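(* Let $G\subset\mathbb{R}^2$ be a bounded domain with smooth boundary $\partial G=\Gamma_1\cup\Gamma_2\cup\mathcal{K}$, where $\Gamma_1,\Gamma_2$ are $C^\infty$ curves, open and connected in the topology of $\partial G$, with $\Gamma_1\cap\Gamma_2=\varnothing$ and $\overline{\Gamma_1}\cap\overline{\Gamma_2}=\mathcal{K}=\{g_1,g_2\}$ (two points). Assume that for some $\varepsilon>0$ and $i=1,2$, the domain $G$ coincides in the $\varepsilon$-neighborhood $\mathcal{O}_\varepsilon(g_i)$ of $g_i$ with a plane angle of opening $\pi$ (with vertex $g_i$). For $j=1,2,3$ let $C_j(\overline G)$ be the subspace of $C(\overline G)$ (with the sup norm) defined below, and let $\mathbf{P}_j:\mathrm{Dom}(\mathbf{P}_j)\subset C_j(\overline G)\to C_j(\overline G)$ be the unbounded operator $\mathbf{P}_j u=\Delta u$ with $\mathrm{Dom}(\mathbf{P}_j)=\{u\in C_j(\overline G):\ \Delta u\in C_j(\overline G)\}$, where $\Delta$ is the Laplace operator in the sense of distributions in $G$. Case $j=1$: Let $b_1\in C^\infty(\overline{\Gamma_1})$ with $0\le b_1\le 1$, $b_1(y)=\text{const}>0$ for $y\in\mathcal{O}_{\varepsilon/2}(g_1)$, $b_1(y)=0$ for $y\notin\mathcal{O}_\varepsilon(g_1)$; let $\Omega_1$ be a smooth nondegenerate transformation defined on a neighborhood of $\overline{\Gamma_1}$ with $\Omega_1(\Gamma_1)\subset G$, $\Omega_1(g_1)\in G$, such that for $y\in\mathcal{O}_\varepsilon(g_1)$, $\Omega_1(y)$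 is the composition of a rotation about $g_1$ and a shift by some vector. $C_1(\overline G)$ is the set of $u\in C(\overline G)$ with $u(y)-b_1(y)u(\Omega_1(y))=0$ for $y\in\Gamma_1$ and $u(y)=0$ for $y\in\overline{\Gamma_2}$. Case $j=2$: For $k=1,2$ let $b_k\in C^\infty(\overline{\Gamma_k})$ with $0\le b_k\le1$, $b_k(y)=b^*>0$ for $y\in\mathcal{O}_{\varepsilon/2}(g_1)$ (the same constant $b^*$ for $k=1,2$), $b_k(y)=0$ for $y\notin\mathcal{O}_\varepsilon(g_1)$; let $\Omega_k$ be a smooth nondegenerate transformation defined on a neighborhood of $\overline{\Gamma_k}$ with $\Omega_k(\Gamma_k)\subset G$, $\Omega_k(g_1)\in G$, $\Omega_1(g_1)\neq\Omega_2(g_1)$, such that for $y\in\mathcal{O}_\varepsilon(g_1)$, $\Omega_k(y)$ is the composition of a rotation about $g_1$ and a shift by some vector. $C_2(\overline G)$ is the set of $u\in C(\overline G)$ with $u(y)-b_1(y)u(\Omega_1(y))=0$ for $y\in\overline{\Gamma_1}$ and $u(y)-b_2(y)u(\Omega_2(y))=0$ for $y\in\Gamma_2$. Case $j=3$: For $k=1,2$ let $b_k\in C^\infty(\overline{\Gamma_k})$ with $0\le b_k\le 1$, $b_k(y)=1$ for $y\in\mathcal{O}_{\varepsilon/2}(g_1)$, $b_k(y)=0$ for $y\notin\mathcal{O}_\varepsilon(g_1)$; let $\Omega_k$ be a smooth nondegenerate transformation defined on a neighborhood of $\overline{\Gamma_k}$ with $\Omega_k(\Gamma_k)\subset G$,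 $\Omega_k(g_1)=g_1$, such that for $y\in\mathcal{O}_\varepsilon(g_1)$, $\Omega_k(y)$ is the rotation (about $g_1$) by the angle $\pi/2$ inwards the region $G$. $C_3(\overline G)$ is the set of $u\in C(\overline G)$ with $u(y)-b_k(y)u(\Omega_k(y))=0$ for $y\in\Gamma_k$, $k=1,2$, and $u(y)=0$ for $y\in\mathcal{K}$. Then for each $j=1,2,3$ the operator $\mathbf{P}_j$ admits a closure $\overline{\mathbf{P}_j}:\mathrm{Dom}(\overline{\mathbf{P}_j})\subset C_j(\overline G)\to C_j(\overline G)$, and $\overline{\mathbf{P}_j}$ is not the generator of a Feller semigroup on $C_j(\overline G)$.
   Context: A Feller semigroup on a Banach space $C_j(\overline G)$ of continuous real functions (sup norm) is a strongly continuous semigroup of bounded linear operators $\{T_t\}_{t\ge0}$ on $C_j(\overline G)$ which is contractive ($\|T_t\|\le 1$) and nonnegative ($T_tu\ge0$ whenever $u\ge0$). $\mathcal{O}_r(g)$ denotes the open disc of radius $r$ centered at $g$. A transformation is called nondegenerate if its Jacobian does not vanish. *)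

theory Defs
  imports "HOL-Analysis.Analysis"
begin

text \<open>The plane R^2 is modelled by the type complex (as a real Euclidean space).
Derivatives are real Frechet derivatives.\<close>

fun higher_diff_on :: "nat \<Rightarrow> ('a::real_normed_vector \<Rightarrow> 'b::real_normed_vector) \<Rightarrow> 'a set \<Rightarrow> bool" where
  "higher_diff_on 0 f S = continuous_on S f"
| "higher_diff_on (Suc k) f S =
     ((\<forall>x\<in>S. f differentiable (at x)) \<and>
      (\<forall>v. higher_diff_on k (\<lambda>x. frechet_derivative f (at x) v) S))"

definition smooth_on :: "('a::real_normed_vector \<Rightarrow> 'b::real_normed_vector) \<Rightarrow> 'a set \<Rightarrow> bool" where
  "smooth_on f S \<longleftrightarrow> open S \<and> (\<forall>k. higher_diff_on k f S)"

definition smooth_on_set :: "('a::real_normed_vector \<Rightarrow> 'b::real_normed_vector) \<Rightarrow> 'a set \<Rightarrow> bool" where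
  "smooth_on_set f K \<longleftrightarrow> (\<exists>U h. open U \<and> K \<subseteq> U \<and> smooth_on h U \<and> (\<forall>y\<in>K. h y = f y))"

definition smooth_boundary :: "complex set \<Rightarrow> bool" where
  "smooth_boundary G \<longleftrightarrow>
     (\<forall>p\<in>frontier G. \<exists>U \<psi>. open U \<and> p \<in> U \<and> smooth_on (\<psi> :: complex \<Rightarrow> real) U \<and>
        (\<forall>y\<in>U. frechet_derivative \<psi> (at y) \<noteq> (\<lambda>v. 0)) \<and>
        G \<inter> U = {y\<in>U. \<psi> y < 0})"

definition jacobian :: "(complex \<Rightarrow> complex) \<Rightarrow> complex \<Rightarrow> real" where
  "jacobian \<Omega> y = (let a = frechet_derivative \<Omega> (at y) 1; b = frechet_derivative \<Omega> (at y) \<i>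
                    in Re a * Im b - Im a * Re b)"

definition smooth_nondeg_on :: "(complex \<Rightarrow> complex) \<Rightarrow> complex set \<Rightarrow> bool" where
  "smooth_nondeg_on \<Omega> U \<longleftrightarrow> smooth_on \<Omega> U \<and> (\<forall>y\<in>U. jacobian \<Omega> y \<noteq> 0)"

definition laplacian :: "(complex \<Rightarrow> real) \<Rightarrow> complex \<Rightarrow> real" where
  "laplacian \<phi> x =
     frechet_derivative (\<lambda>y. frechet_derivative \<phi> (at y) 1) (at x) 1 +
     frechet_derivative (\<lambda>y. frechet_derivative \<phi> (at y) \<i>) (at x) \<i>"

definition test_fun :: "complex set \<Rightarrow> (complex \<Rightarrow> real) \<Rightarrow> bool" where
  "test_fun G \<phi> \<longleftrightarrow> smooth_on \<phi> UNIV \<and> compact (closure {x. \<phi> x \<noteq> 0}) \<and>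
                      closure {x. \<phi> x \<noteq> 0} \<subseteq> G"

definition dist_laplacian_eq :: "complex set \<Rightarrow> (complex \<Rightarrow> real) \<Rightarrow> (complex \<Rightarrow> real) \<Rightarrow> bool" where
  "dist_laplacian_eq G u f \<longleftrightarrow>
     (\<forall>\<phi>. test_fun G \<phi> \<longrightarrow>
        integral G (\<lambda>x. u x * laplacian \<phi> x) = integral G (\<lambda>x. f x * \<phi> x))"

text \<open>C(closure G), elements represented by functions vanishing outside closure G.\<close>
definition CG :: "complex set \<Rightarrow> (complex \<Rightarrow> real) set" where
  "CG G = {u. continuous_on (closure G) u \<and> (\<forall>x. x \<notin> closure G \<longrightarrow> u x = 0)}"

definition supn :: "complex set \<Rightarrow> (complex \<Rightarrow> real) \<Rightarrow> real" where
  "supn G u = (SUP x\<in>closure G. \<bar>u x\<bar>)"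

definition lap_graph :: "complex set \<Rightarrow> (complex \<Rightarrow> real) set \<Rightarrow> ((complex \<Rightarrow> real) \<times> (complex \<Rightarrow> real)) set" where
  "lap_graph G X = {(u, f). u \<in> X \<and> f \<in> X \<and> dist_laplacian_eq G u f}"

definition graph_closure :: "complex set \<Rightarrow> (complex \<Rightarrow> real) set \<Rightarrow>
    ((complex \<Rightarrow> real) \<times> (complex \<Rightarrow> real)) set \<Rightarrow> ((complex \<Rightarrow> real) \<times> (complex \<Rightarrow> real)) set" where
  "graph_closure G X Gr = {(u, f). u \<in> X \<and> f \<in> X \<and>
     (\<exists>s. (\<forall>n. s n \<in> Gr) \<and>
          (\<lambda>n. supn G (\<lambda>x. fst (s n) x - u x)) \<longlonglongrightarrow> 0 \<and>
          (\<lambda>n. supn G (\<lambda>x. snd (s n) x - f x)) \<longlonglongrightarrow> 0)}"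

definition closable :: "complex set \<Rightarrow> (complex \<Rightarrow> real) set \<Rightarrow>
    ((complex \<Rightarrow> real) \<times> (complex \<Rightarrow> real)) set \<Rightarrow> bool" where
  "closable G X Gr \<longleftrightarrow>
     (\<forall>u f f'. (u, f) \<in> graph_closure G X Gr \<longrightarrow> (u, f') \<in> graph_closure G X Gr \<longrightarrow>
        f = f')"

definition feller_semigroup :: "complex set \<Rightarrow> (complex \<Rightarrow> real) set \<Rightarrow>
    (real \<Rightarrow> (complex \<Rightarrow> real) \<Rightarrow> (complex \<Rightarrow> real)) \<Rightarrow> bool" where
  "feller_semigroup G X T \<longleftrightarrow>
     (\<forall>t\<ge>0. \<forall>u\<in>X. T t u \<in> X) \<and>
     (\<forall>t\<ge>0. \<forall>u\<in>X. \<forall>v\<in>X. \<forall>a b. T t (\<lambda>x. a * u x + b * v x) = (\<lambda>x. a * T t u x + b * T t v x)) \<and>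
     (\<forall>u\<in>X. T 0 u = u) \<and>
     (\<forall>s\<ge>0. \<forall>t\<ge>0. \<forall>u\<in>X. T (s + t) u = T s (T t u)) \<and>
     (\<forall>u\<in>X. ((\<lambda>t. supn G (\<lambda>x. T t u x - u x)) \<longlongrightarrow> 0) (at_right 0)) \<and>
     (\<forall>t\<ge>0. \<forall>u\<in>X. supn G (T t u) \<le> supn G u) \<and>
     (\<forall>t\<ge>0. \<forall>u\<in>X. (\<forall>x\<in>closure G. u x \<ge> 0) \<longrightarrow> (\<forall>x\<in>closure G. T t u x \<ge> 0))"

definition is_generator :: "complex set \<Rightarrow> (complex \<Rightarrow> real) set \<Rightarrow>
    (real \<Rightarrow> (complex \<Rightarrow> real) \<Rightarrow> (complex \<Rightarrow> real)) \<Rightarrow>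
    ((complex \<Rightarrow> real) \<times> (complex \<Rightarrow> real)) set \<Rightarrow> bool" where
  "is_generator G X T Gr \<longleftrightarrow>
     (\<forall>u\<in>X. \<forall>f\<in>X. (u, f) \<in> Gr \<longleftrightarrow>
        ((\<lambda>t. supn G (\<lambda>x. (T t u x - u x) / t - f x)) \<longlongrightarrow> 0) (at_right 0))"

definition feller_generator :: "complex set \<Rightarrow> (complex \<Rightarrow> real) set \<Rightarrow>
    ((complex \<Rightarrow> real) \<times> (complex \<Rightarrow> real)) set \<Rightarrow> bool" where
  "feller_generator G X Gr \<longleftrightarrow> (\<exists>T. feller_semigroup G X T \<and> is_generator G X T Gr)"

definition rot :: "complex \<Rightarrow> real \<Rightarrow> complex \<Rightarrow> complex" where
  "rot g \<theta> y = g + cis \<theta> * (y - g)"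

definition half_plane_near :: "complex set \<Rightarrow> complex \<Rightarrow> real \<Rightarrow> bool" where
  "half_plane_near G g \<epsilon> \<longleftrightarrow>
     (\<exists>d. d \<noteq> 0 \<and> G \<inter> ball g \<epsilon> = {y\<in>ball g \<epsilon>. Im (cnj d * (y - g)) > 0})"

definition nonlocal_data :: "complex set \<Rightarrow> complex set \<Rightarrow> complex \<Rightarrow> real \<Rightarrow>
    (complex \<Rightarrow> real) \<Rightarrow> (complex \<Rightarrow> complex) \<Rightarrow> complex set \<Rightarrow> bool" where
  "nonlocal_data G \<Gamma> g \<epsilon> b \<Omega> U \<longleftrightarrow>
     smooth_on_set b (closure \<Gamma>) \<and>
     (\<forall>y\<in>closure \<Gamma>. 0 \<le> b y \<and> b y \<le> 1) \<and>
     (\<forall>y\<in>closure \<Gamma>. y \<notin> ball g \<epsilon> \<longrightarrow> b y = 0) \<and>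
     open U \<and> closure \<Gamma> \<subseteq> U \<and> smooth_nondeg_on \<Omega> U \<and> \<Omega> ` \<Gamma> \<subseteq> G"

end

theory Submission
  imports Defs
begin

text \<open>If the closure of \<open>P\<^sub>j\<close> generated a Feller semigroup, then for every \<open>f \<ge> 0\<close> in \<open>C\<^sub>j\<close> and \<open>\<lambda> > 0\<close>
  there would be \<open>u \<ge> 0\<close> in \<open>C\<^sub>j\<close> with \<open>\<lambda>u - \<Delta>u = f\<close>, and this contradicts constraints that all elements of
  \<open>C\<^sub>j\<close> inherit at \<open>g\<^sub>1\<close> by continuity. For \<open>j = 1\<close> every \<open>u\<close> vanishes at the interior point \<open>\<Omega>\<^sub>1(g\<^sub>1)\<close>, against
  the strong minimum principle. For \<open>j = 2\<close> every \<open>u\<close> takes equal values at the distinct interior points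
  \<open>\<Omega>\<^sub>1(g\<^sub>1)\<close> and \<open>\<Omega>\<^sub>2(g\<^sub>1)\<close>, but for large \<open>\<lambda>\<close> and \<open>f\<close> supported close to the first point \<open>u\<close> is exponentially
  smaller at the second one. For \<open>j = 3\<close> we have \<open>u(g\<^sub>1) = 0\<close>, but near \<open>g\<^sub>1\<close> the boundary values of \<open>u\<close> are
  attained inside \<open>G\<close> at the same distance from \<open>g\<^sub>1\<close>, so that comparison with
  \<open>m(1 + r\<^sup>2)/4 + \<eta> log (r/\<rho>)\<close>, \<open>\<eta> \<rightarrow> 0\<close>, bounds \<open>u(g\<^sub>1)\<close> away from zero.
  Only the explicit test functions \<open>exp(-1/(s\<^sup>2 - \<bar>x - q\<bar>\<^sup>2))\<close> are ever needed.\<close>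

section \<open>Smooth bump functions\<close>

text \<open>Elements of the domain of the closure are merely continuous, with a Laplacian in the
  sense of distributions. All maximum principles are therefore applied at touching points and with
  explicit radial barriers, instead of elliptic regularity or Green functions. Two obstacles shape
  the rest. The right-hand side f has to lie in C_j itself, hence must satisfy the nonlocal
  conditions; it is supported away from the boundary and from the lines that contain the images of
  those boundary points where b is nonzero. And little is known of u at the boundary beyond 0 <= u
  <= sup f / lambda, so for j = 1, 2 the comparison takes place in discs inside G. The constraint
  for j = 1 arises because the Dirichlet condition gives u(g1) = 0, while the limit along Gamma_1
  gives u(g1) = c u(Omega_1(g1)) with c > 0; for j = 2 the two limits at g1 carry the same constant.
  For j = 3 no interior value is constrained. The logarithm enters because it is harmonic off g1 and
  tends to minus infinity there, so that an arbitrarily small multiple of it pushes the barrier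
  below u on a small circle.\<close>

definition expinv :: "nat \<Rightarrow> real \<Rightarrow> real" where
  "expinv n t = (if t > 0 then exp (- (1 / t)) / t ^ n else 0)"

lemma expinv_nonneg: "expinv n t \<ge> 0"
  by (simp add: expinv_def)

lemma expinv_tendsto_0: "(expinv n \<longlongrightarrow> 0) (at_right 0)"
proof -
  have "((\<lambda>x::real. x ^ n / exp x) \<longlongrightarrow> 0) at_top"
    by (rule tendsto_power_div_exp_0)
  then have "((\<lambda>x::real. inverse x ^ n / exp (inverse x)) \<longlongrightarrow> 0) (at_right 0)"
    by (rule filterlim_compose[OF _ filterlim_inverse_at_top_right])
  then show ?thesis
    by (rule Lim_transform_eventually)
      (auto simp: eventually_at_right_less expinv_def field_simps exp_minus
        intro!: eventually_mono[OF eventually_at_right_less[of "0::real"]])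
qed

text \<open>Differentiating exp(-1/t)/t^n only changes the exponent n, so the family is closed under
  differentiation up to linear combinations. At t = 0 the right difference quotient is
  \<open>expinv (Suc n)\<close>, which tends to 0.\<close>

lemma expinv_has_real_derivative:
  "(expinv n has_real_derivative expinv (n + 2) t - real n * expinv (n + 1) t) (at t)"
proof -
  consider "t > 0" | "t < 0" | "t = 0" by linarith
  then show ?thesis
  proof cases
    case 1
    have "((\<lambda>t. exp (- (1 / t)) / t ^ n) has_real_derivative
        expinv (n + 2) t - real n * expinv (n + 1) t) (at t)"
      using 1 
      apply (cases n)
       apply (auto intro!: derivative_eq_intros simp: expinv_def field_simps power2_eq_square)
      subgoal for k by (cases k) auto
      done
    then show ?thesis
      by (rule has_field_derivative_transform_within_open[where S = "{0<..}"])
        (use 1 in \<open>auto simp: expinv_def\<close>)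
  next
    case 2
    have "((\<lambda>t. 0) has_real_derivative 0) (at t)" by simp
    then have "(expinv n has_real_derivative 0) (at t)"
      by (rule has_field_derivative_transform_within_open[where S = "{..<0}"])
        (use 2 in \<open>auto simp: expinv_def\<close>)
    then show ?thesis using 2 by (simp add: expinv_def)
  next
    case 3
    have "((\<lambda>y. (expinv n y - expinv n 0) / (y - 0)) \<longlongrightarrow> 0) (at_right 0)"
      by (rule Lim_transform_eventually[OF expinv_tendsto_0[of "Suc n"]])
        (auto simp: expinv_def intro!: eventually_mono[OF eventually_at_right_less[of "0::real"]])
    moreover have "((\<lambda>y. (expinv n y - expinv n 0) / (y - 0)) \<longlongrightarrow> 0) (at_left 0)"
      by (rule Lim_transform_eventually[OF tendsto_const])
        (auto simp: expinv_def eventually_at_filter)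
    ultimately have "(expinv n has_real_derivative 0) (at 0)"
      by (simp add: has_field_derivative_iff filterlim_at_split)
    then show ?thesis using 3 by (simp add: expinv_def)
  qed
qed

definition bump :: "real \<Rightarrow> complex \<Rightarrow> complex \<Rightarrow> real" where
  "bump s q x = expinv 0 (s\<^sup>2 - (norm (x - q))\<^sup>2)"

text \<open>The chain rule for e_0(T), where e_n is \<open>expinv n\<close>: e_0' = e_2, e_0'' = e_4
  - 2 e_3, and in the plane T has gradient -2(x - q) and Laplacian -4.\<close>

definition lap_bump :: "real \<Rightarrow> complex \<Rightarrow> complex \<Rightarrow> real" where
  "lap_bump s q x = (let T = s\<^sup>2 - (norm (x - q))\<^sup>2 in
     4 * (norm (x - q))\<^sup>2 * (expinv 4 T - 2 * expinv 3 T) - 4 * expinv 2 T)"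

text \<open>\<open>higher_diff_on\<close> asks for all iterated directional derivatives. A class of
  functions closed under every directional derivative reduces this to an induction on the
  order.\<close>

inductive_set bump_algebra :: "real \<Rightarrow> complex \<Rightarrow> (complex \<Rightarrow> real) set" for s q where
  const: "(\<lambda>x. c) \<in> bump_algebra s q"
| expinv: "(\<lambda>x. expinv n (s\<^sup>2 - (norm (x - q))\<^sup>2)) \<in> bump_algebra s q"
| inner: "(\<lambda>x. inner (x - q) w) \<in> bump_algebra s q"
| add: "f \<in> bump_algebra s q \<Longrightarrow> g \<in> bump_algebra s q \<Longrightarrow> (\<lambda>x. f x + g x) \<in> bump_algebra s q"
| mult: "f \<in> bump_algebra s q \<Longrightarrow> g \<in> bump_algebra s q \<Longrightarrow> (\<lambda>x. f x * g x) \<in> bump_algebra s q"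

lemma expinv_comp_has_derivative:
  "((\<lambda>x::complex. expinv n (s\<^sup>2 - (norm (x - q))\<^sup>2)) has_derivative
     (\<lambda>v. (expinv (n + 2) (s\<^sup>2 - (norm (x - q))\<^sup>2)
            - real n * expinv (n + 1) (s\<^sup>2 - (norm (x - q))\<^sup>2)) * (- 2 * inner (x - q) v))) (at x)"
proof -
  have 1: "((\<lambda>x::complex. s\<^sup>2 - (norm (x - q))\<^sup>2) has_derivative (\<lambda>v. - 2 * inner (x - q) v)) (at x)"
    unfolding power2_norm_eq_inner
    by (auto intro!: derivative_eq_intros simp: inner_commute)
  have "(expinv n has_derivative (\<lambda>h. (expinv (n + 2) (s\<^sup>2 - (norm (x - q))\<^sup>2)
            - real n * expinv (n + 1) (s\<^sup>2 - (norm (x - q))\<^sup>2)) * h))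
      (at (s\<^sup>2 - (norm (x - q))\<^sup>2))"
    using expinv_has_real_derivative by (rule has_field_derivative_imp_has_derivative)
  from has_derivative_compose[OF 1 this] show ?thesis .
qed

lemma bump_algebra_derivative:
  assumes "f \<in> bump_algebra s q"
  shows "\<exists>f'. (\<forall>x. (f has_derivative f' x) (at x)) \<and> (\<forall>v. (\<lambda>x. f' x v) \<in> bump_algebra s q)"
  using assms
proof induction
  case (const c)
  show ?case by (rule exI[of _ "\<lambda>x v. 0"]) (auto intro: bump_algebra.const)
next
  case (expinv n)
  have "(\<lambda>x. (expinv (n + 2) (s\<^sup>2 - (norm (x - q))\<^sup>2)
      + (- real n) * expinv (n + 1) (s\<^sup>2 - (norm (x - q))\<^sup>2)) * (- 2 * inner (x - q) v)) \<in> bump_algebra s q" for v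
    by (intro bump_algebra.intros)
  then show ?case
    using expinv_comp_has_derivative[of n s q] by (intro exI conjI allI) (assumption, simp)
next
  case (inner w)
  show ?case
    by (rule exI[of _ "\<lambda>x v. inner v w"])
      (auto intro!: derivative_eq_intros bump_algebra.const)
next
  case (add f g)
  then obtain f' g' where "\<forall>x. (f has_derivative f' x) (at x)" "\<forall>v. (\<lambda>x. f' x v) \<in> bump_algebra s q"
    "\<forall>x. (g has_derivative g' x) (at x)" "\<forall>v. (\<lambda>x. g' x v) \<in> bump_algebra s q" by blast
  then show ?case
    by (intro exI[of _ "\<lambda>x v. f' x v + g' x v"]) (auto intro!: derivative_eq_intros bump_algebra.add)
next
  case (mult f g)
  then obtain f' g' where "\<forall>x. (f has_derivative f' x) (at x)" "\<forall>v. (\<lambda>x. f' x v) \<in> bump_algebra s q"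
    "\<forall>x. (g has_derivative g' x) (at x)" "\<forall>v. (\<lambda>x. g' x v) \<in> bump_algebra s q" by blast
  with mult show ?case
    by (intro exI[of _ "\<lambda>x v. f x * g' x v + f' x v * g x"])
      (auto intro!: has_derivative_mult bump_algebra.add bump_algebra.mult)
qed

lemma bump_algebra_higher_diff:
  "f \<in> bump_algebra s q \<Longrightarrow> higher_diff_on k f UNIV"
proof (induction k arbitrary: f)
  case 0
  then obtain f' where "\<forall>x. (f has_derivative f' x) (at x)" using bump_algebra_derivative by blast
  then have "isCont f x" for x using has_derivative_continuous by blast
  then show ?case by (simp add: continuous_at_imp_continuous_on)
next
  case (Suc k)
  then obtain f' where f': "\<forall>x. (f has_derivative f' x) (at x)" "\<forall>v. (\<lambda>x. f' x v) \<in> bump_algebra s q"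
    using bump_algebra_derivative by blast
  then have "frechet_derivative f (at x) = f' x" for x using frechet_derivative_at by metis
  with f' Suc.IH show ?case by (auto simp: differentiable_def)
qed

lemma bump_pos_iff:
  assumes "s > 0" shows "bump s q x \<noteq> 0 \<longleftrightarrow> x \<in> ball q s"
  using assms by (auto simp: bump_def expinv_def dist_norm norm_minus_commute power_strict_mono not_less
    dest: power2_le_imp_le power2_less_imp_less)

lemma test_fun_bump:
  assumes "s > 0" "cball q s \<subseteq> G"
  shows "test_fun G (bump s q)"
proof -
  have "bump s q \<in> bump_algebra s q" 
    unfolding bump_def[abs_def] by (rule bump_algebra.expinv)
  then have "smooth_on (bump s q) UNIV"
    by (simp add: smooth_on_def bump_algebra_higher_diff)
  moreover have "{x. bump s q x \<noteq> 0} = ball q s" using bump_pos_iff[OF assms(1)] by blast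
  ultimately show ?thesis using assms by (simp add: test_fun_def)
qed

lemma bump_has_derivative:
  "(bump s q has_derivative (\<lambda>v. - 2 * inner (x - q) v * expinv 2 (s\<^sup>2 - (norm (x - q))\<^sup>2))) (at x)"
  using expinv_comp_has_derivative[of 0 s q x] unfolding bump_def[abs_def]
  by (simp add: algebra_simps numeral_2_eq_2)

text \<open>The second derivative of \<open>bump\<close> in the single direction \<open>v\<close>:
  the discrete Laplacian used below splits into one-dimensional second differences along 1 and
  \<open>\<i>\<close>.\<close>

definition bump2 :: "real \<Rightarrow> complex \<Rightarrow> complex \<Rightarrow> complex \<Rightarrow> real" where
  "bump2 s q v x = (let T = s\<^sup>2 - (norm (x - q))\<^sup>2 in
     4 * (inner (x - q) v)\<^sup>2 * (expinv 4 T - 2 * expinv 3 T) - 2 * (norm v)\<^sup>2 * expinv 2 T)"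

lemma bump_has_second_derivative:
  "((\<lambda>x::complex. - 2 * inner (x - q) v * expinv 2 (s\<^sup>2 - (norm (x - q))\<^sup>2)) has_derivative
     (\<lambda>w. 4 * inner (x - q) v * inner (x - q) w * (expinv 4 (s\<^sup>2 - (norm (x - q))\<^sup>2) - 2 * expinv 3 (s\<^sup>2 - (norm (x - q))\<^sup>2))
       - 2 * inner w v * expinv 2 (s\<^sup>2 - (norm (x - q))\<^sup>2))) (at x)"
  by (rule has_derivative_eq_rhs, rule has_derivative_mult[OF _ expinv_comp_has_derivative])
    (auto intro!: derivative_eq_intros simp: algebra_simps eval_nat_numeral)

lemma laplacian_bump: "laplacian (bump s q) = lap_bump s q"
proof
  fix x
  have 1: "frechet_derivative (bump s q) (at y) = (\<lambda>v. - 2 * inner (y - q) v * expinv 2 (s\<^sup>2 - (norm (y - q))\<^sup>2))" for y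
    using frechet_derivative_at[OF bump_has_derivative] by metis
  have 2: "frechet_derivative (\<lambda>x. - 2 * inner (x - q) v * expinv 2 (s\<^sup>2 - (norm (x - q))\<^sup>2)) (at x) v = bump2 s q v x" for v
    unfolding frechet_derivative_at[OF bump_has_second_derivative, symmetric]
    by (simp add: bump2_def Let_def power2_eq_square dot_square_norm)
  have 3: "(norm (x - q))\<^sup>2 = (inner (x - q) 1)\<^sup>2 + (inner (x - q) \<i>)\<^sup>2"
    by (simp add: inner_complex_def cmod_power2)
  show "laplacian (bump s q) x = lap_bump s q x"
    unfolding laplacian_def 1 2 lap_bump_def bump2_def Let_def
    by (simp add: 3 algebra_simps)
qed

lemma bump2_sum: "bump2 s q 1 x + bump2 s q \<i> x = lap_bump s q x"
proof -
  have "(norm (x - q))\<^sup>2 = (inner (x - q) 1)\<^sup>2 + (inner (x - q) \<i>)\<^sup>2"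
    by (simp add: inner_complex_def cmod_power2)
  then show ?thesis
    unfolding lap_bump_def bump2_def Let_def by (simp add: algebra_simps)
qed

lemma continuous_on_expinv: "continuous_on S (expinv n)"
  using expinv_has_real_derivative DERIV_isCont continuous_at_imp_continuous_on by blast

lemma continuous_on_expinv_comp [continuous_intros]:
  "continuous_on S g \<Longrightarrow> continuous_on S (\<lambda>x. expinv n (g x))"
  using continuous_on_compose2[OF continuous_on_expinv] by blast

lemma continuous_on_bump: "continuous_on S (bump s q)"
  unfolding bump_def[abs_def] by (intro continuous_intros)

lemma continuous_on_bump2: "continuous_on S (bump2 s q v)"
  unfolding bump2_def[abs_def] Let_def by (intro continuous_intros)

lemma continuous_on_lap_bump: "continuous_on S (lap_bump s q)"
  unfolding lap_bump_def[abs_def] Let_def by (intro continuous_intros)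

lemma bump_nonneg: "bump s q x \<ge> 0"
  by (simp add: bump_def expinv_nonneg)

lemma bump_eq_0: "s > 0 \<Longrightarrow> x \<notin> cball q s \<Longrightarrow> bump s q x = 0"
  using bump_pos_iff[of s q x] by auto

lemma lap_bump_eq_0: 
  assumes "s > 0" "x \<notin> cball q s" shows "lap_bump s q x = 0"
proof -
  have "s\<^sup>2 \<le> (norm (x - q))\<^sup>2"
    using assms by (intro power_mono) (auto simp: dist_norm norm_minus_commute)
  then show ?thesis by (simp add: lap_bump_def expinv_def)
qed

lemma bump_shift: "bump s (q + v) x = bump s q (x - v)"
  by (simp add: bump_def algebra_simps)

section \<open>Uniform convergence of second differences of the bump function\<close>

lemma uniformly_continuous_on_bounded:
  fixes g :: "'a::heine_borel \<Rightarrow> 'b::metric_space"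
  assumes "continuous_on UNIV g" "bounded A"
  shows "uniformly_continuous_on A g"
proof -
  have "uniformly_continuous_on (closure A) g"
    using assms by (intro compact_uniformly_continuous) (auto intro: continuous_on_subset)
  then show ?thesis
    unfolding uniformly_continuous_on_def by (meson closure_subset subsetD)
qed

text \<open>Taylor's formula of order two for the even function g(t) + g(-t), whose first-order term
  at 0 vanishes.\<close>

lemma second_difference_mean_value:
  fixes g :: "real \<Rightarrow> real"
  assumes "h > 0" "\<And>t. (g has_real_derivative g' t) (at t)" "\<And>t. (g' has_real_derivative g'' t) (at t)"
  shows "\<exists>t. 0 < t \<and> t < h \<and> g h + g (- h) - 2 * g 0 = (g'' t + g'' (- t)) / 2 * h\<^sup>2"
proof -
  define diff where "diff m = (if m = 0 then (\<lambda>t. g t + g (- t)) else if m = 1 then (\<lambda>t. g' t - g' (- t))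
     else (\<lambda>t. g'' t + g'' (- t)))" for m :: nat
  have neg: "((\<lambda>t. f (- t)) has_real_derivative - f' (- t)) (at t)"
    if "\<And>t. (f has_real_derivative f' t) (at t)" for f f' :: "real \<Rightarrow> real" and t
    using DERIV_mirror[of f "f' (- t)" t] that[of "- t"] by simp
  have d: "(diff m has_real_derivative diff (Suc m) t) (at t)" if "m < 2" for m t
  proof (cases "m = 0")
    case True
    then show ?thesis
      using DERIV_add[OF assms(2)[of t] neg[OF assms(2), of t]] by (simp add: diff_def)
  next
    case False
    with that have "m = 1" by simp
    then show ?thesis
      using DERIV_diff[OF assms(3)[of t] neg[OF assms(3), of t]] by (simp add: diff_def)
  qed
  from Maclaurin[OF \<open>h > 0\<close>, of 2 diff "diff 0"] d
  obtain t where t: "0 < t" "t < h"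
    "diff 0 h = (\<Sum>m<2. diff m 0 / fact m * h ^ m) + diff 2 t / fact 2 * h ^ 2" by auto
  have "(\<Sum>m<2. diff m 0 / fact m * h ^ m) = 2 * g 0"
    by (simp add: numeral_2_eq_2 diff_def)
  with t show ?thesis by (intro exI[of _ t]) (simp add: diff_def)
qed

text \<open>The bound is uniform in \<open>x\<close>, which allows the limit to be taken under an
  integral over the bounded set \<open>G\<close>. It comes from uniform continuity of
  \<open>bump2\<close> on a large disc.\<close>

lemma bump_second_difference:
  assumes "bounded A" "e > 0" "norm v = 1"
  shows "\<exists>d>0. \<forall>h x. 0 < h \<and> h < d \<and> x \<in> A \<longrightarrow>
    \<bar>(bump s q (x + of_real h * v) + bump s q (x - of_real h * v) - 2 * bump s q x) / h\<^sup>2 - bump2 s q v x\<bar> \<le> e"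
proof -
  obtain B where B: "\<And>x. x \<in> A \<Longrightarrow> norm x \<le> B" using assms(1) bounded_iff by blast
  have "uniformly_continuous_on (cball 0 (B + 1)) (bump2 s q v)"
    by (intro uniformly_continuous_on_bounded continuous_on_bump2) simp
  then obtain d where d: "d > 0" "\<And>x y. x \<in> cball 0 (B + 1) \<Longrightarrow> y \<in> cball 0 (B + 1) \<Longrightarrow> dist x y < d
      \<Longrightarrow> dist (bump2 s q v x) (bump2 s q v y) < e"
    using assms(2) unfolding uniformly_continuous_on_def by metis
  show ?thesis
  \<comment> \<open>The bound 1 on \<open>h\<close> keeps the intermediate points of the mean value
    formula in the disc of radius \<open>B + 1\<close>.\<close>
  proof (intro exI[of _ "min d 1"] conjI allI impI)
    show "min d 1 > 0" using d by simp
    fix h x assume h: "0 < h \<and> h < min d 1 \<and> x \<in> A"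
    define g where "g t = bump s q (x + of_real t * v)" for t
    define g' where "g' t = - 2 * inner (x + of_real t * v - q) v * expinv 2 (s\<^sup>2 - (norm (x + of_real t * v - q))\<^sup>2)" for t
    have line: "((\<lambda>t. x + of_real t * v) has_derivative (\<lambda>k. of_real k * v)) (at t)" for t :: real
      by (auto intro!: derivative_eq_intros)
    have inner: "inner y (of_real k * v) = k * inner y v" "inner (of_real k * v) v = k" for y k
      using assms(3) by (simp_all add: scaleR_conv_of_real[symmetric] dot_square_norm)
    have "(g has_real_derivative g' t) (at t)" for t
      using has_derivative_compose[OF line bump_has_derivative[of s q]]
      unfolding g_def[abs_def] g'_def has_field_derivative_def
      by (rule has_derivative_eq_rhs) (auto simp: inner)
    moreover have "(g' has_real_derivative bump2 s q v (x + of_real t * v)) (at t)" for t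
      using has_derivative_compose[OF line bump_has_second_derivative[where q = q and v = v and s = s]]
      unfolding g'_def[abs_def] has_field_derivative_def
      by (rule has_derivative_eq_rhs)
        (simp add: fun_eq_iff bump2_def Let_def inner assms(3) left_diff_distrib power2_eq_square[of "inner _ v"])
    ultimately obtain t where t: "0 < t" "t < h"
      "g h + g (- h) - 2 * g 0 = (bump2 s q v (x + of_real t * v) + bump2 s q v (x - of_real t * v)) / 2 * h\<^sup>2"
      using second_difference_mean_value[of h g g' "\<lambda>t. bump2 s q v (x + of_real t * v)"] h by auto
    have n: "norm (of_real t * v) = t" using t assms(3) by (simp add: norm_mult)
    have x: "norm x \<le> B" using B h by auto
    have "x + of_real t * v \<in> cball 0 (B + 1)" "x - of_real t * v \<in> cball 0 (B + 1)" "x \<in> cball 0 (B + 1)"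
      using norm_triangle_ineq[of x "of_real t * v"] norm_triangle_ineq4[of x "of_real t * v"] n t h x
      by auto
    moreover have "dist (x + of_real t * v) x < d" "dist (x - of_real t * v) x < d"
      using n t h by (auto simp: dist_norm)
    ultimately have b: "\<bar>bump2 s q v (x + of_real t * v) - bump2 s q v x\<bar> < e"
      "\<bar>bump2 s q v (x - of_real t * v) - bump2 s q v x\<bar> < e"
      using d(2) by (auto simp: dist_real_def)
    have mid: "\<bar>(a + b) / 2 - c\<bar> \<le> e" if "\<bar>a - c\<bar> < e" "\<bar>b - c\<bar> < e" for a b c :: real
      using that by (simp add: abs_le_iff abs_less_iff field_simps)
    have eq: "(bump s q (x + of_real h * v) + bump s q (x - of_real h * v) - 2 * bump s q x) / h\<^sup>2
       = (bump2 s q v (x + of_real t * v) + bump2 s q v (x - of_real t * v)) / 2"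
      using t(3) h by (simp add: g_def)
    show "\<bar>(bump s q (x + of_real h * v) + bump s q (x - of_real h * v) - 2 * bump s q x) / h\<^sup>2 - bump2 s q v x\<bar> \<le> e"
      unfolding eq by (rule mid[OF b])
  qed
qed

text \<open>The five-point discrete Laplacian. Its sign at a local minimum is visible without any
  differentiability, and being built from translations it passes through a convolution
  directly.\<close>

definition star_diff :: "(complex \<Rightarrow> real) \<Rightarrow> complex \<Rightarrow> real \<Rightarrow> real" where
  "star_diff z x h = (z (x + of_real h) + z (x - of_real h) + z (x + of_real h * \<i>) + z (x - of_real h * \<i>) - 4 * z x) / h\<^sup>2"

definition has_star_laplacian :: "(complex \<Rightarrow> real) \<Rightarrow> real \<Rightarrow> complex \<Rightarrow> bool" where
  "has_star_laplacian z l x \<longleftrightarrow> (star_diff z x \<longlongrightarrow> l) (at_right 0)"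

lemma bump_star_diff:
  assumes "bounded A" "e > 0"
  shows "\<exists>d>0. \<forall>h x. 0 < h \<and> h < d \<and> x \<in> A \<longrightarrow> \<bar>star_diff (bump s q) x h - lap_bump s q x\<bar> \<le> e"
proof -
  from bump_second_difference[OF assms(1), of "e / 2" 1 s q] assms(2)
  obtain d1 where d1: "d1 > 0" "\<And>h x. 0 < h \<and> h < d1 \<and> x \<in> A \<Longrightarrow>
    \<bar>(bump s q (x + of_real h * 1) + bump s q (x - of_real h * 1) - 2 * bump s q x) / h\<^sup>2 - bump2 s q 1 x\<bar> \<le> e / 2"
    by auto
  from bump_second_difference[OF assms(1), of "e / 2" \<i> s q] assms(2)
  obtain d2 where d2: "d2 > 0" "\<And>h x. 0 < h \<and> h < d2 \<and> x \<in> A \<Longrightarrow>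
    \<bar>(bump s q (x + of_real h * \<i>) + bump s q (x - of_real h * \<i>) - 2 * bump s q x) / h\<^sup>2 - bump2 s q \<i> x\<bar> \<le> e / 2"
    by auto
  show ?thesis
  proof (intro exI[of _ "min d1 d2"] conjI allI impI)
    show "min d1 d2 > 0" using d1 d2 by simp
    fix h x assume h: "0 < h \<and> h < min d1 d2 \<and> x \<in> A"
    have add: "\<bar>a + b - (c + d)\<bar> \<le> e" if "\<bar>a - c\<bar> \<le> e / 2" "\<bar>b - d\<bar> \<le> e / 2" for a b c d :: real
      by (rule abs_leI; insert that; linarith)
    have eq: "star_diff (bump s q) x h =
      (bump s q (x + of_real h * 1) + bump s q (x - of_real h * 1) - 2 * bump s q x) / h\<^sup>2 +
      (bump s q (x + of_real h * \<i>) + bump s q (x - of_real h * \<i>) - 2 * bump s q x) / h\<^sup>2"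
      unfolding star_diff_def add_divide_distrib[symmetric] by simp
    show "\<bar>star_diff (bump s q) x h - lap_bump s q x\<bar> \<le> e"
      unfolding eq bump2_sum[symmetric]
      using h by (intro add[OF d1(2) d2(2)]) auto
  qed
qed

section \<open>Integrals against bump functions\<close>

lemma integrable_on_supported:
  fixes u \<phi> :: "complex \<Rightarrow> real"
  assumes "open G" "bounded G" "continuous_on G u" "continuous_on UNIV \<phi>"
    and "\<And>x. x \<notin> cball q s \<Longrightarrow> \<phi> x = 0" "cball q s \<subseteq> G"
  shows "(\<lambda>x. u x * \<phi> x) integrable_on G"
proof -
  \<comment> \<open>Extension of the product by zero. It is continuous on \<open>G\<close> and on
    the complement of the disc, two open sets that cover the plane, so the behaviour of
    \<open>u\<close> at the frontier does not matter.\<close>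
  define w where "w x = (if x \<in> G then u x * \<phi> x else 0)" for x
  have "continuous_on G w"
    by (rule continuous_on_eq[of _ "\<lambda>x. u x * \<phi> x"])
      (auto simp: w_def intro!: continuous_intros assms continuous_on_subset[OF assms(4)])
  moreover have "continuous_on (- cball q s) w"
    by (rule continuous_on_eq[of _ "\<lambda>x. 0"]) (auto simp: w_def assms(5))
  ultimately have "continuous_on (G \<union> - cball q s) w"
    using assms(1) by (intro continuous_on_open_Un) auto
  moreover have "G \<union> - cball q s = UNIV" using assms(6) by auto
  ultimately have w: "continuous_on UNIV w" by simp
  obtain a b where ab: "G \<subseteq> cbox a b" using bounded_subset_cbox_symmetric[OF assms(2)] by metis
  have "w integrable_on cbox a b" 
    by (rule integrable_continuous) (rule continuous_on_subset[OF w], simp)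
  then have "w integrable_on UNIV"
    by (rule integrable_on_superset) (use ab in \<open>auto simp: w_def\<close>)
  then show ?thesis unfolding w_def integrable_restrict_UNIV .
qed

lemma integral_abs_le_measure:
  fixes g :: "complex \<Rightarrow> real"
  assumes "open G" "bounded G" "g integrable_on G" "\<And>x. x \<in> G \<Longrightarrow> \<bar>g x\<bar> \<le> e"
  shows "\<bar>integral G g\<bar> \<le> e * measure lebesgue G"
proof -
  have G: "G \<in> lmeasurable" using assms(1,2) by (simp add: lmeasurable_open)
  then have "(\<lambda>x. e) integrable_on G" "integral G (\<lambda>x. e) = e * measure lebesgue G"
    using lmeasure_integral[OF G] integral_mult_right[of G e "\<lambda>x. 1"]
    by (auto simp: integrable_on_const)
  then show ?thesis
    using integral_norm_bound_integral[OF assms(3), of "\<lambda>x. e"] assms(4) by auto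
qed

text \<open>The mass of the mollifier does not depend on its centre; the mollified function can thus
  be normalised by one constant, which commutes with \<open>star_diff\<close>.\<close>

lemma integral_bump_shift:
  assumes "s > 0" "cball p s \<subseteq> G" "cball q s \<subseteq> G"
  shows "integral G (bump s p) = integral G (bump s q)"
proof -
  have *: "integral S (bump s a) = integral UNIV (bump s a)" if "cball a s \<subseteq> S" for S a
  proof -
    have "(\<lambda>x. if x \<in> S then bump s a x else 0) = bump s a"
      using bump_eq_0[OF assms(1)] that by fastforce
    then show ?thesis using integral_restrict_UNIV[of S "bump s a"] by simp
  qed
  obtain a b where ab: "cball q s \<subseteq> cbox a b"
    using bounded_subset_cbox_symmetric[OF bounded_cball] by metis
  have "cball p s = (+) (p - q) ` cball q s"
    by (metis cball_translation diff_add_cancel)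
  also have "\<dots> \<subseteq> cbox (a + (p - q)) (b + (p - q))"
    using ab cbox_translation[of "p - q" a b] by (auto simp: add.commute)
  finally have 1: "integral (cbox (a + (p - q)) (b + (p - q))) (bump s p) = integral G (bump s p)"
    using * assms(2) by metis
  have "bump s p \<circ> (+) (p - q) = bump s q"
    by (auto simp: bump_def fun_eq_iff algebra_simps)
  then have "integral (cbox a b) (bump s q) = integral (cbox (a + (p - q)) (b + (p - q))) (bump s p)"
    using integral_shift_cbox_plus[of a b "bump s p" "p - q"] by simp
  then show ?thesis using 1 * ab assms(3) by metis
qed

section \<open>Weak solutions and mollification\<close>

definition weak_laplacian :: "complex set \<Rightarrow> (complex \<Rightarrow> real) \<Rightarrow> (complex \<Rightarrow> real) \<Rightarrow> bool" where
  "weak_laplacian G u f \<longleftrightarrow> (\<forall>q s. s > 0 \<longrightarrow> cball q s \<subseteq> G \<longrightarrow>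
     integral G (\<lambda>x. u x * lap_bump s q x) = integral G (\<lambda>x. f x * bump s q x))"

lemma dist_laplacian_eq_imp_weak: "dist_laplacian_eq G u f \<Longrightarrow> weak_laplacian G u f"
  unfolding dist_laplacian_eq_def weak_laplacian_def
  using test_fun_bump laplacian_bump by metis

lemma integrable_mult_bump:
  assumes "open G" "bounded G" "continuous_on G u" "s > 0" "cball q s \<subseteq> G"
  shows "(\<lambda>x. u x * bump s q x) integrable_on G"
  using assms by (intro integrable_on_supported[where q = q and s = s] continuous_on_bump bump_eq_0) auto

lemma integrable_mult_lap_bump:
  assumes "open G" "bounded G" "continuous_on G u" "s > 0" "cball q s \<subseteq> G"
  shows "(\<lambda>x. u x * lap_bump s q x) integrable_on G"
  using assms by (intro integrable_on_supported[where q = q and s = s] continuous_on_lap_bump lap_bump_eq_0) auto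

lemma integrable_bump:
  assumes "open G" "bounded G" "s > 0" "cball q s \<subseteq> G"
  shows "bump s q integrable_on G"
  using integrable_mult_bump[OF assms(1,2) continuous_on_const[of G 1] assms(3,4)] by simp

lemma integral_bump_pos:
  assumes "open G" "bounded G" "s > 0" "cball q s \<subseteq> G"
  shows "integral G (bump s q) > 0"
proof -
  have pos: "bump s q x > 0" if "x \<in> cball q (s / 2)" for x
    using bump_pos_iff[OF assms(3), of q x] bump_nonneg[of s q x] that assms(3) by auto
  have "continuous_on (cball q (s / 2)) (bump s q)" by (rule continuous_on_bump)
  then obtain x0 where x0: "x0 \<in> cball q (s / 2)" "\<And>x. x \<in> cball q (s / 2) \<Longrightarrow> bump s q x0 \<le> bump s q x"
    using continuous_attains_inf[of "cball q (s / 2)" "bump s q"] assms(3) by auto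
  have sub: "cball q (s / 2) \<subseteq> G" using assms(3,4) by (auto simp: subset_iff)
  have m: "cball q (s / 2) \<in> lmeasurable" by simp
  have "0 < bump s q x0 * measure lebesgue (cball q (s / 2))"
    using pos[OF x0(1)] content_cball_pos[of "s / 2" q] assms(3) by simp
  also have "\<dots> = integral (cball q (s / 2)) (\<lambda>x. bump s q x0)"
    using lmeasure_integral[OF m] integral_mult_right[of "cball q (s / 2)" "bump s q x0" "\<lambda>x. 1"] by simp
  also have "\<dots> = integral G (\<lambda>x. if x \<in> cball q (s / 2) then bump s q x0 else 0)"
    using sub by (simp only: integral_restrict_Int inf.absorb1)
  also have "\<dots> \<le> integral G (bump s q)"
    using integrable_bump[OF assms] sub x0 m
    by (intro integral_le) (auto simp: bump_nonneg integrable_restrict_Int inf.absorb1 integrable_on_const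
        simp del: mem_cball)
  finally show ?thesis .
qed

lemma mollification_close:
  assumes "open G" "bounded G" "continuous_on G u" "s > 0" "cball x s \<subseteq> G"
    and "\<And>y. y \<in> cball x s \<Longrightarrow> \<bar>u y - c\<bar> \<le> e"
  shows "\<bar>integral G (\<lambda>y. u y * bump s x y) / integral G (bump s x) - c\<bar> \<le> e"
proof -
  let ?m = "integral G (bump s x)"
  have m: "?m > 0" by (rule integral_bump_pos[OF assms(1,2,4,5)])
  have i: "(\<lambda>y. u y * bump s x y) integrable_on G" "bump s x integrable_on G"
    using assms integrable_mult_bump integrable_bump by blast+
  have "\<bar>integral G (\<lambda>y. (u y - c) * bump s x y)\<bar> \<le> integral G (\<lambda>y. e * bump s x y)"
  proof (subst real_norm_def[symmetric], rule integral_norm_bound_integral)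
    show "(\<lambda>y. (u y - c) * bump s x y) integrable_on G"
      using integrable_diff[OF i(1) integrable_on_mult_right[OF i(2), of c]] by (simp add: left_diff_distrib)
    show "(\<lambda>y. e * bump s x y) integrable_on G" using i(2) by (rule integrable_on_mult_right)
    fix y
    show "norm ((u y - c) * bump s x y) \<le> e * bump s x y"
      using assms(6)[of y] bump_eq_0[OF assms(4), of y x] bump_nonneg[of s x y]
      by (cases "y \<in> cball x s") (auto simp: abs_mult intro: mult_right_mono)
  qed
  also have "integral G (\<lambda>y. (u y - c) * bump s x y) = integral G (\<lambda>y. u y * bump s x y) - c * ?m"
    using integral_diff[OF i(1) integrable_on_mult_right[OF i(2), of c]] by (simp add: left_diff_distrib)
  finally have "\<bar>integral G (\<lambda>y. u y * bump s x y) - c * ?m\<bar> \<le> e * ?m" by simp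
  moreover have "integral G (\<lambda>y. u y * bump s x y) / ?m - c = (integral G (\<lambda>y. u y * bump s x y) - c * ?m) / ?m"
    using m by (simp add: field_simps)
  ultimately show ?thesis using m by (simp add: abs_div pos_divide_le_eq)
qed

lemma continuous_on_mollification:
  assumes "open G" "bounded G" "continuous_on G u" "\<And>y. y \<in> G \<Longrightarrow> \<bar>u y\<bar> \<le> M" "s > 0"
    and "bounded A" "\<And>x. x \<in> A \<Longrightarrow> cball x s \<subseteq> G"
  shows "continuous_on A (\<lambda>x. integral G (\<lambda>y. u y * bump s x y))"
proof (cases "G = {}")
  case True
  then show ?thesis by simp
next
  case False
  then obtain y0 where "y0 \<in> G" by blast
  then have M: "M \<ge> 0" using assms(4)[of y0] by linarith
  define V where "V = measure lebesgue G"
  have V: "V \<ge> 0" by (simp add: V_def)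
  define D where "D = {y - x | x y. x \<in> A \<and> y \<in> G}"
  have "bounded D"
    unfolding D_def using bounded_minus[OF assms(2,6)] by (rule bounded_subset) auto
  from uniformly_continuous_on_bounded[OF continuous_on_bump[of UNIV s 0] this]
  have uc: "\<exists>d>0. \<forall>a\<in>D. \<forall>b\<in>D. dist b a < d \<longrightarrow> \<bar>bump s 0 b - bump s 0 a\<bar> < e" if "e > 0" for e
    using that unfolding uniformly_continuous_on_def dist_real_def by blast
  show ?thesis
  proof (rule continuous_on_iff[THEN iffD2], intro ballI allI impI)
    fix x and e :: real assume x: "x \<in> A" and "e > 0"
    \<comment> \<open>\<open>V\<close> is the area of \<open>G\<close>; the summand 1 covers the
      case that \<open>M * V\<close> vanishes.\<close>
    define e' where "e' = e / (M * V + 1)"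
    have p: "M * V + 1 > 0" using M V by (simp add: add_nonneg_pos)
    have e': "e' > 0" using \<open>e > 0\<close> p by (simp add: e'_def)
    from uc[OF this] obtain d where d: "d > 0"
      "\<And>a b. a \<in> D \<Longrightarrow> b \<in> D \<Longrightarrow> dist b a < d \<Longrightarrow> \<bar>bump s 0 b - bump s 0 a\<bar> < e'" by blast
    show "\<exists>d>0. \<forall>x'\<in>A. dist x' x < d \<longrightarrow> dist (integral G (\<lambda>y. u y * bump s x' y)) (integral G (\<lambda>y. u y * bump s x y)) < e"
    proof (intro exI[of _ d] conjI ballI impI)
      fix x' assume x': "x' \<in> A" "dist x' x < d"
      have "\<bar>u y * (bump s x' y - bump s x y)\<bar> \<le> M * e'" if "y \<in> G" for y
      proof -
        have "dist (y - x') (y - x) < d" using x' by (simp add: dist_norm norm_minus_commute)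
        then have "\<bar>bump s 0 (y - x') - bump s 0 (y - x)\<bar> < e'"
          using x x' that by (intro d(2)) (auto simp: D_def)
        then have "\<bar>bump s x' y - bump s x y\<bar> \<le> e'"
          using bump_shift[of s 0 x' y] bump_shift[of s 0 x y] by simp
        then show ?thesis
          using assms(4)[OF that] M by (auto simp: abs_mult intro!: mult_mono)
      qed
      then have "\<bar>integral G (\<lambda>y. u y * (bump s x' y - bump s x y))\<bar> \<le> M * e' * V"
        unfolding V_def
        using assms x x' integrable_mult_bump[OF assms(1-3,5)]
        by (intro integral_abs_le_measure) (auto simp: right_diff_distrib intro!: integrable_diff)
      also have "integral G (\<lambda>y. u y * (bump s x' y - bump s x y))
         = integral G (\<lambda>y. u y * bump s x' y) - integral G (\<lambda>y. u y * bump s x y)"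
        using assms x x' integrable_mult_bump[OF assms(1-3,5)]
        by (simp add: right_diff_distrib integral_diff)
      also have "M * e' * V < e"
        using p \<open>e > 0\<close> unfolding e'_def by (simp add: field_simps)
      finally show "dist (integral G (\<lambda>y. u y * bump s x' y)) (integral G (\<lambda>y. u y * bump s x y)) < e"
        by (simp add: dist_real_def)
    qed (rule d)
  qed
qed

text \<open>\<open>bump s x y\<close> depends only on y - x and the five-point star is symmetric, so
  a difference taken in the centre equals the same difference taken in the integration variable.
  There \<open>bump_star_diff\<close> gives uniform convergence to \<open>lap_bump\<close>.\<close>

lemma star_diff_mollification:
  assumes "open G" "bounded G" "continuous_on G u" "\<And>y. y \<in> G \<Longrightarrow> \<bar>u y\<bar> \<le> M" "s > 0"
    and "r > 0" "\<And>x. x \<in> ball q r \<Longrightarrow> cball x s \<subseteq> G"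
  shows "has_star_laplacian (\<lambda>x. integral G (\<lambda>y. u y * bump s x y)) (integral G (\<lambda>y. u y * lap_bump s q y)) q"
proof -
  have "q \<in> G" using assms(7)[of q] assms(5,6) by (auto simp: subset_iff)
  then have M: "M \<ge> 0" using assms(4)[of q] by linarith
  define V where "V = measure lebesgue G"
  have V: "V \<ge> 0" by (simp add: V_def)
  show ?thesis unfolding has_star_laplacian_def
  proof (rule tendstoI)
    fix e :: real assume "e > 0"
    define e' where "e' = e / (M * V + 1)"
    have p: "M * V + 1 > 0" using M V by (simp add: add_nonneg_pos)
    have e': "e' > 0" using \<open>e > 0\<close> p by (simp add: e'_def)
    obtain d where d: "d > 0" "\<And>h x. 0 < h \<and> h < d \<and> x \<in> G \<Longrightarrow> \<bar>star_diff (bump s q) x h - lap_bump s q x\<bar> \<le> e'"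
      using bump_star_diff[OF assms(2) e'] by metis
    show "\<forall>\<^sub>F h in at_right 0. dist (star_diff (\<lambda>x. integral G (\<lambda>y. u y * bump s x y)) q h) (integral G (\<lambda>y. u y * lap_bump s q y)) < e"
      unfolding eventually_at_right_field
    proof (intro exI[of _ "min d r"] conjI allI impI)
      show "0 < min d r" using d assms by simp
      fix h :: real assume h: "0 < h" "h < min d r"
      let ?I = "\<lambda>x. integral G (\<lambda>y. u y * bump s x y)"
      have int: "(\<lambda>y. u y * bump s x y) integrable_on G" if "x \<in> ball q r" for x
        using integrable_mult_bump[OF assms(1-3,5)] assms(7) that by blast
      have "q + of_real h \<in> ball q r" "q - of_real h \<in> ball q r"
        "q + of_real h * \<i> \<in> ball q r" "q - of_real h * \<i> \<in> ball q r" "q \<in> ball q r"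
        using h assms(6) by (auto simp: dist_norm norm_mult)
      note int' = this[THEN int]
      have sd: "star_diff (bump s q) y h = (bump s (q + of_real h) y + bump s (q - of_real h) y + bump s (q + of_real h * \<i>) y
          + bump s (q - of_real h * \<i>) y - 4 * bump s q y) / h\<^sup>2" for y
        using bump_shift[of s q "of_real h" y] bump_shift[of s q "- of_real h" y]
           bump_shift[of s q "of_real h * \<i>" y] bump_shift[of s q "- of_real h * \<i>" y]
        by (simp add: star_diff_def)
      let ?g = "\<lambda>y. u y * bump s (q + of_real h) y + u y * bump s (q - of_real h) y + u y * bump s (q + of_real h * \<i>) y
          + u y * bump s (q - of_real h * \<i>) y - 4 * (u y * bump s q y)"
      have "(?g has_integral (?I (q + of_real h) + ?I (q - of_real h) + ?I (q + of_real h * \<i>)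
          + ?I (q - of_real h * \<i>) - 4 * ?I q)) G"
        by (intro has_integral_diff has_integral_add has_integral_mult_right integrable_integral int')
      then have g: "?g integrable_on G" "integral G ?g = ?I (q + of_real h) + ?I (q - of_real h) + ?I (q + of_real h * \<i>)
          + ?I (q - of_real h * \<i>) - 4 * ?I q"
        by (simp_all only: has_integral_iff)
      have eq: "u y * star_diff (bump s q) y h = ?g y * (1 / h\<^sup>2)" for y
        unfolding sd by (simp add: field_simps)
      have i1: "(\<lambda>y. u y * star_diff (bump s q) y h) integrable_on G"
        unfolding eq using g(1) by (rule integrable_on_mult_left)
      have i2: "integral G (\<lambda>y. u y * star_diff (bump s q) y h) = star_diff ?I q h"
        unfolding eq integral_mult_left g(2) by (simp add: star_diff_def)
      have i3: "(\<lambda>y. u y * lap_bump s q y) integrable_on G"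
        using integrable_mult_lap_bump[OF assms(1-3,5)] assms(6,7) by auto
      have "\<bar>u y * (star_diff (bump s q) y h - lap_bump s q y)\<bar> \<le> M * e'" if "y \<in> G" for y
        using d(2)[of h y] h that assms(4)[OF that] M by (auto simp: abs_mult intro!: mult_mono)
      then have "\<bar>integral G (\<lambda>y. u y * (star_diff (bump s q) y h - lap_bump s q y))\<bar> \<le> M * e' * V"
        unfolding V_def using assms i1 i3
        by (intro integral_abs_le_measure) (auto simp: right_diff_distrib intro!: integrable_diff)
      also have "integral G (\<lambda>y. u y * (star_diff (bump s q) y h - lap_bump s q y))
         = star_diff ?I q h - integral G (\<lambda>y. u y * lap_bump s q y)"
        using i1 i2 i3 by (simp add: right_diff_distrib integral_diff)
      also have "M * e' * V < e"
        using p \<open>e > 0\<close> unfolding e'_def by (simp add: field_simps)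
      finally show "dist (star_diff ?I q h) (integral G (\<lambda>y. u y * lap_bump s q y)) < e"
        by (simp add: dist_real_def)
    qed
  qed
qed

section \<open>Viscosity characterisation of weak solutions\<close>

lemma star_diff_nonneg_at_min:
  assumes "eventually (\<lambda>x. H q \<le> H x) (nhds q)"
  shows "\<forall>\<^sub>F h in at_right 0. star_diff H q h \<ge> 0"
proof -
  obtain d where d: "d > 0" "\<And>x. dist x q < d \<Longrightarrow> H q \<le> H x"
    using assms unfolding eventually_nhds_metric by blast
  show ?thesis unfolding eventually_at_right_field
  proof (intro exI[of _ d] conjI allI impI)
    fix h :: real assume h: "0 < h" "h < d"
    have "H q \<le> H (q + of_real h)" "H q \<le> H (q - of_real h)"
      "H q \<le> H (q + of_real h * \<i>)" "H q \<le> H (q - of_real h * \<i>)"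
      using h by (auto intro!: d(2) simp: dist_norm norm_mult)
    then show "star_diff H q h \<ge> 0" by (simp add: star_diff_def)
  qed (rule d)
qed

lemma star_diff_linear:
  "star_diff (\<lambda>x. a * f x + b * g x) q h = a * star_diff f q h + b * star_diff g q h"
  unfolding star_diff_def by (simp add: add_divide_distrib diff_divide_distrib algebra_simps)

lemma has_star_laplacian_linear:
  assumes "has_star_laplacian f l q" "has_star_laplacian g k q"
  shows "has_star_laplacian (\<lambda>x. a * f x + b * g x) (a * l + b * k) q"
  using assms unfolding has_star_laplacian_def star_diff_linear[abs_def]
  by (intro tendsto_intros)

lemma has_star_laplacian_quadratic: "has_star_laplacian (\<lambda>x. (norm (x - p))\<^sup>2) 4 q"
proof -
  have "star_diff (\<lambda>x. (norm (x - p))\<^sup>2) q h = 4" if "h > 0" for h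
    using that unfolding star_diff_def cmod_power2 by (simp add: field_simps power2_eq_square)
  then show ?thesis
    unfolding has_star_laplacian_def
    by (intro Lim_transform_eventually[OF tendsto_const])
      (auto intro: eventually_mono[OF eventually_at_right_less])
qed

lemma star_laplacian_nonneg_at_min:
  assumes "eventually (\<lambda>x. H q \<le> H x) (nhds q)" "has_star_laplacian H l q"
  shows "l \<ge> 0"
  using tendsto_lowerbound[OF assms(2)[unfolded has_star_laplacian_def] star_diff_nonneg_at_min[OF assms(1)]]
  by simp

text \<open>A weak solution is a viscosity solution: touching \<open>u\<close> from below with \<open>z\<close> and mollifying,
  the perturbation \<open>c\<bar>x - p\<bar>\<^sup>2\<close> keeps the minimum of the mollified difference near \<open>p\<close>.\<close>

lemma weak_laplacian_touching_below:
  assumes G: "open G" "bounded G" and u: "continuous_on G u" "\<And>y. y \<in> G \<Longrightarrow> \<bar>u y\<bar> \<le> M"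
    and f: "continuous_on G f" and weak: "weak_laplacian G u f"
    and r: "r > 0" "ball p r \<subseteq> G" and z: "continuous_on (ball p r) z"
    and L: "\<And>q. q \<in> ball p r \<Longrightarrow> has_star_laplacian z (L q) q" "isCont L p"
    and min: "\<And>x. x \<in> ball p r \<Longrightarrow> u p - z p \<le> u x - z x"
  shows "L p \<le> f p"
proof (rule ccontr)
  assume "\<not> L p \<le> f p"
  \<comment> \<open>The final contradiction spends 4c on the Laplacian of c|x - p|^2 and c each on
    replacing \<open>l\<close> by \<open>f p\<close> and \<open>L q\<close> by \<open>L p\<close>:
    in all 6c, less than the assumed gap 8c.\<close>
  define c where "c = (L p - f p) / 8"
  have c: "c > 0" using \<open>\<not> L p \<le> f p\<close> by (simp add: c_def)
  have "p \<in> G" using r by auto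
  then have "isCont f p" using f G(1) continuous_on_eq_continuous_at by blast
  then obtain d1 where d1: "d1 > 0" "\<And>x. dist x p < d1 \<Longrightarrow> \<bar>f x - f p\<bar> < c"
    using c unfolding continuous_at_eps_delta dist_real_def by (metis dist_norm real_norm_def)
  obtain d2 where d2: "d2 > 0" "\<And>x. dist x p < d2 \<Longrightarrow> \<bar>L x - L p\<bar> < c"
    using L(2) c unfolding continuous_at_eps_delta dist_real_def by (metis dist_norm real_norm_def)
  define \<delta> where "\<delta> = min (r / 2) (min (d1 / 2) (d2 / 2))"
  have \<delta>: "\<delta> > 0" "\<delta> < r" "\<delta> < d1" "\<delta> < d2" using r(1) d1(1) d2(1) by (auto simp: \<delta>_def)
  have \<delta>f: "\<bar>f x - f p\<bar> < c" and \<delta>L: "\<bar>L x - L p\<bar> < c" if "x \<in> cball p \<delta>" for x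
    using that \<delta> by (auto intro!: d1(2) d2(2) simp: dist_commute)
  have sub: "cball p \<delta> \<subseteq> ball p r" using \<delta> by auto
  \<comment> \<open>On the circle of radius \<delta>/2 the perturbation is worth c \<delta>^2 / 4,
    more than the total mollification error 2e = c \<delta>^2 / 8. Hence the minimum point lies
    strictly inside.\<close>
  define e where "e = c * \<delta>\<^sup>2 / 16"
  have e: "e > 0" using c \<delta>(1) by (simp add: e_def)
  have "uniformly_continuous_on (cball p \<delta>) u"
    using sub r(2) by (intro compact_uniformly_continuous continuous_on_subset[OF u(1)]) auto
  then obtain s0 where s0: "s0 > 0" "\<And>x y. x \<in> cball p \<delta> \<Longrightarrow> y \<in> cball p \<delta> \<Longrightarrow> dist y x < s0 \<Longrightarrow> \<bar>u y - u x\<bar> < e"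
    using e unfolding uniformly_continuous_on_def dist_real_def by metis
  define s where "s = min (s0 / 2) (\<delta> / 2)"
  have s: "s > 0" "s < s0" "s \<le> \<delta> / 2" using s0(1) \<delta>(1) by (auto simp: s_def)
  have ball_sub: "cball x s \<subseteq> cball p \<delta>" if "x \<in> cball p (\<delta> / 2)" for x
  proof
    fix y assume "y \<in> cball x s"
    then show "y \<in> cball p \<delta>" using that s(3) dist_triangle[of p y x] by simp
  qed
  have ball_G: "cball x s \<subseteq> G" if "x \<in> cball p (\<delta> / 2)" for x
    using ball_sub[OF that] sub r(2) by blast
  define m where "m = integral G (bump s p)"
  have p2: "p \<in> cball p (\<delta> / 2)" using \<delta> by simp
  have m: "m > 0" unfolding m_def by (rule integral_bump_pos[OF G s(1) ball_G[OF p2]])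
  have m_eq: "integral G (bump s x) = m" if "x \<in> cball p (\<delta> / 2)" for x
    unfolding m_def by (rule integral_bump_shift[OF s(1) ball_G[OF that] ball_G[OF p2]])
  define F where "F x = integral G (\<lambda>y. u y * bump s x y) / m" for x
  have F_close: "\<bar>F x - u x\<bar> \<le> e" if "x \<in> cball p (\<delta> / 2)" for x
  proof -
    have "\<bar>u y - u x\<bar> \<le> e" if "y \<in> cball x s" for y
    proof -
      have "y \<in> cball p \<delta>" "x \<in> cball p \<delta>" 
        using that ball_sub[OF \<open>x \<in> cball p (\<delta> / 2)\<close>] s(1)
        by (auto simp: subset_iff)
      moreover have "dist y x < s0" using that s by (simp add: dist_commute)
      ultimately show ?thesis using s0(2) less_imp_le by blast
    qed
    from mollification_close[OF G u(1) s(1) ball_G[OF that] this]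
    show ?thesis unfolding F_def m_eq[OF that] by simp
  qed
  define H where "H x = F x - z x + c * (norm (x - p))\<^sup>2" for x
  have "continuous_on (cball p (\<delta> / 2)) H"
    unfolding H_def F_def using sub \<delta>
    by (intro continuous_intros continuous_on_mollification[OF G u s(1)] ball_G
        continuous_on_subset[OF z]) (auto simp: subset_iff m[THEN less_imp_neq, symmetric])
  then obtain q where q: "q \<in> cball p (\<delta> / 2)" "\<And>x. x \<in> cball p (\<delta> / 2) \<Longrightarrow> H q \<le> H x"
    using continuous_attains_inf[of "cball p (\<delta> / 2)" H] p2 by auto
  have "H q \<le> H p" using q(2) p2 by blast
  have "dist p q \<noteq> \<delta> / 2"
  proof
    assume "dist p q = \<delta> / 2"
    then have n: "(norm (q - p))\<^sup>2 = \<delta>\<^sup>2 / 4"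
      unfolding dist_norm norm_minus_commute[of p q] by (simp only: power_divide) simp
    have "u p - z p \<le> u q - z q" using q(1) sub \<delta> by (intro min) auto
    moreover have "F p \<le> u p + e" "u q \<le> F q + e" using F_close[OF p2] F_close[OF q(1)] by auto
    ultimately have "H p + c * \<delta>\<^sup>2 / 4 \<le> H q + 2 * e" unfolding H_def n by simp
    moreover have "2 * e < c * \<delta>\<^sup>2 / 4" using c \<delta>(1) by (simp add: e_def)
    ultimately show False using \<open>H q \<le> H p\<close> by linarith
  qed
  then have qin: "q \<in> ball p (\<delta> / 2)" using q(1) by auto
  then have "eventually (\<lambda>x. x \<in> ball p (\<delta> / 2)) (nhds q)" by (intro eventually_nhds_in_open) auto
  then have "eventually (\<lambda>x. H q \<le> H x) (nhds q)"
    by (rule eventually_mono) (auto intro!: q(2))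
  moreover
  define r' where "r' = \<delta> / 2 - dist p q"
  have "r' > 0" using qin by (simp add: r'_def)
  moreover have "x \<in> cball p (\<delta> / 2)" if "x \<in> ball q r'" for x
    using that dist_triangle[of p x q] by (auto simp: r'_def)
  ultimately have lapF: "has_star_laplacian (\<lambda>x. integral G (\<lambda>y. u y * bump s x y)) (integral G (\<lambda>y. u y * lap_bump s q y)) q"
    using ball_G by (intro star_diff_mollification[OF G u s(1), of r']) auto
  define l where "l = integral G (\<lambda>y. u y * lap_bump s q y) / m"
  have "has_star_laplacian z (L q) q" using q(1) sub \<delta> by (intro L(1)) auto
  from has_star_laplacian_linear[OF has_star_laplacian_linear[OF lapF this, of "1 / m" "-1"] 
      has_star_laplacian_quadratic[of p], of 1 c]
  have "has_star_laplacian H (l - L q + 4 * c) q"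
    by (simp add: H_def[abs_def] F_def l_def algebra_simps)
  then have "l - L q + 4 * c \<ge> 0"
    using \<open>eventually (\<lambda>x. H q \<le> H x) (nhds q)\<close> star_laplacian_nonneg_at_min by blast
  moreover have "l = integral G (\<lambda>y. f y * bump s q y) / integral G (bump s q)"
    using weak s(1) ball_G[OF q(1)] m_eq[OF q(1)] by (simp add: weak_laplacian_def l_def)
  moreover have "\<bar>integral G (\<lambda>y. f y * bump s q y) / integral G (bump s q) - f p\<bar> \<le> c"
    using ball_sub[OF q(1)] \<delta>f
    by (intro mollification_close[OF G f s(1) ball_G[OF q(1)]] less_imp_le) blast
  moreover have "\<bar>L q - L p\<bar> < c" using \<delta>L q(1) \<delta>(1) by auto
  moreover have "L p - f p = 8 * c" by (simp add: c_def)
  ultimately show False using c by linarith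
qed

text \<open>One use of L'Hopital's rule leaves (g'(h) - g'(-h)) / (2h), the mean of two difference
  quotients of g' at 0, so differentiability of g' at that single point suffices.\<close>

lemma second_difference_tendsto:
  fixes g :: "real \<Rightarrow> real"
  assumes "\<forall>\<^sub>F t in nhds 0. (g has_real_derivative g' t) (at t)" "(g' has_real_derivative D) (at 0)"
  shows "((\<lambda>h. (g h + g (- h) - 2 * g 0) / h\<^sup>2) \<longlongrightarrow> D) (at_right 0)"
proof (rule lhopital_right_0)
  obtain d where d: "d > 0" "\<And>t. \<bar>t\<bar> < d \<Longrightarrow> (g has_real_derivative g' t) (at t)"
    using assms(1) unfolding eventually_nhds_metric by auto
  have "isCont g 0" using d(2)[of 0] d(1) DERIV_isCont by auto
  then have g: "(g \<longlongrightarrow> g 0) (at 0)" by (simp add: isCont_def)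
  then have "isCont (\<lambda>h. g (- h)) 0"
    using isCont_o2[of 0 "\<lambda>h. - h" g] \<open>isCont g 0\<close> by simp
  then have "((\<lambda>h. g (- h)) \<longlongrightarrow> g 0) (at 0)" by (simp add: isCont_def)
  then have "((\<lambda>h. g h + g (- h) - 2 * g 0) \<longlongrightarrow> g 0 + g 0 - 2 * g 0) (at_right 0)"
    using g by (intro tendsto_intros) (auto intro: filterlim_mono at_le)
  then show "((\<lambda>h. g h + g (- h) - 2 * g 0) \<longlongrightarrow> 0) (at_right 0)" by simp
  show "((\<lambda>h::real. h\<^sup>2) \<longlongrightarrow> 0) (at_right 0)"
    by (rule tendsto_eq_intros | simp)+
  show "\<forall>\<^sub>F h in at_right 0. (h::real)\<^sup>2 \<noteq> 0" "\<forall>\<^sub>F h in at_right 0. 2 * (h::real) \<noteq> 0"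
    by (auto intro: eventually_mono[OF eventually_at_right_less])
  show "\<forall>\<^sub>F h in at_right 0. ((\<lambda>h. g h + g (- h) - 2 * g 0) has_real_derivative g' h - g' (- h)) (at h)"
    unfolding eventually_at_right_field
  proof (intro exI[of _ d] conjI allI impI)
    fix h assume h: "0 < h" "h < d"
    have 1: "(g has_real_derivative g' h) (at h)" "(g has_real_derivative g' (- h)) (at (- h))"
      using h by (auto intro: d(2))
    have "((\<lambda>h. g (- h)) has_real_derivative - g' (- h)) (at h)"
      using 1(2) DERIV_mirror by blast
    with 1(1) show "((\<lambda>h. g h + g (- h) - 2 * g 0) has_real_derivative g' h - g' (- h)) (at h)"
      by (auto intro!: derivative_eq_intros)
  qed (rule d)
  show "\<forall>\<^sub>F h in at_right 0. ((\<lambda>h. h\<^sup>2) has_real_derivative 2 * h) (at (h::real))"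
    by (auto intro!: always_eventually derivative_eq_intros)
  have q: "((\<lambda>h. (g' h - g' 0) / h) \<longlongrightarrow> D) (at 0)"
    using assms(2) by (simp add: has_field_derivative_iff)
  have "((\<lambda>h. (g' (- h) - g' 0) / (- h)) \<longlongrightarrow> D) (at 0)"
  proof (rule filterlim_compose[OF q])
    show "filterlim uminus (at 0) (at (0::real))"
      unfolding filterlim_at by (auto simp: eventually_at_filter intro!: tendsto_eq_intros)
  qed
  then have "((\<lambda>h. ((g' h - g' 0) / h + (g' (- h) - g' 0) / (- h)) / 2) \<longlongrightarrow> (D + D) / 2) (at_right 0)"
    using q by (intro tendsto_intros) (auto intro: filterlim_mono at_le)
  then have "((\<lambda>h. ((g' h - g' 0) / h + (g' (- h) - g' 0) / (- h)) / 2) \<longlongrightarrow> D) (at_right 0)" by simp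
  then show "((\<lambda>h. (g' h - g' (- h)) / (2 * h)) \<longlongrightarrow> D) (at_right 0)"
    by (rule Lim_transform_eventually)
      (auto simp: field_simps intro!: eventually_mono[OF eventually_at_right_less[of "0::real"]])
qed

text \<open>With t = |x - p|^2 as variable the planar Laplacian of a radial function is 4 \<phi>' +
  4 t \<phi>'', a formula that stays valid at the centre, where |x - p| itself is not
  differentiable.\<close>

lemma has_star_laplacian_radial:
  fixes \<phi> :: "real \<Rightarrow> real" and p q :: complex
  assumes "\<forall>\<^sub>F t in nhds ((norm (q - p))\<^sup>2). (\<phi> has_real_derivative \<phi>' t) (at t)"
    and "(\<phi>' has_real_derivative D) (at ((norm (q - p))\<^sup>2))"
  shows "has_star_laplacian (\<lambda>x. \<phi> ((norm (x - p))\<^sup>2)) (4 * \<phi>' ((norm (q - p))\<^sup>2) + 4 * (norm (q - p))\<^sup>2 * D) q"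
proof -
  define t0 where "t0 = (norm (q - p))\<^sup>2"
  note assms = assms[folded t0_def]
  have dir: "((\<lambda>h. (\<phi> ((norm (q + of_real h * v - p))\<^sup>2) + \<phi> ((norm (q - of_real h * v - p))\<^sup>2) - 2 * \<phi> (t0)) / h\<^sup>2)
      \<longlongrightarrow> 2 * \<phi>' (t0) + 4 * (inner (q - p) v)\<^sup>2 * D) (at_right 0)" if v: "norm v = 1" for v
  proof -
    define b where "b = inner (q - p) v"
    define T where "T h = t0 + 2 * h * b + h\<^sup>2" for h
    have T: "(norm (q + of_real h * v - p))\<^sup>2 = T h" for h
    proof -
      have "q + of_real h * v - p = (q - p) + h *\<^sub>R v" by (simp add: scaleR_conv_of_real)
      then show ?thesis
        unfolding T_def t0_def b_def power2_norm_eq_inner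
        using v dot_square_norm[of v] by (simp add: algebra_simps inner_commute power2_eq_square)
    qed
    have T': "(norm (q - of_real h * v - p))\<^sup>2 = T (- h)" for h
      using T[of "- h"] by simp
    have dT: "(T has_real_derivative 2 * b + 2 * h) (at h)" for h
      unfolding T_def by (auto intro!: derivative_eq_intros)
    have "isCont T 0" using dT DERIV_isCont by blast
    moreover have T0: "T 0 = t0" by (simp add: T_def)
    ultimately have "(T \<longlongrightarrow> t0) (nhds 0)" by (metis isCont_def tendsto_at_iff_tendsto_nhds) 
    then have "\<forall>\<^sub>F h in nhds 0. (\<phi> has_real_derivative \<phi>' (T h)) (at (T h))"
      using assms(1) unfolding filterlim_iff by blast
    then have 1: "\<forall>\<^sub>F h in nhds 0. ((\<lambda>h. \<phi> (T h)) has_real_derivative \<phi>' (T h) * (2 * b + 2 * h)) (at h)"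
      by (rule eventually_mono) (rule DERIV_chain2[OF _ dT])
    have "((\<lambda>h. \<phi>' (T h)) has_real_derivative D * (2 * b + 2 * 0)) (at 0)"
      using assms(2) T0 by (intro DERIV_chain2[OF _ dT]) auto
    then have 2: "((\<lambda>h. \<phi>' (T h) * (2 * b + 2 * h)) has_real_derivative 2 * \<phi>' (t0) + 4 * b\<^sup>2 * D) (at 0)"
      by (auto intro!: derivative_eq_intros simp: T0 power2_eq_square)
    show ?thesis
      using second_difference_tendsto[OF 1 2] unfolding T T' T0 b_def by simp
  qed
  have "star_diff (\<lambda>x. \<phi> ((norm (x - p))\<^sup>2)) q = (\<lambda>h.
     (\<phi> ((norm (q + of_real h * 1 - p))\<^sup>2) + \<phi> ((norm (q - of_real h * 1 - p))\<^sup>2) - 2 * \<phi> t0) / h\<^sup>2 +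
     (\<phi> ((norm (q + of_real h * \<i> - p))\<^sup>2) + \<phi> ((norm (q - of_real h * \<i> - p))\<^sup>2) - 2 * \<phi> t0) / h\<^sup>2)"
    by (simp add: star_diff_def t0_def add_divide_distrib[symmetric] fun_eq_iff)
  moreover have "2 * \<phi>' t0 + 4 * (inner (q - p) 1)\<^sup>2 * D + (2 * \<phi>' t0 + 4 * (inner (q - p) \<i>)\<^sup>2 * D)
     = 4 * \<phi>' t0 + 4 * t0 * D"
    by (simp add: t0_def inner_complex_def cmod_power2 algebra_simps)
  ultimately show ?thesis
    using tendsto_add[OF dir[of 1] dir[of \<i>]] unfolding has_star_laplacian_def t0_def[symmetric]
    by (simp only: norm_one norm_ii)
qed

section \<open>Comparison with radial functions\<close>

lemma CG_continuous: "u \<in> CG G \<Longrightarrow> continuous_on (closure G) u"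
  by (simp add: CG_def)

lemma CG_continuous_interior: "u \<in> CG G \<Longrightarrow> continuous_on G u"
  using continuous_on_subset[OF CG_continuous closure_subset] .

lemma CG_bounded:
  assumes "u \<in> CG G" "bounded G"
  obtains M where "M \<ge> 0" "\<And>x. \<bar>u x\<bar> \<le> M"
proof -
  have "compact (u ` closure G)"
    using assms by (intro compact_continuous_image CG_continuous) auto
  then obtain M where M: "\<And>x. x \<in> closure G \<Longrightarrow> \<bar>u x\<bar> \<le> M"
    using compact_imp_bounded bounded_iff by (metis imageI real_norm_def)
  have "\<bar>u x\<bar> \<le> max M 0" for x
    using M[of x] assms(1) by (cases "x \<in> closure G") (auto simp: CG_def)
  then show ?thesis using that[of "max M 0"] by simp
qed

lemma CG_linear:
  assumes "u \<in> CG G" "v \<in> CG G"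
  shows "(\<lambda>x. a * u x + b * v x) \<in> CG G"
  using assms by (auto simp: CG_def intro!: continuous_intros)

lemma weak_laplacian_linear:
  assumes G: "open G" "bounded G" and "u \<in> CG G" "v \<in> CG G" "f \<in> CG G" "g \<in> CG G"
    and "weak_laplacian G u f" "weak_laplacian G v g"
  shows "weak_laplacian G (\<lambda>x. a * u x + b * v x) (\<lambda>x. a * f x + b * g x)"
  unfolding weak_laplacian_def
proof (intro allI impI)
  fix q and s :: real assume s: "s > 0" "cball q s \<subseteq> G"
  have lin: "integral G (\<lambda>x. (a * u x + b * v x) * \<phi> x) = a * integral G (\<lambda>x. u x * \<phi> x) + b * integral G (\<lambda>x. v x * \<phi> x)"
    if "(\<lambda>x. u x * \<phi> x) integrable_on G" "(\<lambda>x. v x * \<phi> x) integrable_on G" for u v \<phi> :: "complex \<Rightarrow> real"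
  proof -
    have "((\<lambda>x. a * (u x * \<phi> x) + b * (v x * \<phi> x)) has_integral
        (a * integral G (\<lambda>x. u x * \<phi> x) + b * integral G (\<lambda>x. v x * \<phi> x))) G"
      by (intro has_integral_add has_integral_mult_right integrable_integral that)
    then show ?thesis by (simp add: has_integral_iff algebra_simps)
  qed
  show "integral G (\<lambda>x. (a * u x + b * v x) * lap_bump s q x) = integral G (\<lambda>x. (a * f x + b * g x) * bump s q x)"
    using assms s by (simp add: lin integrable_mult_bump integrable_mult_lap_bump CG_continuous_interior weak_laplacian_def)
qed

text \<open>At a minimum point q of u - z in \<open>D\<close>, touching gives
  \<open>L q \<le> lam * u q - g q\<close>, which with \<open>sub\<close> forces
  \<open>z q \<le> u q\<close>. A negative minimum outside \<open>D\<close> is moved into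
  \<open>D\<close> by the second alternative of \<open>bd\<close>; this is the form in which
  nonlocal boundary conditions can be used.\<close>

lemma weak_laplacian_comparison:
  assumes G: "open G" "bounded G" and u: "u \<in> CG G" and g: "g \<in> CG G" and lam: "lam > 0"
    and weak: "weak_laplacian G u (\<lambda>x. lam * u x - g x)"
    and K: "compact K" "K \<subseteq> closure G" and D: "open D" "D \<subseteq> K" "D \<subseteq> G"
    and z: "continuous_on K z" and L: "\<And>q. q \<in> D \<Longrightarrow> has_star_laplacian z (L q) q" "continuous_on D L"
    and sub: "\<And>q. q \<in> D \<Longrightarrow> lam * z q - g q \<le> L q"
    and bd: "\<And>x. x \<in> K - D \<Longrightarrow> z x \<le> u x \<or> (\<exists>x'\<in>D. u x' - z x' \<le> u x - z x)"
    and x: "x \<in> K"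
  shows "z x \<le> u x"
proof (rule ccontr)
  assume neg: "\<not> z x \<le> u x"
  have "continuous_on K (\<lambda>x. u x - z x)"
    using z CG_continuous[OF u] K(2) by (intro continuous_intros) (auto intro: continuous_on_subset)
  then obtain y where y: "y \<in> K" "\<And>x. x \<in> K \<Longrightarrow> u y - z y \<le> u x - z x"
    using continuous_attains_inf[OF K(1), of "\<lambda>x. u x - z x"] x by auto
  have ym: "u y < z y" using y(2)[OF x] neg by simp
  obtain q where q: "q \<in> D" "\<And>x. x \<in> K \<Longrightarrow> u q - z q \<le> u x - z x" "u q < z q"
  proof (cases "y \<in> D")
    case True
    then show ?thesis using that y ym by blast
  next
    case False
    then obtain x' where "x' \<in> D" "u x' - z x' \<le> u y - z y" using bd[of y] y(1) ym by auto
    moreover have "u x' - z x' \<le> u x - z x" if "x \<in> K" for x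
      using y(2)[OF that] calculation(2) by linarith
    ultimately show ?thesis using that[of x'] ym by force
  qed
  obtain r where r: "r > 0" "ball q r \<subseteq> D" using D(1) q(1) open_contains_ball by blast
  obtain M where M: "\<And>x. \<bar>u x\<bar> \<le> M" using CG_bounded[OF u G(2)] by blast
  have "L q \<le> lam * u q - g q"
  proof (rule weak_laplacian_touching_below[OF G CG_continuous_interior[OF u] M _ weak r(1), of _ z])
    show "continuous_on G (\<lambda>x. lam * u x - g x)"
      using u g by (intro continuous_intros CG_continuous_interior)
    show "ball q r \<subseteq> G" using r D by blast
    show "continuous_on (ball q r) z" using z r D continuous_on_subset by blast
    show "isCont L q" using L(2) D(1) q(1) continuous_on_eq_continuous_at by blast
  qed (use r L(1) q D in blast)+
  with sub[OF q(1)] have "lam * z q \<le> lam * u q" by linarith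
  then show False using lam q(3) by simp
qed

text \<open>A radial barrier takes equal values at equal distance from \<open>p\<close>, so trading
  a boundary point for an interior one only requires the same radius and a value of \<open>u\<close>
  that is no larger.\<close>

lemma weak_laplacian_radial_comparison:
  assumes G: "open G" "bounded G" and u: "u \<in> CG G" and g: "g \<in> CG G" and lam: "lam > 0"
    and weak: "weak_laplacian G u (\<lambda>x. lam * u x - g x)"
    and K: "compact K" "K \<subseteq> closure G" and D: "open D" "D \<subseteq> K" "D \<subseteq> G"
    and I: "open I" "\<And>q. q \<in> D \<Longrightarrow> (norm (q - p))\<^sup>2 \<in> I"
    and z: "continuous_on K (\<lambda>x. \<phi> ((norm (x - p))\<^sup>2))"
    and d1: "\<And>t. t \<in> I \<Longrightarrow> (\<phi> has_real_derivative \<phi>' t) (at t)"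
    and d2: "\<And>t. t \<in> I \<Longrightarrow> (\<phi>' has_real_derivative \<phi>'' t) (at t)" "continuous_on I \<phi>''"
    and sub: "\<And>q t. q \<in> D \<Longrightarrow> t = (norm (q - p))\<^sup>2 \<Longrightarrow> lam * \<phi> t - g q \<le> 4 * \<phi>' t + 4 * t * \<phi>'' t"
    and bd: "\<And>x. x \<in> K - D \<Longrightarrow> \<phi> ((norm (x - p))\<^sup>2) \<le> u x \<or>
       (\<exists>x'\<in>D. u x' \<le> u x \<and> norm (x' - p) = norm (x - p))"
    and x: "x \<in> K"
  shows "\<phi> ((norm (x - p))\<^sup>2) \<le> u x"
proof -
  let ?t = "\<lambda>x. (norm (x - p))\<^sup>2"
  have tc: "continuous_on D ?t" by (intro continuous_intros)
  have "continuous_on I \<phi>'" using d2(1) DERIV_isCont continuous_at_imp_continuous_on by blast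
  then have "continuous_on D (\<lambda>q. \<phi>' (?t q))"
    by (rule continuous_on_compose2[OF _ tc]) (use I(2) in auto)
  moreover have "continuous_on D (\<lambda>q. \<phi>'' (?t q))"
    by (rule continuous_on_compose2[OF d2(2) tc]) (use I(2) in auto)
  ultimately have c: "continuous_on D (\<lambda>q. 4 * \<phi>' (?t q) + 4 * ?t q * \<phi>'' (?t q))"
    by (intro continuous_intros)
  show ?thesis
  proof (rule weak_laplacian_comparison[OF G u g lam weak K D z _ c _ _ x])
    fix q assume q: "q \<in> D"
    have "\<forall>\<^sub>F t in nhds (?t q). t \<in> I" using I q by (intro eventually_nhds_in_open) auto
    then have "\<forall>\<^sub>F t in nhds (?t q). (\<phi> has_real_derivative \<phi>' t) (at t)"
      by (rule eventually_mono) (rule d1)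
    then show "has_star_laplacian (\<lambda>x. \<phi> (?t x)) (4 * \<phi>' (?t q) + 4 * ?t q * \<phi>'' (?t q)) q"
      by (rule has_star_laplacian_radial) (rule d2(1)[OF I(2)[OF q]])
    show "lam * \<phi> (?t q) - g q \<le> 4 * \<phi>' (?t q) + 4 * ?t q * \<phi>'' (?t q)"
      using sub[OF q refl] .
  next
    fix x assume "x \<in> K - D"
    from bd[OF this] show "\<phi> (?t x) \<le> u x \<or> (\<exists>x'\<in>D. u x' - \<phi> (?t x') \<le> u x - \<phi> (?t x))"
      by (metis diff_right_mono)
  qed
qed

section \<open>Explicit barriers on discs and annuli\<close>

lemma ball_lower_bound:
  assumes G: "open G" "bounded G" and u: "u \<in> CG G" and g: "g \<in> CG G" and lam: "lam > 0"
    and weak: "weak_laplacian G u (\<lambda>x. lam * u x - g x)"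
    and B: "cball p \<rho> \<subseteq> G" "\<rho> > 0" "\<And>x. x \<in> ball p \<rho> \<Longrightarrow> g x \<ge> 1" "\<And>x. u x \<ge> 0"
    and x: "x \<in> cball p \<rho>"
  shows "(\<rho>\<^sup>2 - (norm (x - p))\<^sup>2) / (lam * \<rho>\<^sup>2 + 4) \<le> u x"
proof -
  \<comment> \<open>For z = k (\<rho>^2 - r^2) one has -Laplacian z = 4k and lam z <= lam k
    \<rho>^2; \<open>k\<close> is chosen so that these bounds add up to 1, the lower bound for
    \<open>g\<close>.\<close>
  define k where "k = 1 / (lam * \<rho>\<^sup>2 + 4)"
  have den: "lam * \<rho>\<^sup>2 + 4 > 0" using lam by (intro add_nonneg_pos) auto
  have "lam * (k * \<rho>\<^sup>2) + 4 * k = k * (lam * \<rho>\<^sup>2 + 4)" by (simp add: algebra_simps)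
  then have k: "k > 0" "lam * (k * \<rho>\<^sup>2) + 4 * k = 1" using den by (simp_all add: k_def)
  have "k * (\<rho>\<^sup>2 - (norm (x - p))\<^sup>2) \<le> u x"
  proof (rule weak_laplacian_radial_comparison[OF G u g lam weak, where K = "cball p \<rho>" and D = "ball p \<rho>"
        and I = UNIV and \<phi> = "\<lambda>t. k * (\<rho>\<^sup>2 - t)" and \<phi>' = "\<lambda>t. - k" and \<phi>'' = "\<lambda>t. 0"])
    show "lam * (k * (\<rho>\<^sup>2 - t)) - g q \<le> 4 * - k + 4 * t * 0" if "q \<in> ball p \<rho>" "t = (norm (q - p))\<^sup>2" for q t
    proof -
      have "k * (\<rho>\<^sup>2 - t) \<le> k * \<rho>\<^sup>2" using that k(1) by simp
      then have "lam * (k * (\<rho>\<^sup>2 - t)) \<le> lam * (k * \<rho>\<^sup>2)" using lam mult_le_cancel_left_pos by blast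
      then show ?thesis using B(3)[OF that(1)] k(2) by simp
    qed
    show "k * (\<rho>\<^sup>2 - (norm (x - p))\<^sup>2) \<le> u x \<or> (\<exists>x'\<in>ball p \<rho>. u x' \<le> u x \<and> norm (x' - p) = norm (x - p))"
      if "x \<in> cball p \<rho> - ball p \<rho>" for x
    proof -
      have "norm (x - p) = \<rho>" using that by (auto simp: dist_norm norm_minus_commute)
      then show ?thesis using B(4) by simp
    qed
  qed (use B x closure_subset[of G] in \<open>auto intro!: continuous_intros derivative_eq_intros\<close>)
  then show ?thesis by (simp add: k_def)
qed

text \<open>The Laplacian of exp(-a r) is (a^2 - a/r) exp(-a r). For r >= \<rho> and this
  \<open>a\<close> the factor is at least a^2 - a/\<rho> = a sqrt lam >= lam. Subtracting the value
  at \<open>R\<close> makes the barrier vanish on the outer circle and only helps the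
  inequality.\<close>

lemma annulus_lower_bound:
  assumes G: "open G" "bounded G" and u: "u \<in> CG G" and g: "g \<in> CG G" and lam: "lam > 0"
    and weak: "weak_laplacian G u (\<lambda>x. lam * u x - g x)"
    and B: "cball p R \<subseteq> G" "0 < \<rho>" "\<rho> < R" "c > 0" "\<And>x. x \<in> cball p \<rho> \<Longrightarrow> u x \<ge> c"
    and nonneg: "\<And>x. u x \<ge> 0" "\<And>x. g x \<ge> 0"
    and x: "\<rho> \<le> norm (x - p)" "norm (x - p) \<le> R" and a: "a = sqrt lam + 1 / \<rho>"
  shows "c * (exp (- a * norm (x - p)) - exp (- a * R)) \<le> u x"
proof -
  have a0: "a > 0" "a \<ge> sqrt lam" using lam B(2) by (auto simp: a add_pos_pos)
  define E where "E = exp (- a * R)"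
  let ?\<phi> = "\<lambda>t. c * (exp (- a * sqrt t) - E)"
  let ?\<phi>' = "\<lambda>t. - c * a * exp (- a * sqrt t) / (2 * sqrt t)"
  let ?\<phi>'' = "\<lambda>t. c * exp (- a * sqrt t) * (a\<^sup>2 / (4 * (sqrt t)\<^sup>2) + a / (4 * (sqrt t) ^ 3))"
  have "?\<phi> ((norm (x - p))\<^sup>2) \<le> u x"
  proof (rule weak_laplacian_radial_comparison[OF G u g lam weak, where K = "cball p R - ball p \<rho>" and D = "ball p R - cball p \<rho>"
        and I = "{0<..}" and \<phi> = ?\<phi> and \<phi>' = ?\<phi>' and \<phi>'' = ?\<phi>''])
    show "(?\<phi> has_real_derivative ?\<phi>' t) (at t)" if "t \<in> {0<..}" for t
      using that by (auto intro!: derivative_eq_intros simp: field_simps)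
    show "(?\<phi>' has_real_derivative ?\<phi>'' t) (at t)" if "t \<in> {0<..}" for t
    proof -
      have "sqrt t > 0" using that by auto
      then show ?thesis
        using that
        by (auto intro!: derivative_eq_intros simp: field_simps power2_eq_square power3_eq_cube
            simp del: real_sqrt_mult_self real_sqrt_pow2 real_sqrt_power)
    qed
    show "lam * ?\<phi> t - g q \<le> 4 * ?\<phi>' t + 4 * t * ?\<phi>'' t"
      if "q \<in> ball p R - cball p \<rho>" "t = (norm (q - p))\<^sup>2" for q t
    proof -
      define s where "s = norm (q - p)"
      have s: "s > \<rho>" "sqrt t = s" "t = s * s" using that by (auto simp: s_def dist_norm norm_minus_commute power2_eq_square)
      have s0: "s > 0" using s B(2) by linarith
      have "a / s \<le> a / \<rho>" using s a0 B(2) by (intro divide_left_mono) auto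
      moreover have "a\<^sup>2 - a / \<rho> = a * sqrt lam" using B(2) by (simp add: a power2_eq_square algebra_simps add_divide_distrib)
      moreover have "lam \<le> a * sqrt lam" using mult_right_mono[OF a0(2), of "sqrt lam"] lam by simp
      ultimately have 1: "lam \<le> a\<^sup>2 - a / s" by linarith
      have "lam * ?\<phi> t \<le> lam * (c * exp (- a * s))"
        using lam B(4) s by (simp add: E_def)
      also have "\<dots> \<le> c * exp (- a * s) * (a\<^sup>2 - a / s)"
        using mult_left_mono[OF 1, of "c * exp (- a * s)"] B(4) by (simp add: mult.commute)
      also have "\<dots> = 4 * ?\<phi>' t + 4 * t * ?\<phi>'' t"
        unfolding s(2) unfolding s(3) using s0 by (simp add: field_simps power2_eq_square power3_eq_cube)
      finally show ?thesis using nonneg(2)[of q] by linarith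
    qed
    show "?\<phi> ((norm (x - p))\<^sup>2) \<le> u x \<or> (\<exists>x'\<in>ball p R - cball p \<rho>. u x' \<le> u x \<and> norm (x' - p) = norm (x - p))"
      if xb: "x \<in> (cball p R - ball p \<rho>) - (ball p R - cball p \<rho>)" for x
    proof -
      consider "norm (x - p) = R" | "norm (x - p) = \<rho>"
        using xb by (force simp: dist_norm norm_minus_commute)
      then show ?thesis
      proof cases
        case 1
        then show ?thesis using nonneg(1) B by (simp add: E_def)
      next
        case 2
        have "exp (- a * \<rho>) \<le> 1" using a0 B by simp
        moreover have "E \<ge> 0" by (simp add: E_def)
        ultimately have "exp (- a * \<rho>) - E \<le> 1" by linarith
        then have "c * (exp (- a * \<rho>) - E) \<le> c" using B(4) by (simp add: mult_left_le)
        moreover have "u x \<ge> c" using B(5)[of x] 2 by (simp add: dist_norm norm_minus_commute)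
        ultimately show ?thesis using 2 B(2) by simp
      qed
    qed
    show "continuous_on {0<..} ?\<phi>''" by (intro continuous_intros) auto
    show "compact (cball p R - ball p \<rho>)" by (simp add: compact_diff)
    show "cball p R - ball p \<rho> \<subseteq> closure G" using B(1) closure_subset by blast
    show "ball p R - cball p \<rho> \<subseteq> G" using B(1) by auto
    show "x \<in> cball p R - ball p \<rho>" using x by (auto simp: dist_norm norm_minus_commute)
    show "(norm (q - p))\<^sup>2 \<in> {0<..}" if "q \<in> ball p R - cball p \<rho>" for q
      using that B(2) by (auto simp: dist_norm norm_minus_commute)
    show "continuous_on (cball p R - ball p \<rho>) (\<lambda>x. ?\<phi> ((norm (x - p))\<^sup>2))"
      by (intro continuous_intros)
  qed auto
  then show ?thesis by (simp add: E_def)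
qed

text \<open>Lower comparison applied to -u with the barrier -M exp(al (t - r^2)), which equals -M on
  the circle. Its Laplacian has the factor 4 al + 4 t al^2, at most \<mu>^2/2 + \<mu>^2/4 by 1/r <=
  \<mu>/2, and al = \<mu>/(4r) yields the exponent -\<mu> r/4 at the centre.\<close>

lemma ball_upper_bound:
  assumes G: "open G" "bounded G" and u: "u \<in> CG G" and g: "g \<in> CG G"
    and weak: "weak_laplacian G u (\<lambda>x. \<mu>\<^sup>2 * u x - g x)"
    and B: "cball p r \<subseteq> G" "0 < r" "\<And>x. x \<in> ball p r \<Longrightarrow> g x = 0" "\<And>x. u x \<le> M" "M \<ge> 0"
    and \<mu>: "\<mu> \<ge> 2 / r" 
  shows "u p \<le> M * exp (- \<mu> * r / 4)"
proof -
  define al where "al = \<mu> / (4 * r)"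
  have \<mu>0: "\<mu> > 0" using \<mu> B(2) by (meson divide_pos_pos less_le_trans zero_less_numeral)
  have al: "al > 0" using \<mu>0 B(2) by (simp add: al_def)
  let ?\<phi> = "\<lambda>t. - M * exp (al * (t - r\<^sup>2))"
  have u': "(\<lambda>x. -1 * u x + 0 * u x) \<in> CG G" "(\<lambda>x. -1 * g x + 0 * g x) \<in> CG G" 
    using CG_linear[OF u u] CG_linear[OF g g] by blast+
  have "weak_laplacian G (\<lambda>x. -1 * u x + 0 * u x) (\<lambda>x. -1 * (\<mu>\<^sup>2 * u x - g x) + 0 * (\<mu>\<^sup>2 * u x - g x))"
    using CG_linear[OF u g, of "\<mu>\<^sup>2" "-1"] by (intro weak_laplacian_linear[OF G u u _ _ weak weak]) auto
  then have w: "weak_laplacian G (\<lambda>x. - u x) (\<lambda>x. \<mu>\<^sup>2 * - u x - - g x)" by simp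
  have "?\<phi> ((norm (p - p))\<^sup>2) \<le> - u p"
  proof (rule weak_laplacian_radial_comparison[OF G u'[simplified] _ w, where K = "cball p r" and D = "ball p r"
        and I = UNIV and \<phi> = ?\<phi> and \<phi>' = "\<lambda>t. al * ?\<phi> t" and \<phi>'' = "\<lambda>t. al\<^sup>2 * ?\<phi> t"])
    show "\<mu>\<^sup>2 * ?\<phi> t - - g q \<le> 4 * (al * ?\<phi> t) + 4 * t * (al\<^sup>2 * ?\<phi> t)"
      if "q \<in> ball p r" "t = (norm (q - p))\<^sup>2" for q t
    proof -
      have "t \<le> r\<^sup>2" using that by (auto intro!: power_mono simp: dist_norm norm_minus_commute)
      then have "4 * t * al\<^sup>2 \<le> 4 * r\<^sup>2 * al\<^sup>2" by (simp add: mult_right_mono)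
      also have "\<dots> = \<mu>\<^sup>2 / 4" using B(2) by (simp add: al_def power2_eq_square)
      finally have 1: "4 * t * al\<^sup>2 \<le> \<mu>\<^sup>2 / 4" .
      have "4 * al = \<mu> * (1 / r)" by (simp add: al_def)
      also have "\<dots> \<le> \<mu> * (\<mu> / 2)" using \<mu> \<mu>0 by (intro mult_left_mono) auto
      also have "\<dots> = \<mu>\<^sup>2 / 2" by (simp add: power2_eq_square)
      finally have "4 * al + 4 * t * al\<^sup>2 \<le> \<mu>\<^sup>2" using 1 zero_le_power2[of \<mu>] by linarith
      then have "(4 * al + 4 * t * al\<^sup>2) * (M * exp (al * (t - r\<^sup>2))) \<le> \<mu>\<^sup>2 * (M * exp (al * (t - r\<^sup>2)))"
        using B(5) by (intro mult_right_mono) auto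
      then show ?thesis using B(3)[OF that(1)] by (simp add: algebra_simps)
    qed
    show "?\<phi> ((norm (x - p))\<^sup>2) \<le> - u x \<or> (\<exists>x'\<in>ball p r. - u x' \<le> - u x \<and> norm (x' - p) = norm (x - p))"
      if "x \<in> cball p r - ball p r" for x
    proof -
      have "norm (x - p) = r" using that by (auto simp: dist_norm norm_minus_commute)
      then show ?thesis using B(4)[of x] by simp
    qed
    show "(?\<phi> has_real_derivative al * ?\<phi> t) (at t)" for t
      by (auto intro!: derivative_eq_intros)
    show "((\<lambda>t. al * ?\<phi> t) has_real_derivative al\<^sup>2 * ?\<phi> t) (at t)" for t
      by (auto intro!: derivative_eq_intros simp: power2_eq_square)
  qed (use B \<mu>0 closure_subset[of G] in \<open>auto intro!: continuous_intros\<close>)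
  moreover have "al * ((norm (p - p))\<^sup>2 - r\<^sup>2) = - \<mu> * r / 4"
    using B(2) by (simp add: al_def power2_eq_square)
  ultimately have "- M * exp (- \<mu> * r / 4) \<le> - u p" by (simp only:)
  then show ?thesis by linarith
qed

section \<open>The nonlocal spaces and closures\<close>

lemma abs_le_supn:
  assumes "u \<in> CG G" "bounded G" "G \<noteq> {}"
  shows "\<bar>u x\<bar> \<le> supn G u"
proof -
  obtain M where M: "\<And>x. \<bar>u x\<bar> \<le> M" using CG_bounded[OF assms(1,2)] by blast
  have bdd: "bdd_above ((\<lambda>x. \<bar>u x\<bar>) ` closure G)" unfolding bdd_above_def using M by auto
  have up: "\<bar>u y\<bar> \<le> supn G u" if "y \<in> closure G" for y
    unfolding supn_def by (rule cSUP_upper[OF that bdd])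
  show ?thesis
  proof (cases "x \<in> closure G")
    case False
    obtain y where "y \<in> closure G" using assms(3) closure_subset by blast
    from up[OF this] have "supn G u \<ge> 0" by linarith
    then show ?thesis using False assms(1) by (simp add: CG_def)
  qed (rule up)
qed

lemma supn_le:
  assumes "G \<noteq> {}" "\<And>x. \<bar>u x\<bar> \<le> e"
  shows "supn G u \<le> e"
  unfolding supn_def using assms by (intro cSUP_least) auto

lemma weak_laplacian_limit:
  assumes G: "open G" "bounded G" and u: "u \<in> CG G" and f: "f \<in> CG G"
    and approx: "\<And>e. e > 0 \<Longrightarrow> \<exists>v g. v \<in> CG G \<and> g \<in> CG G \<and> weak_laplacian G v g \<and>
      (\<forall>x. \<bar>v x - u x\<bar> \<le> e) \<and> (\<forall>x. \<bar>g x - f x\<bar> \<le> e)"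
  shows "weak_laplacian G u f"
  unfolding weak_laplacian_def
proof (intro allI impI)
  fix q and s :: real assume s: "s > 0" "cball q s \<subseteq> G"
  define V where "V = measure lebesgue G"
  have V: "V \<ge> 0" by (simp add: V_def)
  have bdd: "\<exists>C\<ge>0. \<forall>x\<in>G. \<bar>\<phi> x\<bar> \<le> C" if "continuous_on UNIV \<phi>" for \<phi> :: "complex \<Rightarrow> real"
  proof -
    have "compact (\<phi> ` closure G)" using that G by (intro compact_continuous_image) (auto intro: continuous_on_subset)
    then obtain C where "\<And>x. x \<in> closure G \<Longrightarrow> \<bar>\<phi> x\<bar> \<le> C"
      using compact_imp_bounded bounded_iff by (metis imageI real_norm_def)
    then have "\<forall>x\<in>G. \<bar>\<phi> x\<bar> \<le> max C 0" using closure_subset by fastforce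
    then show ?thesis by (intro exI[of _ "max C 0"]) simp
  qed
  obtain C1 where C1: "C1 \<ge> 0" "\<And>x. x \<in> G \<Longrightarrow> \<bar>lap_bump s q x\<bar> \<le> C1" using bdd[OF continuous_on_lap_bump] by blast
  obtain C2 where C2: "C2 \<ge> 0" "\<And>x. x \<in> G \<Longrightarrow> \<bar>bump s q x\<bar> \<le> C2" using bdd[OF continuous_on_bump] by blast
  have close: "\<bar>integral G (\<lambda>x. v x * \<phi> x) - integral G (\<lambda>x. w x * \<phi> x)\<bar> \<le> e * C * V"
    if "(\<lambda>x. v x * \<phi> x) integrable_on G" "(\<lambda>x. w x * \<phi> x) integrable_on G" "\<forall>x. \<bar>v x - w x\<bar> \<le> e" 
      "\<And>x. x \<in> G \<Longrightarrow> \<bar>\<phi> x\<bar> \<le> C" "C \<ge> 0" for v w \<phi> :: "complex \<Rightarrow> real" and e C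
  proof -
    have "\<bar>integral G (\<lambda>x. v x * \<phi> x - w x * \<phi> x)\<bar> \<le> e * C * V" unfolding V_def
    proof (rule integral_abs_le_measure[OF G])
      show "(\<lambda>x. v x * \<phi> x - w x * \<phi> x) integrable_on G" using that by (intro integrable_diff)
      fix x assume x: "x \<in> G"
      have "\<bar>v x * \<phi> x - w x * \<phi> x\<bar> = \<bar>v x - w x\<bar> * \<bar>\<phi> x\<bar>" by (simp add: abs_mult[symmetric] left_diff_distrib)
      also have "\<dots> \<le> e * C" using that(3)[rule_format, of x] that(4)[OF x] by (intro mult_mono) auto
      finally show "\<bar>v x * \<phi> x - w x * \<phi> x\<bar> \<le> e * C" .
    qed
    then show ?thesis using integral_diff[OF that(1,2)] by simp
  qed
  let ?A = "integral G (\<lambda>x. u x * lap_bump s q x)" and ?B = "integral G (\<lambda>x. f x * bump s q x)"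
  have main: "\<bar>?A - ?B\<bar> \<le> e * ((C1 + C2) * V)" if "e > 0" for e
  proof -
    obtain v g where vg: "v \<in> CG G" "g \<in> CG G" "weak_laplacian G v g" 
      "\<forall>x. \<bar>v x - u x\<bar> \<le> e" "\<forall>x. \<bar>g x - f x\<bar> \<le> e" using approx[OF \<open>e > 0\<close>] by blast
    have "\<bar>integral G (\<lambda>x. v x * lap_bump s q x) - ?A\<bar> \<le> e * C1 * V"
      using C1 vg u by (intro close integrable_mult_lap_bump G s CG_continuous_interior)
    moreover have "\<bar>integral G (\<lambda>x. g x * bump s q x) - ?B\<bar> \<le> e * C2 * V"
      using C2 vg f by (intro close integrable_mult_bump G s CG_continuous_interior)
    moreover have "integral G (\<lambda>x. v x * lap_bump s q x) = integral G (\<lambda>x. g x * bump s q x)"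
      using vg(3) s by (simp add: weak_laplacian_def)
    ultimately have "\<bar>?A - ?B\<bar> \<le> e * C1 * V + e * C2 * V" by linarith
    then show ?thesis by (simp add: algebra_simps)
  qed
  show "?A = ?B"
  proof (rule ccontr)
    assume "?A \<noteq> ?B"
    then have p: "\<bar>?A - ?B\<bar> > 0" by simp
    define W where "W = (C1 + C2) * V"
    have W: "W \<ge> 0" using C1(1) C2(1) V by (simp add: W_def)
    have "\<bar>?A - ?B\<bar> \<le> \<bar>?A - ?B\<bar> / (W + 1) * W"
      using main[of "\<bar>?A - ?B\<bar> / (W + 1)"] p W unfolding W_def by (simp add: add_nonneg_pos)
    also have "\<dots> < \<bar>?A - ?B\<bar>" using p W by (simp add: field_simps)
    finally show False by simp
  qed
qed

text \<open>Both sides of the weak equation are continuous under uniform convergence because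
  \<open>G\<close> is bounded. Closability and the resolvent equation see the graph closure only
  through this inclusion.\<close>

lemma graph_closure_imp_weak:
  assumes G: "open G" "bounded G" "G \<noteq> {}" and X: "X \<subseteq> CG G"
    and uf: "(u, f) \<in> graph_closure G X (lap_graph G X)"
  shows "weak_laplacian G u f"
proof -
  obtain s where s: "\<And>n. s n \<in> lap_graph G X" "u \<in> X" "f \<in> X"
     "(\<lambda>n. supn G (\<lambda>x. fst (s n) x - u x)) \<longlonglongrightarrow> 0" "(\<lambda>n. supn G (\<lambda>x. snd (s n) x - f x)) \<longlonglongrightarrow> 0"
    using uf unfolding graph_closure_def by blast
  have sn: "fst (s n) \<in> CG G" "snd (s n) \<in> CG G" "dist_laplacian_eq G (fst (s n)) (snd (s n))" for n
    using s(1)[of n] X by (auto simp: lap_graph_def)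
  have uf': "u \<in> CG G" "f \<in> CG G" using s X by auto
  have diff: "\<bar>v x - w x\<bar> \<le> supn G (\<lambda>x. v x - w x)" if "v \<in> CG G" "w \<in> CG G" for v w x
    using abs_le_supn[OF CG_linear[OF that, of 1 "-1"] G(2,3)] by simp
  show ?thesis
  proof (rule weak_laplacian_limit[OF G(1,2) uf'])
    fix e :: real assume "e > 0"
    have "\<forall>\<^sub>F n in sequentially. supn G (\<lambda>x. fst (s n) x - u x) < e \<and> supn G (\<lambda>x. snd (s n) x - f x) < e"
      using s(4,5)[THEN order_tendstoD(2), OF \<open>e > 0\<close>] by (rule eventually_conj)
    then obtain n where "supn G (\<lambda>x. fst (s n) x - u x) < e" "supn G (\<lambda>x. snd (s n) x - f x) < e"
      using eventually_happens'[OF sequentially_bot] by blast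
    then show "\<exists>v g. v \<in> CG G \<and> g \<in> CG G \<and> weak_laplacian G v g \<and> (\<forall>x. \<bar>v x - u x\<bar> \<le> e) \<and> (\<forall>x. \<bar>g x - f x\<bar> \<le> e)"
      using sn[of n] diff[OF sn(1) uf'(1), of n] diff[OF sn(2) uf'(2), of n]
      by (intro exI[of _ "fst (s n)"] exI[of _ "snd (s n)"] conjI allI dist_laplacian_eq_imp_weak)
        (auto intro: order_trans[OF _ less_imp_le])
  qed
qed

text \<open>By linearity 0 is a weak solution with right-hand side g - f; touching it from below by
  the constant 0 gives f <= g at every interior point. Exchanging roles gives equality in
  \<open>G\<close>, and continuity extends it to the closure.\<close>

lemma weak_laplacian_unique:
  assumes G: "open G" "bounded G" and "u \<in> CG G" "f \<in> CG G" "g \<in> CG G" "weak_laplacian G u f" "weak_laplacian G u g"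
  shows "f = g"
proof -
  have le: "f p \<le> g p" if p: "p \<in> G" and fg: "f \<in> CG G" "g \<in> CG G" "weak_laplacian G u f" "weak_laplacian G u g" for f g p
  proof -
    obtain r where r: "r > 0" "ball p r \<subseteq> G" using G(1) p open_contains_ball by blast
    have "weak_laplacian G (\<lambda>x. 1 * u x + -1 * u x) (\<lambda>x. 1 * g x + -1 * f x)"
      using assms fg by (intro weak_laplacian_linear)
    then have w: "weak_laplacian G (\<lambda>x. 0) (\<lambda>x. g x - f x)" by simp
    have "0 \<le> g p - f p"
    proof (rule weak_laplacian_touching_below[OF G _ _ _ w r, of 0 "\<lambda>x. 0" "\<lambda>x. 0"])
      show "continuous_on G (\<lambda>x. g x - f x)" using fg by (intro continuous_intros CG_continuous_interior)
      show "has_star_laplacian (\<lambda>x. 0) 0 q" for q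
        by (simp add: has_star_laplacian_def star_diff_def[abs_def])
    qed auto
    then show ?thesis by simp
  qed
  have eqG: "f p = g p" if "p \<in> G" for p using le[of p f g] le[of p g f] assms that by auto
  show ?thesis
  proof
    fix x
    show "f x = g x"
    proof (cases "x \<in> closure G")
      case True
      then show ?thesis
        using continuous_constant_on_closure[OF continuous_on_diff[OF CG_continuous[OF assms(4)] CG_continuous[OF assms(5)]], of 0 x]
          eqG by simp
    next
      case False
      then show ?thesis using assms by (simp add: CG_def)
    qed
  qed
qed

lemma closable_lap_graph:
  assumes G: "open G" "bounded G" "G \<noteq> {}" and X: "X \<subseteq> CG G"
  shows "closable G X (lap_graph G X)"
  unfolding closable_def
proof (intro allI impI)
  fix u f g assume *: "(u, f) \<in> graph_closure G X (lap_graph G X)" "(u, g) \<in> graph_closure G X (lap_graph G X)"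
  then have "u \<in> CG G" "f \<in> CG G" "g \<in> CG G" using X by (auto simp: graph_closure_def)
  then show "f = g" using weak_laplacian_unique[OF G(1,2)] graph_closure_imp_weak[OF G X] * by blast
qed

text \<open>A common format for the three spaces: each triple is one pointwise linear condition, and
  a Dirichlet condition is a triple with coefficient 0.\<close>

definition nonlocal_space :: "complex set \<Rightarrow> (complex \<times> complex \<times> real) set \<Rightarrow> (complex \<Rightarrow> real) set" where
  "nonlocal_space G S = {u \<in> CG G. \<forall>(y, z, c)\<in>S. u y = c * u z}"

lemma nonlocal_space_subset: "nonlocal_space G S \<subseteq> CG G"
  by (auto simp: nonlocal_space_def)

lemma nonlocal_spaceD: "u \<in> nonlocal_space G S \<Longrightarrow> (y, z, c) \<in> S \<Longrightarrow> u y = c * u z"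
  by (auto simp: nonlocal_space_def)

lemma nonlocal_space_linear:
  assumes "u \<in> nonlocal_space G S" "v \<in> nonlocal_space G S"
  shows "(\<lambda>x. a * u x + b * v x) \<in> nonlocal_space G S"
proof -
  have "(\<lambda>x. a * u x + b * v x) \<in> CG G" using assms CG_linear nonlocal_space_subset by blast
  moreover have "a * u y + b * v y = c * (a * u z + b * v z)" if "(y, z, c) \<in> S" for y z c
    unfolding nonlocal_spaceD[OF assms(1) that] nonlocal_spaceD[OF assms(2) that] by (simp add: algebra_simps)
  ultimately show ?thesis by (auto simp: nonlocal_space_def)
qed

lemma nonlocal_space_uniform_limit:
  assumes "\<And>n::nat. u n \<in> nonlocal_space G S" "uniform_limit UNIV u v sequentially"
  shows "v \<in> nonlocal_space G S"
proof -
  have pt: "(\<lambda>n. u n x) \<longlonglongrightarrow> v x" for x using tendsto_uniform_limitI[OF assms(2)] by simp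
  have CG: "u n \<in> CG G" for n using assms(1) nonlocal_space_subset by blast
  have "uniform_limit (closure G) u v sequentially" using assms(2) uniform_limit_on_subset by blast
  then have "continuous_on (closure G) v"
    by (intro uniform_limit_theorem[where f = u and F = sequentially]) (auto intro!: always_eventually CG_continuous CG)
  moreover have "v x = 0" if "x \<notin> closure G" for x
    using pt[of x] CG that by (auto simp: CG_def LIMSEQ_const_iff)
  moreover have "v y = c * v z" if "(y, z, c) \<in> S" for y z c
  proof -
    have "(\<lambda>n. c * u n z) \<longlonglongrightarrow> c * v z" by (intro tendsto_intros pt)
    then have "(\<lambda>n. u n y) \<longlonglongrightarrow> c * v z" using nonlocal_spaceD[OF assms(1) that] by simp
    then show ?thesis using pt[of y] LIMSEQ_unique by blast
  qed
  ultimately show ?thesis by (auto simp: nonlocal_space_def CG_def)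
qed

section \<open>Resolvents of Feller semigroups\<close>

text \<open>Joint continuity in space and time makes the truncated resolvent integrals continuous
  functions of the space variable.\<close>

lemma equicontinuous_times:
  fixes F :: "real \<Rightarrow> complex \<Rightarrow> real"
  assumes cont: "\<And>s. s \<ge> 0 \<Longrightarrow> continuous_on C (F s)"
    and equi: "\<And>s e. s \<ge> 0 \<Longrightarrow> e > 0 \<Longrightarrow> \<exists>d>0. \<forall>t\<ge>0. \<bar>t - s\<bar> < d \<longrightarrow> (\<forall>x. \<bar>F t x - F s x\<bar> \<le> e)"
  shows "continuous_on (C \<times> {0..b}) (\<lambda>(x, s). F s x)"
proof (rule continuous_on_iff[THEN iffD2], clarsimp)
  fix x s and e :: real assume x: "x \<in> C" and s: "0 \<le> s" "s \<le> b" and "e > 0"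
  obtain d1 where d1: "d1 > 0" "\<And>t x. t \<ge> 0 \<Longrightarrow> \<bar>t - s\<bar> < d1 \<Longrightarrow> \<bar>F t x - F s x\<bar> \<le> e / 3"
    using equi[OF s(1), of "e / 3"] \<open>e > 0\<close> by auto
  obtain d2 where d2: "d2 > 0" "\<And>y. y \<in> C \<Longrightarrow> dist y x < d2 \<Longrightarrow> \<bar>F s y - F s x\<bar> < e / 3"
    using cont[OF s(1)] x \<open>e > 0\<close> unfolding continuous_on_iff dist_real_def by (metis divide_pos_pos zero_less_numeral)
  show "\<exists>d>0. \<forall>y\<in>C. \<forall>t\<in>{0..b}. dist (y, t) (x, s) < d \<longrightarrow> dist (F t y) (F s x) < e"
  proof (intro exI[of _ "min d1 d2"] conjI ballI impI)
    fix y t assume yt: "y \<in> C" "t \<in> {0..b}" "dist (y, t) (x, s) < min d1 d2"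
    have "dist t s < d1" "dist y x < d2"
      using yt(3) dist_snd_le[of "(y, t)" "(x, s)"] dist_fst_le[of "(y, t)" "(x, s)"] by auto
    then have "\<bar>F t y - F s y\<bar> \<le> e / 3" "\<bar>F s y - F s x\<bar> < e / 3"
      using d1(2)[of t y] d2(2)[of y] yt by (auto simp: dist_real_def)
    then show "dist (F t y) (F s x) < e" using \<open>e > 0\<close> unfolding dist_real_def by linarith
  qed (use d1 d2 in auto)
qed

text \<open>The resolvent \<open>\<integral>\<^sub>0\<^sup>\<infinity> e\<^sup>-\<^sup>\<lambda>\<^sup>s T\<^sub>s f ds\<close> of a semigroup is built pointwise; the truncated integrals
  \<open>P\<^sub>n\<close> satisfy \<open>T\<^sub>h P\<^sub>n = e\<^sup>\<lambda>\<^sup>h (P\<^sub>n\<^sub>+\<^sub>h - P\<^sub>h)\<close>, from which their image under the generator is read off.\<close>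

lemma feller_resolvent:
  fixes G S defines "X \<equiv> nonlocal_space G S"
  assumes G: "open G" "bounded G" "G \<noteq> {}"
    and T: "feller_semigroup G X T"
    and gen: "is_generator G X T (graph_closure G X (lap_graph G X))"
    and f: "f \<in> X" "\<And>x. f x \<ge> 0" and lam: "lam > 0"
  obtains u where "u \<in> X" "weak_laplacian G u (\<lambda>x. lam * u x - f x)"
    "\<And>x. 0 \<le> u x" "\<And>x. u x \<le> supn G f / lam"
proof -
  have TX: "\<And>t u. t \<ge> 0 \<Longrightarrow> u \<in> X \<Longrightarrow> T t u \<in> X"
    and Tlin: "\<And>t u v a b. t \<ge> 0 \<Longrightarrow> u \<in> X \<Longrightarrow> v \<in> X \<Longrightarrow> T t (\<lambda>x. a * u x + b * v x) = (\<lambda>x. a * T t u x + b * T t v x)"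
    and T0: "\<And>u. u \<in> X \<Longrightarrow> T 0 u = u"
    and Tadd: "\<And>s t u. s \<ge> 0 \<Longrightarrow> t \<ge> 0 \<Longrightarrow> u \<in> X \<Longrightarrow> T (s + t) u = T s (T t u)"
    and Tc: "\<And>u. u \<in> X \<Longrightarrow> ((\<lambda>t. supn G (\<lambda>x. T t u x - u x)) \<longlongrightarrow> 0) (at_right 0)"
    and Tcontr: "\<And>t u. t \<ge> 0 \<Longrightarrow> u \<in> X \<Longrightarrow> supn G (T t u) \<le> supn G u"
    and Tpos: "\<And>t u x. t \<ge> 0 \<Longrightarrow> u \<in> X \<Longrightarrow> \<forall>x\<in>closure G. u x \<ge> 0 \<Longrightarrow> x \<in> closure G \<Longrightarrow> T t u x \<ge> 0"
    using T by (simp_all add: feller_semigroup_def)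
  have XCG: "u \<in> CG G" if "u \<in> X" for u using that nonlocal_space_subset X_def by blast
  have Xlin: "(\<lambda>x. a * u x + b * v x) \<in> X" if "u \<in> X" "v \<in> X" for u v a b
    using that nonlocal_space_linear unfolding X_def by blast
  have Xdiff: "(\<lambda>x. u x - v x) \<in> X" if "u \<in> X" "v \<in> X" for u v
    using Xlin[OF that, of 1 "-1"] by simp
  have b: "\<bar>u x\<bar> \<le> supn G u" if "u \<in> X" for u x using abs_le_supn[OF XCG[OF that] G(2,3)] .
  have contr: "\<bar>T t u x\<bar> \<le> e" if "u \<in> X" "t \<ge> 0" "\<And>x. \<bar>u x\<bar> \<le> e" for t u e x
    using b[OF TX[OF that(2,1)], of x] Tcontr[OF that(2,1)] supn_le[OF G(3), of u e, OF that(3)] by linarith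
  have Tdiff: "T t (\<lambda>x. u x - v x) = (\<lambda>x. T t u x - T t v x)" if "u \<in> X" "v \<in> X" "t \<ge> 0" for t u v
    using Tlin[OF that(3,1,2), of 1 "-1"] by simp
  \<comment> \<open>Strong continuity is given only at 0 from the right. Writing T_t v - T_s v as
    T_s applied to T_(t-s) v - v, contractivity turns it into continuity uniform in s, on both
    sides.\<close>
  have equi: "\<exists>d>0. \<forall>s\<ge>0. \<forall>t\<ge>0. \<bar>t - s\<bar> < d \<longrightarrow> (\<forall>x. \<bar>T t v x - T s v x\<bar> \<le> e)" if v: "v \<in> X" and "e > 0" for v e
  proof -
    obtain d where d: "d > 0" "\<And>h. 0 < h \<Longrightarrow> h < d \<Longrightarrow> supn G (\<lambda>x. T h v x - v x) < e"
      using order_tendstoD(2)[OF Tc[OF v] \<open>e > 0\<close>] unfolding eventually_at_right_field by auto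
    have le: "\<bar>T t v x - T s v x\<bar> \<le> e" if "0 \<le> s" "s \<le> t" "t - s < d" for s t x
    proof (cases "s = t")
      case False
      define h where "h = t - s"
      have h: "h > 0" "h < d" using that False by (auto simp: h_def)
      have D: "(\<lambda>x. T h v x - v x) \<in> X" using Xdiff[OF TX v] v h by simp
      have "\<bar>T s (\<lambda>x. T h v x - v x) x\<bar> \<le> e"
        using b[OF D] d(2)[OF h] by (intro contr[OF D that(1)]) (meson less_imp_le order_trans)
      moreover have "T s (\<lambda>x. T h v x - v x) = (\<lambda>x. T s (T h v) x - T s v x)"
        using v h that by (intro Tdiff TX) auto
      moreover have "T s (T h v) = T t v"
        using Tadd[of s h v] that h v by (simp add: h_def)
      ultimately show ?thesis by simp
    qed (use \<open>e > 0\<close> in simp)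
    show ?thesis
    proof (intro exI[of _ d] conjI allI impI)
      fix s t x assume "0 \<le> s" "0 \<le> t" "\<bar>t - s\<bar> < d"
      then show "\<bar>T t v x - T s v x\<bar> \<le> e"
        using le[of s t x] le[of t s x] by (cases "s \<le> t") (auto simp: abs_minus_commute)
    qed (rule d)
  qed
  define F where "F s = T s f" for s
  define W where "W s x = exp (- lam * s) * F s x" for s x
  define M where "M = supn G f"
  have FX: "F s \<in> X" if "s \<ge> 0" for s unfolding F_def using TX f(1) that by blast
  have WX: "W s \<in> X" if "s \<ge> 0" for s
    using Xlin[OF FX FX, of s s "exp (- lam * s)" 0] that by (simp add: W_def[abs_def])
  have FM: "\<bar>F s x\<bar> \<le> M" if "s \<ge> 0" for s x
    unfolding F_def M_def using b[OF f(1)] contr f(1) that by blast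
  have M0: "M \<ge> 0" using FM[of 0 0] by linarith
  have Fpos: "F s x \<ge> 0" if "s \<ge> 0" for s x
    using Tpos[OF that f(1), of x] f(2) XCG[OF FX[OF that]] unfolding F_def by (cases "x \<in> closure G") (auto simp: CG_def)
  have W_le: "W s x \<le> exp (- lam * s) * M" "0 \<le> W s x" if "s \<ge> 0" for s x
    using FM[OF that, of x] Fpos[OF that, of x] by (auto simp: W_def intro: mult_left_mono)
  have Wequi: "\<exists>d>0. \<forall>t\<ge>0. \<bar>t - s\<bar> < d \<longrightarrow> (\<forall>x. \<bar>W t x - W s x\<bar> \<le> e)" if s: "s \<ge> 0" and "e > 0" for s e
  proof -
    obtain d1 where d1: "d1 > 0" "\<And>t x. t \<ge> 0 \<Longrightarrow> \<bar>t - s\<bar> < d1 \<Longrightarrow> \<bar>F t x - F s x\<bar> \<le> e / 2"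
      using equi[OF f(1), of "e / 2"] \<open>e > 0\<close> s unfolding F_def by auto
    have "isCont (\<lambda>t. exp (- lam * t)) s" by (intro continuous_intros)
    then have "\<exists>d>0. \<forall>t. \<bar>t - s\<bar> < d \<longrightarrow> \<bar>exp (- lam * t) - exp (- lam * s)\<bar> < e / (2 * (M + 1))"
      using \<open>e > 0\<close> M0 unfolding continuous_at_eps_delta dist_real_def
      by (elim allE[of _ "e / (2 * (M + 1))"]) auto
    then obtain d2 where d2: "d2 > 0" "\<And>t. \<bar>t - s\<bar> < d2 \<Longrightarrow> \<bar>exp (- lam * t) - exp (- lam * s)\<bar> < e / (2 * (M + 1))"
      by blast
    show ?thesis
    proof (intro exI[of _ "min d1 d2"] conjI allI impI)
      fix t x assume t: "0 \<le> t" "\<bar>t - s\<bar> < min d1 d2"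
      have "W t x - W s x = exp (- lam * t) * (F t x - F s x) + (exp (- lam * t) - exp (- lam * s)) * F s x"
        by (simp add: W_def algebra_simps)
      moreover have "\<bar>exp (- lam * t) * (F t x - F s x)\<bar> \<le> 1 * (e / 2)"
        unfolding abs_mult using d1(2)[of t x] t lam by (intro mult_mono) auto
      moreover have "\<bar>(exp (- lam * t) - exp (- lam * s)) * F s x\<bar> \<le> e / (2 * (M + 1)) * M"
        unfolding abs_mult using d2(2)[of t] t FM[OF s, of x] \<open>e > 0\<close> M0 by (intro mult_mono) auto
      moreover have "e / (2 * (M + 1)) * M \<le> e / 2" using M0 \<open>e > 0\<close> by (simp add: field_simps)
      ultimately show "\<bar>W t x - W s x\<bar> \<le> e" by linarith
    qed (use d1 d2 in auto)
  qed
  have Wjoint: "continuous_on (closure G \<times> {0..r}) (\<lambda>(x, s). W s x)" for r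
    by (rule equicontinuous_times) (use WX XCG CG_continuous Wequi in blast)+
  have Wcont: "continuous_on {0..r} (\<lambda>s. W s x)" for x r
  proof (cases "x \<in> closure G")
    case True
    have "continuous_on {0..r} ((\<lambda>(x, s). W s x) \<circ> Pair x)"
      using True by (intro continuous_on_compose continuous_on_subset[OF Wjoint[of r]] continuous_intros) auto
    then show ?thesis by (simp add: o_def)
  next
    case False
    then have "W s x = 0" if "s \<in> {0..r}" for s using XCG[OF WX[of s]] that by (simp add: CG_def)
    then show ?thesis using continuous_on_cong[of "{0..r}" "{0..r}" "\<lambda>s. W s x" "\<lambda>s. 0"] by simp
  qed
  define P where "P t x = integral {0..t} (\<lambda>s. W s x)" for t x
  have P0: "P 0 = (\<lambda>x. 0)" by (simp add: P_def fun_eq_iff)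
  have Pd: "((\<lambda>t. P t x) has_real_derivative W t x) (at t within {0..r})" if "0 \<le> t" "t \<le> r" for t r x
    unfolding P_def using that by (intro integral_has_real_derivative Wcont) auto
  have Pshift: "((\<lambda>t. P (h + t) x) has_real_derivative W (h + t) x) (at t within {0..r})"
    if "0 \<le> t" "t \<le> r" "0 \<le> h" for t r h x
  proof -
    have "((\<lambda>t. P t x) has_real_derivative W (h + t) x) (at (h + t) within (+) h ` {0..r})"
      using that by (intro DERIV_subset[OF Pd[of "h + t" "h + r"]]) auto
    moreover have "((+) h has_real_derivative 1) (at t within {0..r})" by (auto intro!: derivative_eq_intros)
    ultimately have "((\<lambda>t. P t x) \<circ> (+) h has_real_derivative W (h + t) x * 1) (at t within {0..r})"
      by (rule DERIV_image_chain)
    then show ?thesis by (simp add: o_def)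
  qed
  have PX: "P t \<in> X" if "t \<ge> 0" for t
  proof -
    have "continuous_on (closure G) (\<lambda>x. integral (cbox 0 t) (\<lambda>s. W s x))"
      using Wjoint[of t] by (intro integral_continuous_on_param) (simp add: case_prod_unfold)
    then have "continuous_on (closure G) (P t)" by (simp add: P_def[abs_def])
    moreover have "P t x = 0" if "x \<notin> closure G" for x
    proof -
      have "W s x = 0" if "s \<in> {0..t}" for s using XCG[OF WX[of s]] that \<open>x \<notin> closure G\<close> by (simp add: CG_def)
      then have "P t x = integral {0..t} (\<lambda>s. 0)" unfolding P_def by (intro integral_cong) auto
      then show ?thesis by simp
    qed
    moreover have "P t y = c * P t z" if "(y, z, c) \<in> S" for y z c
    proof -
      have "W s y = c * W s z" if "s \<in> {0..t}" for s
        using WX[of s] that nonlocal_spaceD[OF _ \<open>(y, z, c) \<in> S\<close>] unfolding X_def by simp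
      then have "P t y = integral {0..t} (\<lambda>s. c * W s z)" unfolding P_def by (intro integral_cong) auto
      then show ?thesis by (simp add: P_def)
    qed
    ultimately show ?thesis by (auto simp: X_def nonlocal_space_def CG_def)
  qed
  have Pmvt: "\<exists>\<xi>\<in>{a..c}. P c x - P a x = W \<xi> x * (c - a)" if "0 \<le> a" "a \<le> c" for a c x
  proof -
    have "((\<lambda>t. P t x) has_derivative (*) (W t x)) (at t within {a..c})" if "a \<le> t" "t \<le> c" for t
      using DERIV_subset[OF Pd[of t c x], of "{a..c}"] that \<open>0 \<le> a\<close> by (simp add: has_field_derivative_def)
    from mvt_very_simple[OF that(2) this] show ?thesis by auto
  qed
  \<comment> \<open>Instead of moving T_h through an integral, both sides are compared as functions
    of t: they vanish at t = 0 and have the same derivative, as T_h W_s = exp(lam h)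
    W_(s+h).\<close>
  have TP: "T h (P t) x = exp (lam * h) * (P (t + h) x - P h x)" if h: "h \<ge> 0" and t: "t \<ge> 0" for h t x
  proof -
    have 1: "((\<lambda>s. T h (P s) x) has_real_derivative T h (W s) x) (at s within {0..t})" if s: "s \<in> {0..t}" for s
      unfolding has_field_derivative_def has_derivative_within_alt
    proof (intro conjI allI impI bounded_linear_mult_right)
      fix e :: real assume "e > 0"
      obtain d where d: "d > 0" "\<And>t x. t \<ge> 0 \<Longrightarrow> \<bar>t - s\<bar> < d \<Longrightarrow> \<bar>W t x - W s x\<bar> \<le> e"
        using Wequi[OF _ \<open>e > 0\<close>, of s] s by auto
      show "\<exists>d>0. \<forall>y\<in>{0..t}. norm (y - s) < d \<longrightarrow> norm (T h (P y) x - T h (P s) x - T h (W s) x * (y - s)) \<le> e * norm (y - s)"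
      proof (intro exI[of _ d] conjI ballI impI)
        fix y assume y: "y \<in> {0..t}" "norm (y - s) < d"
        \<comment> \<open>The mean value point depends on \<open>x\<close>, but the equicontinuity
          of \<open>W\<close> makes the bound uniform in \<open>x\<close>, as needed to apply the
          contraction T_h to this remainder.\<close>
        have small: "\<bar>P y x - P s x - (y - s) * W s x\<bar> \<le> e * \<bar>y - s\<bar>" for x
        proof -
          obtain \<xi> where \<xi>: "\<xi> \<ge> 0" "\<bar>\<xi> - s\<bar> \<le> \<bar>y - s\<bar>" "P y x - P s x = W \<xi> x * (y - s)"
          proof (cases "s \<le> y")
            case True
            then obtain \<xi> where "\<xi> \<in> {s..y}" "P y x - P s x = W \<xi> x * (y - s)" using Pmvt[of s y x] s by auto
            then show ?thesis using that[of \<xi>] s by simp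
          next
            case False
            then obtain \<xi> where "\<xi> \<in> {y..s}" "P s x - P y x = W \<xi> x * (s - y)" using Pmvt[of y s x] y by auto
            then show ?thesis using that[of \<xi>] False y by (simp add: algebra_simps)
          qed
          have "P y x - P s x - (y - s) * W s x = (W \<xi> x - W s x) * (y - s)"
            unfolding \<xi>(3) by (simp add: algebra_simps)
          moreover have "\<bar>W \<xi> x - W s x\<bar> \<le> e" using d(2)[of \<xi> x] \<xi> y by simp
          ultimately show ?thesis by (simp add: abs_mult mult_right_mono)
        qed
        have memP: "P y \<in> X" "P s \<in> X" "W s \<in> X" using PX WX y s by auto
        note mem = Xlin[OF memP(1,2), of 1 "-1"] memP
        have mem2: "(\<lambda>x. 1 * (1 * P y x + (-1) * P s x) + (- (y - s)) * W s x) \<in> X"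
          using mem Xlin by blast
        have "T h (\<lambda>x. 1 * (1 * P y x + (-1) * P s x) + (- (y - s)) * W s x) x
            = T h (P y) x - T h (P s) x - T h (W s) x * (y - s)"
          unfolding Tlin[OF h mem(1,4)] Tlin[OF h mem(2,3)] by (simp add: algebra_simps)
        moreover have "\<bar>T h (\<lambda>x. 1 * (1 * P y x + (-1) * P s x) + (- (y - s)) * W s x) x\<bar> \<le> e * \<bar>y - s\<bar>"
          using small by (intro contr[OF mem2 h]) (simp add: algebra_simps)
        ultimately show "norm (T h (P y) x - T h (P s) x - T h (W s) x * (y - s)) \<le> e * norm (y - s)" by simp
      qed (rule d)
    qed
    have 2: "((\<lambda>s. exp (lam * h) * (P (s + h) x - P h x)) has_real_derivative exp (lam * h) * W (s + h) x) (at s within {0..t})"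
      if s: "s \<in> {0..t}" for s
    proof -
      have "((\<lambda>s. P (s + h) x) has_real_derivative W (s + h) x) (at s within {0..t})"
        using Pshift[of s t h x] s h by (simp add: add.commute)
      then show ?thesis by (auto intro!: derivative_eq_intros)
    qed
    have eq: "T h (W s) x = exp (lam * h) * W (s + h) x" if "s \<in> {0..t}" for s
    proof -
      have "T h (W s) = (\<lambda>x. exp (- lam * s) * T h (F s) x)"
        using Tlin[OF h FX FX, of s s "exp (- lam * s)" 0] that by (simp add: W_def[abs_def])
      moreover have "T h (F s) = F (s + h)" unfolding F_def using Tadd[of h s f] f(1) h that by (simp add: add.commute)
      moreover have "exp (lam * h) * exp (- lam * (s + h)) = exp (- lam * s)"
        by (simp add: exp_add[symmetric] algebra_simps)
      ultimately show ?thesis by (simp add: W_def)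
    qed
    have "((\<lambda>s. T h (P s) x - exp (lam * h) * (P (s + h) x - P h x)) has_real_derivative 0) (at s within {0..t})" if "s \<in> {0..t}" for s
      using DERIV_diff[OF 1[OF that] 2[OF that]] eq[OF that] by simp
    then obtain c where c: "\<And>s. s \<in> {0..t} \<Longrightarrow> T h (P s) x - exp (lam * h) * (P (s + h) x - P h x) = c"
      using has_field_derivative_zero_constant[of "{0..t}" "\<lambda>s. T h (P s) x - exp (lam * h) * (P (s + h) x - P h x)"] by auto
    have "T h (P 0) = (\<lambda>x. 0)" using Tlin[OF h f(1) f(1), of 0 0] by (simp add: P0)
    then have "c = 0" using c[of 0] t by simp
    then show ?thesis using c[of t] t by simp
  qed
  \<comment> \<open>The derivative at h = 0 of the formula \<open>TP\<close>, that is, the expected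
    value of the generator at \<open>P t\<close>. As t grows the last summand dies out and lam u - f
    remains.\<close>
  define g where "g t x = lam * P t x - f x + exp (- lam * t) * F t x" for t x
  have gX: "g t \<in> X" if "t \<ge> 0" for t
    using Xlin[OF Xlin[OF PX[OF that] f(1), of lam "-1"] FX[OF that], of 1 "exp (- lam * t)"]
    by (simp add: g_def[abs_def] algebra_simps)
  have quot: "((\<lambda>h. supn G (\<lambda>x. (T h (P t) x - P t x) / h - g t x)) \<longlongrightarrow> 0) (at_right 0)" if t: "t \<ge> 0" for t
  proof (rule tendstoI)
    fix e :: real assume "e > 0"
    \<comment> \<open>The difference quotient will differ from \<open>g t\<close> by at most lam e'
      + e' + e', which is below e.\<close>
    define e' where "e' = e / (lam + 3)"
    have e': "e' > 0" "(lam + 2) * e' < e" using lam \<open>e > 0\<close> by (auto simp: e'_def field_simps)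
    obtain d1 where d1: "d1 > 0" "\<And>s h x. s \<ge> 0 \<Longrightarrow> h \<ge> 0 \<Longrightarrow> \<bar>h - s\<bar> < d1 \<Longrightarrow> \<bar>T h f x - T s f x\<bar> \<le> e'"
      using equi[OF f(1) e'(1)] by blast
    obtain d2 where d2: "d2 > 0" "\<And>s h x. s \<ge> 0 \<Longrightarrow> h \<ge> 0 \<Longrightarrow> \<bar>h - s\<bar> < d2 \<Longrightarrow> \<bar>T h (P t) x - T s (P t) x\<bar> \<le> e'"
      using equi[OF PX[OF t] e'(1)] by blast
    show "\<forall>\<^sub>F h in at_right 0. dist (supn G (\<lambda>x. (T h (P t) x - P t x) / h - g t x)) 0 < e"
      unfolding eventually_at_right_field
    proof (intro exI[of _ "min d1 d2"] conjI allI impI)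
      fix h assume h: "0 < h" "h < min d1 d2"
      have small: "\<bar>(T h (P t) x - P t x) / h - g t x\<bar> \<le> (lam + 2) * e'" for x
      proof -
        \<comment> \<open>The derivative of k -> T_k (P_t) at time k, with \<open>J' 0\<close> equal
          to \<open>g t\<close>. The mean value theorem turns the difference quotient into
          \<open>J' k\<close> with k in [0, h].\<close>
        define J' where "J' k = lam * T k (P t) x + (exp (- lam * t) * F (t + k) x - F k x)" for k
        have "((\<lambda>k. T k (P t) x) has_derivative (*) (J' k)) (at k within {0..h})" if k: "0 \<le> k" "k \<le> h" for k
        proof -
          have a: "((\<lambda>k. P (t + k) x) has_real_derivative W (t + k) x) (at k within {0..h})"
            using Pshift[of k h t x] k t by simp
          have "((\<lambda>k. exp (lam * k) * (P (t + k) x - P k x)) has_real_derivative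
              lam * exp (lam * k) * (P (t + k) x - P k x) + exp (lam * k) * (W (t + k) x - W k x)) (at k within {0..h})"
            using k by (auto intro!: derivative_eq_intros a Pd)
          moreover have "exp (lam * k) * exp (- lam * (t + k)) = exp (- lam * t)" "exp (lam * k) * exp (- lam * k) = 1"
            by (simp_all add: mult_exp_exp algebra_simps)
          then have "exp (lam * k) * (W (t + k) x - W k x) = exp (- lam * t) * F (t + k) x - F k x"
            unfolding W_def right_diff_distrib mult.assoc[symmetric] by simp
          ultimately have "((\<lambda>k. exp (lam * k) * (P (t + k) x - P k x)) has_real_derivative J' k) (at k within {0..h})"
            using TP[OF k(1) t, of x] by (simp add: J'_def mult.assoc)
          then show ?thesis
            unfolding has_field_derivative_def
            by (rule has_derivative_transform[rotated 2]) (use k TP[OF _ t] in auto)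
        qed
        from mvt_very_simple[OF _ this] h obtain k where k: "k \<in> {0..h}" "T h (P t) x - T 0 (P t) x = J' k * h" by auto
        have "(T h (P t) x - P t x) / h = J' k" using k(2) h T0[OF PX[OF t]] by (simp add: field_simps)
        then have "(T h (P t) x - P t x) / h - g t x = lam * (T k (P t) x - T 0 (P t) x)
           + exp (- lam * t) * (T (t + k) f x - T t f x) - (T k f x - T 0 f x)"
          using T0[OF PX[OF t]] T0[OF f(1)] by (simp add: J'_def g_def F_def algebra_simps)
        moreover have "\<bar>lam * (T k (P t) x - T 0 (P t) x)\<bar> \<le> lam * e'"
          using d2(2)[of 0 k x] k h lam by (simp add: abs_mult)
        moreover have "\<bar>exp (- lam * t) * (T (t + k) f x - T t f x)\<bar> \<le> 1 * e'"
          unfolding abs_mult using d1(2)[of t "t + k" x] k h t lam by (intro mult_mono) auto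
        moreover have "\<bar>T k f x - T 0 f x\<bar> \<le> e'" using d1(2)[of 0 k x] k h by simp
        ultimately show ?thesis unfolding distrib_right by linarith
      qed
      have "(\<lambda>x. 1 * ((1 / h) * T h (P t) x + (- (1 / h)) * P t x) + (-1) * g t x) \<in> X"
        using h t by (intro Xlin TX PX gX) auto
      then have "(\<lambda>x. (T h (P t) x - P t x) / h - g t x) \<in> X" by (simp add: diff_divide_distrib)
      from b[OF this] have "0 \<le> supn G (\<lambda>x. (T h (P t) x - P t x) / h - g t x)" by (meson abs_ge_zero order_trans)
      moreover have "supn G (\<lambda>x. (T h (P t) x - P t x) / h - g t x) \<le> (lam + 2) * e'"
        using small by (rule supn_le[OF G(3)])
      ultimately show "dist (supn G (\<lambda>x. (T h (P t) x - P t x) / h - g t x)) 0 < e" using e'(2) by simp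
    qed (use d1 d2 in auto)
  qed
  have weak: "weak_laplacian G (P t) (g t)" if "t \<ge> 0" for t
  proof -
    have "(P t, g t) \<in> graph_closure G X (lap_graph G X)"
      using gen quot[OF that] PX[OF that] gX[OF that] unfolding is_generator_def by blast
    then show ?thesis using graph_closure_imp_weak[OF G, of X] nonlocal_space_subset X_def by blast
  qed
  have Pmono: "P a x \<le> P c x" if "0 \<le> a" "a \<le> c" for a c x
    using Pmvt[OF that, of x] W_le(2) that by (smt (verit) atLeastAtMost_iff mult_nonneg_nonneg)
  \<comment> \<open>Tail estimate: since W_t <= M exp(-lam t), the function P_t + (M/lam) exp(-lam
    t) is nonincreasing in t.\<close>
  have Pbound: "P c x - P a x \<le> M / lam * exp (- lam * a)" if ac: "0 \<le> a" "a \<le> c" for a c x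
  proof -
    have "((\<lambda>t. P t x + M / lam * exp (- lam * t)) has_derivative (*) (W t x - M * exp (- lam * t))) (at t within {a..c})"
      if "a \<le> t" "t \<le> c" for t
    proof -
      have "((\<lambda>t. P t x) has_real_derivative W t x) (at t within {a..c})"
        using DERIV_subset[OF Pd[of t c x], of "{a..c}"] that ac by auto
      then have "((\<lambda>t. P t x + M / lam * exp (- lam * t)) has_real_derivative W t x - M * exp (- lam * t)) (at t within {a..c})"
        using lam by (auto intro!: derivative_eq_intros)
      then show ?thesis by (simp add: has_field_derivative_def)
    qed
    from mvt_very_simple[OF ac(2) this] obtain t where t: "t \<in> {a..c}"
      "(P c x + M / lam * exp (- lam * c)) - (P a x + M / lam * exp (- lam * a)) = (W t x - M * exp (- lam * t)) * (c - a)" by blast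
    have "(W t x - M * exp (- lam * t)) * (c - a) \<le> 0"
      using W_le(1)[of t x] t ac by (intro mult_nonpos_nonneg) (auto simp: mult.commute)
    moreover have "M / lam * exp (- lam * c) \<ge> 0" using M0 lam by simp
    ultimately show ?thesis using t(2) by linarith
  qed
  define u where "u x = lim (\<lambda>n. P (real n) x)" for x
  have lim: "(\<lambda>n. P (real n) x) \<longlonglongrightarrow> u x" for x
  proof -
    have "incseq (\<lambda>n. P (real n) x)" by (intro incseq_SucI Pmono) auto
    moreover have "P (real n) x \<le> M / lam" for n using Pbound[of 0 "real n" x] by (simp add: P0)
    ultimately obtain l where "(\<lambda>n. P (real n) x) \<longlonglongrightarrow> l" using incseq_convergent by metis
    then show ?thesis unfolding u_def using limI by metis
  qed
  have close: "\<bar>P (real n) x - u x\<bar> \<le> M / lam * exp (- lam * real n)" for n x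
  proof -
    have "P (real n) x \<le> u x"
      using Pmono by (intro LIMSEQ_le_const[OF lim]) (auto intro!: exI[of _ n])
    moreover have "u x \<le> P (real n) x + M / lam * exp (- lam * real n)"
    proof (intro LIMSEQ_le_const2[OF lim] exI[of _ n] allI impI)
      fix m assume "n \<le> m"
      then show "P (real m) x \<le> P (real n) x + M / lam * exp (- lam * real n)"
        using Pbound[of "real n" "real m" x] by simp
    qed
    ultimately show ?thesis by simp
  qed
  have small: "\<exists>n. M / lam * exp (- lam * real n) \<le> e" if "e > 0" for e
  proof -
    have "((\<lambda>n. M / lam * exp (- lam * real n)) \<longlongrightarrow> M / lam * 0) sequentially"
      using lam by (intro tendsto_intros filterlim_compose[OF exp_at_bot] filterlim_tendsto_neg_mult_at_bot[OF tendsto_const] filterlim_real_sequentially) auto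
    then have "\<forall>\<^sub>F n in sequentially. M / lam * exp (- lam * real n) < e" using order_tendstoD(2)[of _ 0] that by simp
    then show ?thesis using eventually_happens'[OF sequentially_bot] less_imp_le by blast
  qed
  have uX: "u \<in> X"
    unfolding X_def
  proof (rule nonlocal_space_uniform_limit)
    show "P (real n) \<in> nonlocal_space G S" for n using PX unfolding X_def by simp
    show "uniform_limit UNIV (\<lambda>n. P (real n)) u sequentially"
      unfolding uniform_limit_iff
    proof (intro allI impI)
      fix e :: real assume "e > 0"
      obtain N where N: "M / lam * exp (- lam * real N) \<le> e / 2" using small[of "e / 2"] \<open>e > 0\<close> by auto
      show "\<forall>\<^sub>F n in sequentially. \<forall>x\<in>UNIV. dist (P (real n) x) (u x) < e"
        unfolding eventually_sequentially
      proof (intro exI[of _ N] allI impI ballI)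
        fix n x assume "N \<le> n"
        then have "M / lam * exp (- lam * real n) \<le> M / lam * exp (- lam * real N)"
          using M0 lam by (intro mult_left_mono) auto
        then show "dist (P (real n) x) (u x) < e" using close[of n x] N \<open>e > 0\<close> unfolding dist_real_def by linarith
      qed
    qed
  qed
  have "weak_laplacian G u (\<lambda>x. lam * u x - f x)"
  proof (rule weak_laplacian_limit[OF G(1,2)])
    show "u \<in> CG G" using uX XCG by blast
    show "(\<lambda>x. lam * u x - f x) \<in> CG G" using XCG[OF Xlin[OF uX f(1), of lam "-1"]] by simp
    fix e :: real assume "e > 0"
    \<comment> \<open>The right-hand sides differ by lam (P_n - u) + exp(-lam n) F_n. Both terms are
      at most lam e', hence at most e/2.\<close>
    define e' where "e' = min e (e / (2 * lam))"
    have "e' > 0" using \<open>e > 0\<close> lam by (simp add: e'_def)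
    from small[OF this] obtain n where n: "M / lam * exp (- lam * real n) \<le> e'" by blast
    have le: "\<bar>P (real n) x - u x\<bar> \<le> e'" for x using close[of n x] n by linarith
    have "lam * e' \<le> e / 2" using lam \<open>e > 0\<close> by (simp add: e'_def min_def field_simps)
    have "\<bar>g (real n) x - (lam * u x - f x)\<bar> \<le> e" for x
    proof -
      have "g (real n) x - (lam * u x - f x) = lam * (P (real n) x - u x) + exp (- lam * real n) * F (real n) x"
        by (simp add: g_def algebra_simps)
      moreover have "\<bar>lam * (P (real n) x - u x)\<bar> \<le> lam * e'" using le[of x] lam by (simp add: abs_mult)
      moreover have "\<bar>exp (- lam * real n) * F (real n) x\<bar> \<le> exp (- lam * real n) * M"
        using FM[of "real n" x] by (simp add: abs_mult)
      moreover have "exp (- lam * real n) * M \<le> lam * e'" using n lam by (simp add: field_simps)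
      ultimately show ?thesis using \<open>lam * e' \<le> e / 2\<close> by linarith
    qed
    moreover have "e' \<le> e" by (simp add: e'_def)
    ultimately show "\<exists>v g. v \<in> CG G \<and> g \<in> CG G \<and> weak_laplacian G v g \<and> (\<forall>x. \<bar>v x - u x\<bar> \<le> e) \<and> (\<forall>x. \<bar>g x - (lam * u x - f x)\<bar> \<le> e)"
      using le weak PX gX XCG
      by (intro exI[of _ "P (real n)"] exI[of _ "g (real n)"]) (auto intro: order_trans)
  qed
  moreover have "0 \<le> u x" for x
    using Pmono[of 0 "real n" x for n] by (intro LIMSEQ_le_const[OF lim]) (auto simp: P0)
  moreover have "u x \<le> M / lam" for x
    using close[of 0 x] by (simp add: P0)
  ultimately show ?thesis using that uX M_def by blast
qed

section \<open>Obstructions to generation\<close>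

text \<open>Strong minimum principle by connectedness. At \<open>p\<close>, touching by the constant
  0 excludes u = 0. If u vanishes at h but not at a nearby q, then u >= u(q)/2 on a small disc about
  q, and the annulus barrier centred at q carries positivity to h. So the zero set is open, like its
  complement in \<open>G\<close>.\<close>

lemma weak_laplacian_strict_positivity:
  assumes G: "open G" "bounded G" "connected G" and u: "u \<in> CG G" and g: "g \<in> CG G" and lam: "lam > 0"
    and weak: "weak_laplacian G u (\<lambda>x. lam * u x - g x)"
    and nonneg: "\<And>x. u x \<ge> 0" "\<And>x. g x \<ge> 0" and p: "p \<in> G" "g p > 0" and x: "x \<in> G"
  shows "u x > 0"
proof -
  have cu: "continuous_on G u" using u by (rule CG_continuous_interior)
  obtain M where M: "\<And>x. \<bar>u x\<bar> \<le> M" using CG_bounded[OF u G(2)] by blast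
  have up: "u p > 0"
  proof (rule ccontr)
    assume "\<not> u p > 0"
    then have up: "u p = 0" using nonneg(1)[of p] by simp
    obtain r where r: "r > 0" "ball p r \<subseteq> G" using G(1) p(1) open_contains_ball by blast
    have "0 \<le> lam * u p - g p"
    proof (rule weak_laplacian_touching_below[OF G(1,2) cu M _ weak r, of "\<lambda>x. 0" "\<lambda>x. 0"])
      show "continuous_on G (\<lambda>x. lam * u x - g x)"
        using u g by (intro continuous_intros CG_continuous_interior)
      show "has_star_laplacian (\<lambda>x. 0) 0 q" for q
        by (simp add: has_star_laplacian_def star_diff_def[abs_def])
    qed (use up nonneg in auto)
    then show False using up p(2) by simp
  qed
  define A where "A = G \<inter> u -` {0<..}"
  define Z where "Z = {y \<in> G. u y = 0}"
  have A: "open A" unfolding A_def by (rule continuous_open_preimage[OF cu G(1)]) simp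
  have Z: "open Z"
    unfolding open_dist
  proof
    fix h assume "h \<in> Z"
    then have h: "h \<in> G" "u h = 0" by (auto simp: Z_def)
    obtain r where r: "r > 0" "ball h r \<subseteq> G" using G(1) h(1) open_contains_ball by blast
    \<comment> \<open>With dist q h < r/3 the disc of radius r/2 about q stays inside the disc of
      radius r about h (r/3 + r/2 < r) and still contains h in its interior.\<close>
    show "\<exists>e>0. \<forall>q. dist q h < e \<longrightarrow> q \<in> Z"
    proof (intro exI[of _ "r / 3"] conjI allI impI)
      show "r / 3 > 0" using r(1) by simp
      fix q assume q: "dist q h < r / 3"
      have qG: "q \<in> G" using q r by (auto simp: dist_commute subset_iff)
      show "q \<in> Z"
      proof (rule ccontr)
        assume "q \<notin> Z"
        then have uq: "u q > 0" using qG nonneg(1)[of q] by (auto simp: Z_def)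
        then have "q \<noteq> h" using h by auto
        have "open A" "q \<in> A" using A qG uq by (auto simp: A_def)
        have "isCont u q" using cu G(1) qG continuous_on_eq_continuous_at by blast
        then have "\<exists>d>0. \<forall>y. dist y q < d \<longrightarrow> dist (u y) (u q) < u q / 2"
          using uq unfolding continuous_at_eps_delta by (elim allE[of _ "u q / 2"]) auto
        then obtain d where d: "d > 0" "\<And>y. dist y q < d \<Longrightarrow> dist (u y) (u q) < u q / 2" by blast
        define \<rho> where "\<rho> = min (d / 2) (dist h q / 2)"
        have "dist h q > 0" using \<open>q \<noteq> h\<close> by simp
        then have \<rho>: "\<rho> > 0" "\<rho> < d" "\<rho> < dist h q"
          using d(1) unfolding \<rho>_def min_def by (auto simp del: zero_less_dist_iff)
        have lower: "u y \<ge> u q / 2" if "y \<in> cball q \<rho>" for y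
        proof -
          have "dist y q < d" using that \<rho> by (simp add: dist_commute)
          from d(2)[OF this] show ?thesis unfolding dist_real_def by linarith
        qed
        have "cball q (r / 2) \<subseteq> ball h r"
        proof
          fix y assume "y \<in> cball q (r / 2)"
          then show "y \<in> ball h r" using dist_triangle[of h y q] q r(1) by (simp add: dist_commute)
        qed
        then have sub: "cball q (r / 2) \<subseteq> G" using r(2) by blast
        have n: "norm (h - q) < r / 2" using q r(1) by (simp add: dist_norm norm_minus_commute)
        define a where "a = sqrt lam + 1 / \<rho>"
        have a: "a > 0" using lam \<rho>(1) by (simp add: a_def add_pos_pos)
        have "u q / 2 * (exp (- a * norm (h - q)) - exp (- a * (r / 2))) \<le> u h"
          using \<rho> n uq lower
          by (intro annulus_lower_bound[OF G(1,2) u g lam weak sub \<rho>(1) _ _ _ nonneg _ _ a_def])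
            (auto simp: dist_norm)
        moreover have "exp (- a * norm (h - q)) - exp (- a * (r / 2)) > 0" using a n by simp
        ultimately show False using uq h(2) by (simp add: mult_le_0_iff)
      qed
    qed
  qed
  have "A \<inter> Z = {}" "G \<subseteq> A \<union> Z" using nonneg(1) by (auto simp: A_def Z_def less_le)
  moreover have "p \<in> A \<inter> G" using up p by (simp add: A_def)
  ultimately have "Z \<inter> G = {}" using G(3) A Z unfolding connected_def by blast
  then have "u x \<noteq> 0" using x by (auto simp: Z_def)
  then show ?thesis using nonneg(1)[of x] by simp
qed

section \<open>Admissible right-hand sides\<close>

definition tent :: "complex \<Rightarrow> real \<Rightarrow> complex \<Rightarrow> real" where
  "tent p \<rho> x = max 0 (2 - norm (x - p) / \<rho>)"

lemma tent_bounds: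
  assumes "\<rho> > 0"
  shows "tent p \<rho> x \<ge> 0" "tent p \<rho> x \<le> 2" "x \<in> ball p \<rho> \<Longrightarrow> tent p \<rho> x \<ge> 1"
    "x \<notin> cball p (2 * \<rho>) \<Longrightarrow> tent p \<rho> x = 0"
  using assms by (auto simp: tent_def dist_norm norm_minus_commute max_def field_simps)

text \<open>The support avoids all \<open>y\<close> outside \<open>G\<close> and all
  \<open>z\<close> in \<open>L\<close>, so every condition of \<open>S\<close> reads 0 = 0.\<close>

lemma tent_in_nonlocal_space:
  assumes "\<rho> > 0" "cball p (2 * \<rho>) \<subseteq> G - L"
    and S: "\<And>y z c. (y, z, c) \<in> S \<Longrightarrow> y \<notin> G \<and> (c = 0 \<or> z \<in> L)"
  shows "tent p \<rho> \<in> nonlocal_space G S"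
proof -
  have 0: "tent p \<rho> x = 0" if "x \<notin> G - L" for x using tent_bounds(4)[OF assms(1)] that assms(2) by blast
  have "continuous_on (closure G) (tent p \<rho>)"
    unfolding tent_def[abs_def] using assms(1) by (intro continuous_intros) auto
  then have "tent p \<rho> \<in> CG G" using 0 closure_subset[of G] by (auto simp: CG_def)
  then show ?thesis using S 0 by (force simp: nonlocal_space_def)
qed

lemma avoid_line:
  assumes "open B" "B \<noteq> {}" "d \<noteq> 0"
  shows "B \<inter> {x. Im (cnj d * (x - a)) \<noteq> 0} \<noteq> {}"
proof -
  obtain x where x: "x \<in> B" using assms(2) by blast
  then obtain e where e: "e > 0" "ball x e \<subseteq> B" using assms(1) open_contains_ball by blast
  show ?thesis
  proof (cases "Im (cnj d * (x - a)) = 0")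
    case True
    \<comment> \<open>A displacement of length e/2 along \<open>\<i> * d\<close>, the normal of the
      line, changes the imaginary part by t |d|^2.\<close>
    define t where "t = e / (2 * norm d)"
    have t: "t > 0" using e assms(3) by (simp add: t_def)
    define y where "y = x + of_real t * (\<i> * d)"
    have "norm (y - x) = t * norm d" using t by (simp add: y_def norm_mult)
    also have "\<dots> = e / 2" using assms(3) by (simp add: t_def)
    finally have "norm (y - x) = e / 2" .
    then have "y \<in> ball x e" using e(1) by (simp add: dist_norm norm_minus_commute)
    moreover have "cnj d * (y - a) = cnj d * (x - a) + of_real (t * (norm d)\<^sup>2) * \<i>"
      by (simp add: y_def algebra_simps complex_norm_square[symmetric] flip: complex_norm_square)
    then have "Im (cnj d * (y - a)) = t * (norm d)\<^sup>2" using True by simp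
    then have "Im (cnj d * (y - a)) \<noteq> 0" using t assms(3) by simp
    ultimately show ?thesis using e(2) by blast
  qed (use x in blast)
qed

lemma open_complement_line: "open {x. Im (cnj d * (x - a)) \<noteq> 0}"
  by (intro open_Collect_neq continuous_intros)

text \<open>\<open>L\<close> contains every point whose value enters a condition with nonzero
  coefficient. As it is closed without interior points, each nonempty open part of \<open>G\<close>
  has room for a tent that lies in the space.\<close>

locale nonlocal_problem =
  fixes G :: "complex set" and S :: "(complex \<times> complex \<times> real) set" and L :: "complex set"
  assumes G: "open G" "bounded G" "connected G" "G \<noteq> {}"
    and S: "\<And>y z c. (y, z, c) \<in> S \<Longrightarrow> y \<notin> G \<and> (c = 0 \<or> z \<in> L)"
    and L: "\<And>B. open B \<Longrightarrow> B \<noteq> {} \<Longrightarrow> B - L \<noteq> {}" "closed L"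
begin

abbreviation "X \<equiv> nonlocal_space G S"

lemma tent_exists:
  assumes "open B" "B \<noteq> {}" "B \<subseteq> G"
  obtains p \<rho> where "\<rho> > 0" "cball p (2 * \<rho>) \<subseteq> B" "tent p \<rho> \<in> X" "p \<in> G"
proof -
  have "open (B - L)" "B - L \<noteq> {}" using assms L by auto
  then obtain p r where r: "r > 0" "cball p r \<subseteq> B - L" by (meson ex_in_conv open_contains_cball)
  then have "cball p (2 * (r / 2)) \<subseteq> G - L" using assms(3) by auto
  from tent_in_nonlocal_space[OF _ this S] r have "tent p (r / 2) \<in> X" by simp
  moreover have "p \<in> cball p r" using r(1) by simp
  then have "cball p r \<subseteq> B" "p \<in> G" using r(2) assms(3) by blast+
  ultimately show ?thesis using that[of "r / 2" p] r(1) by simp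
qed

lemma resolvent:
  assumes "feller_generator G X (graph_closure G X (lap_graph G X))" "f \<in> X" "\<And>x. f x \<ge> 0" "lam > 0"
  obtains u where "u \<in> X" "weak_laplacian G u (\<lambda>x. lam * u x - f x)"
    "\<And>x. 0 \<le> u x" "\<And>x. u x \<le> supn G f / lam"
  using assms feller_resolvent[OF G(1,2,4)] unfolding feller_generator_def by metis

lemma positive_resolvent:
  assumes "feller_generator G X (graph_closure G X (lap_graph G X))"
  obtains f u where "f \<in> CG G" "\<And>x. f x \<ge> 0" "u \<in> X" "weak_laplacian G u (\<lambda>x. 1 * u x - f x)"
    "\<And>x. 0 \<le> u x" "\<And>x. x \<in> G \<Longrightarrow> 0 < u x"
proof -
  obtain p \<rho> where p: "\<rho> > 0" "tent p \<rho> \<in> X" "p \<in> G" using tent_exists[OF G(1,4)] by blast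
  note t = tent_bounds[OF p(1), where p = p]
  obtain u where u: "u \<in> X" "weak_laplacian G u (\<lambda>x. 1 * u x - tent p \<rho> x)" "\<And>x. 0 \<le> u x"
    using resolvent[OF assms p(2) t(1), of 1] by (metis zero_less_one)
  have "tent p \<rho> p \<ge> 1" using t(3)[of p] p(1) by simp
  then have "u x > 0" if "x \<in> G" for x
    using weak_laplacian_strict_positivity[OF G(1-3) _ _ _ u(2,3) t(1) p(3) _ that]
      u(1) p(2) nonlocal_space_subset by force
  then show ?thesis using that u p(2) t(1) nonlocal_space_subset by blast
qed

lemma not_generator_zero:
  assumes "h \<in> G" "\<And>u. u \<in> X \<Longrightarrow> u h = 0"
  shows "\<not> feller_generator G X (graph_closure G X (lap_graph G X))"
proof
  assume "feller_generator G X (graph_closure G X (lap_graph G X))"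
  from positive_resolvent[OF this] obtain u where "u \<in> X" "0 < u h" using assms(1) by metis
  then show False using assms(2) by force
qed

text \<open>For large \<open>\<lambda> = \<mu>\<^sup>2\<close> the resolvent of a function supported at distance \<open>d\<close> from \<open>h\<^sub>1\<close> and \<open>\<ge> 8 d\<close>
  from \<open>h\<^sub>2\<close> is of order \<open>e\<^sup>-\<^sup>\<mu>\<^sup>d\<close> at \<open>h\<^sub>1\<close> but at most of order \<open>e\<^sup>-\<^sup>2\<^sup>\<mu>\<^sup>d\<close> at \<open>h\<^sub>2\<close>, irrespective of the
  boundary conditions.\<close>

lemma not_generator_identified:
  assumes h: "h1 \<in> G" "h2 \<in> G" "h1 \<noteq> h2" "\<And>u. u \<in> X \<Longrightarrow> u h1 = u h2"
  shows "\<not> feller_generator G X (graph_closure G X (lap_graph G X))"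
proof
  assume gen: "feller_generator G X (graph_closure G X (lap_graph G X))"
  obtain r1 where r1: "r1 > 0" "cball h1 r1 \<subseteq> G" using G(1) h(1) open_contains_cball by blast
  obtain r2 where r2: "r2 > 0" "cball h2 r2 \<subseteq> G" using G(1) h(2) open_contains_cball by blast
  define r where "r = min (dist h1 h2 / 2) (min r1 r2)"
  have r: "r > 0" "r \<le> r1" "r \<le> r2" "2 * r \<le> dist h1 h2" using r1 r2 h(3) by (auto simp: r_def)
  have cb: "cball h1 r \<subseteq> G" "cball h2 r \<subseteq> G"
    using r r1(2) r2(2) by (meson order_trans subset_cball)+
  \<comment> \<open>The radius gives 8d < r for d = |h1 - p|. The puncture keeps \<open>h1\<close>
    outside the support of the tent, hence d > 2\<rho> > 0, and the annulus barrier around the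
    support reaches \<open>h1\<close>.\<close>
  define B where "B = ball h1 (r / 8) - {h1}"
  have "ball h1 (r / 8) \<subseteq> cball h1 r" using r(1) by auto
  then have B: "open B" "B \<subseteq> G" using cb(1) by (auto simp: B_def)
  have "h1 + of_real (r / 16) \<in> B" using r(1) by (simp add: B_def dist_norm)
  then have "B \<noteq> {}" by blast
  from tent_exists[OF B(1) this B(2)] obtain p \<rho> where p: "\<rho> > 0" "cball p (2 * \<rho>) \<subseteq> B" "tent p \<rho> \<in> X" "p \<in> G" .
  define d where "d = norm (h1 - p)"
  have "p \<in> B" using p by auto
  then have d: "d > 0" "8 * d < r" by (auto simp: B_def d_def dist_norm)
  have "h1 \<notin> cball p (2 * \<rho>)" using p(2) by (auto simp: B_def)
  then have \<rho>d: "2 * \<rho> < d" by (simp add: d_def dist_norm norm_minus_commute)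
  have sub: "cball p (2 * d) \<subseteq> G"
  proof
    fix x assume "x \<in> cball p (2 * d)"
    then have "dist p x \<le> 2 * d" "dist h1 p = d" by (auto simp: d_def dist_norm)
    then have "x \<in> cball h1 r" unfolding mem_cball
      using dist_triangle[of h1 x p] d by linarith
    then show "x \<in> G" using cb by blast
  qed
  \<comment> \<open>The first summand gives \<mu> \<rho> >= 2. The second adds 4 to \<mu> d, so that
    with the decay rate a = \<mu> + 2/\<rho> of the lower barrier 2 \<mu> d = a d + 4 exactly; it
    also gives \<mu> >= 2/r.\<close>
  define \<mu> where "\<mu> = 2 / \<rho> + 4 / d"
  have \<mu>: "\<mu> > 0" "\<mu> \<ge> 2 / \<rho>" using p(1) d(1) by (auto simp: \<mu>_def add_pos_pos)
  have \<mu>d: "\<mu> * d = 2 * d / \<rho> + 4" using p(1) d(1) by (simp add: \<mu>_def field_simps)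
  have "2 / r \<le> 4 / d" using d r by (simp add: field_simps)
  then have \<mu>r: "\<mu> \<ge> 2 / r" using p(1) by (simp add: \<mu>_def add_increasing)
  note t = tent_bounds[OF p(1), where p = p]
  obtain u where u: "u \<in> X" "weak_laplacian G u (\<lambda>x. \<mu>\<^sup>2 * u x - tent p \<rho> x)" "\<And>x. 0 \<le> u x"
     "\<And>x. u x \<le> supn G (tent p \<rho>) / \<mu>\<^sup>2"
    using resolvent[OF gen p(3) t(1), of "\<mu>\<^sup>2"] \<mu>(1) by (metis zero_less_power)
  have CG: "u \<in> CG G" "tent p \<rho> \<in> CG G" using u(1) p(3) nonlocal_space_subset by blast+
  have "supn G (tent p \<rho>) \<le> 2" using t(1,2) by (intro supn_le[OF G(4)]) simp
  then have u2: "u x \<le> 2 / \<mu>\<^sup>2" for x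
    using u(4)[of x] divide_right_mono[of "supn G (tent p \<rho>)" 2 "\<mu>\<^sup>2"] by simp
  have "tent p \<rho> x = 0" if "x \<in> ball h2 r" for x
  proof (rule t(4))
    show "x \<notin> cball p (2 * \<rho>)"
    proof
    assume "x \<in> cball p (2 * \<rho>)"
    then have "dist h1 x < r" using p(2) r(1) by (auto simp: B_def)
    then show False using that dist_triangle[of h1 h2 x] r(4) by (simp add: dist_commute)
    qed
  qed
  then have "u h2 \<le> 2 / \<mu>\<^sup>2 * exp (- \<mu> * r / 4)"
    using u2 \<mu>r cb(2) r(1) by (intro ball_upper_bound[OF G(1,2) CG u(2)]) auto
  also have "\<dots> \<le> 2 / \<mu>\<^sup>2 * exp (- (2 * \<mu> * d))"
  proof -
    have "\<mu> * (8 * d) \<le> \<mu> * r" using \<mu>(1) d(2) by (intro mult_left_mono) auto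
    then show ?thesis using \<mu>(1) by (intro mult_left_mono) auto
  qed
  finally have upper: "u h2 \<le> 2 / \<mu>\<^sup>2 * exp (- (2 * \<mu> * d))" .
  \<comment> \<open>On the half disc the paraboloid bound is at least (3/4) \<rho>^2 / (\<mu>^2
    \<rho>^2 + 4), and 4 <= \<mu>^2 \<rho>^2 makes this at least 3/(8 \<mu>^2).\<close>
  define c where "c = 3 / (8 * \<mu>\<^sup>2)"
  have c: "c > 0" using \<mu>(1) by (simp add: c_def)
  have \<mu>2: "\<mu>\<^sup>2 > 0" using \<mu>(1) by simp
  have sub\<rho>: "cball p \<rho> \<subseteq> G" using p(1,2) B(2) by (auto simp: subset_iff)
  have lower: "u x \<ge> c" if x: "x \<in> cball p (\<rho> / 2)" for x
  proof -
    have "\<rho> * \<mu> \<ge> 2" using \<mu>(2) p(1) by (simp add: field_simps)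
    then have "(\<rho> * \<mu>)\<^sup>2 \<ge> 2\<^sup>2" by (intro power_mono) auto
    then have \<rho>\<mu>: "\<mu>\<^sup>2 * \<rho>\<^sup>2 \<ge> 4" by (simp add: power_mult_distrib mult.commute)
    have "(norm (x - p))\<^sup>2 \<le> (\<rho> / 2)\<^sup>2"
      using x by (intro power_mono) (auto simp: dist_norm norm_minus_commute)
    then have nx: "\<rho>\<^sup>2 - (norm (x - p))\<^sup>2 \<ge> 3 / 4 * \<rho>\<^sup>2" by (simp add: power_divide)
    have "c = (3 / 4 * \<rho>\<^sup>2) / (\<mu>\<^sup>2 * \<rho>\<^sup>2 + \<mu>\<^sup>2 * \<rho>\<^sup>2)" using p(1) \<mu>(1) by (simp add: c_def)
    also have "\<dots> \<le> (\<rho>\<^sup>2 - (norm (x - p))\<^sup>2) / (\<mu>\<^sup>2 * \<rho>\<^sup>2 + 4)"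
    proof (rule frac_le)
      show "0 \<le> \<rho>\<^sup>2 - (norm (x - p))\<^sup>2" using nx zero_le_power2[of \<rho>] by linarith
      show "0 < \<mu>\<^sup>2 * \<rho>\<^sup>2 + 4" by (intro add_nonneg_pos) auto
    qed (use nx \<rho>\<mu> in auto)
    also have "\<dots> \<le> u x"
      using x p(1) t u(3) by (intro ball_lower_bound[OF G(1,2) CG \<mu>2 u(2) sub\<rho>]) auto
    finally show ?thesis .
  qed
  \<comment> \<open>The rate sqrt lam + 1/(inner radius) of the annulus barrier, for lam = \<mu>^2
    and inner radius \<rho>/2.\<close>
  define a where "a = \<mu> + 2 / \<rho>"
  have "a * d = \<mu> * d + 2 * d / \<rho>" by (simp add: a_def algebra_simps)
  moreover have "2 * d / \<rho> \<ge> 0" using p(1) d(1) by simp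
  ultimately have ad: "a * d \<ge> 4" "- (2 * \<mu> * d) = - a * d + (- 4)"
    using \<mu>d by simp_all
  have "exp (- (4::real)) \<le> 1 / 16"
  proof -
    have "(2::real) ^ 4 \<le> exp 1 ^ 4" using exp_ge_add_one_self[of 1] by (intro power_mono) auto
    then have "(16::real) \<le> exp 4" by (simp add: exp_of_nat_mult[symmetric])
    then show ?thesis by (simp add: exp_minus field_simps)
  qed
  note e4 = this
  have "c * (exp (- a * d) - exp (- a * (2 * d))) \<le> u h1"
    unfolding d_def
    using \<rho>d p(1) c lower u(3) t(1) d(1) \<mu>(1) unfolding d_def
    by (intro annulus_lower_bound[OF G(1,2) CG \<mu>2 u(2) sub[unfolded d_def], of "\<rho> / 2"]) (auto simp: a_def)
  moreover have "exp (- a * (2 * d)) \<le> exp (- a * d) * (1 / 16)"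
  proof -
    have "exp (- a * (2 * d)) = exp (- a * d) * exp (- a * d)" by (simp add: mult_exp_exp)
    moreover have "exp (- a * d) \<le> exp (- 4)" using ad(1) by simp
    then have "exp (- a * d) \<le> 1 / 16" using e4 by linarith
    then have "exp (- a * d) * exp (- a * d) \<le> exp (- a * d) * (1 / 16)" by (intro mult_left_mono) auto
    ultimately show ?thesis by simp
  qed
  then have "c * (exp (- a * d) * (15 / 16)) \<le> c * (exp (- a * d) - exp (- a * (2 * d)))"
    using c by (intro mult_left_mono) auto
  ultimately have "c * (exp (- a * d) * (15 / 16)) \<le> u h1" by linarith
  moreover have "u h2 \<le> 2 / \<mu>\<^sup>2 * (exp (- a * d) * (1 / 16))"
  proof -
    have "exp (- (2 * \<mu> * d)) \<le> exp (- a * d) * (1 / 16)"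
      unfolding ad(2) exp_add using e4 by simp
    then have "2 / \<mu>\<^sup>2 * exp (- (2 * \<mu> * d)) \<le> 2 / \<mu>\<^sup>2 * (exp (- a * d) * (1 / 16))" by (intro mult_left_mono) auto
    then show ?thesis using upper by linarith
  qed
  \<comment> \<open>Up to the common factor exp(-a d)/\<mu>^2 this is 1/8 = 16/128 against
    (3/8)(15/16) = 45/128.\<close>
  moreover have "2 / \<mu>\<^sup>2 * (exp (- a * d) * (1 / 16)) < c * (exp (- a * d) * (15 / 16))"
    using \<mu>(1) by (simp add: c_def field_simps)
  ultimately show False using h(4)[OF u(1)] by linarith
qed

text \<open>Along the rotation-invariant boundary values a radial comparison function sees no boundary, so near \<open>g\<close>
  the solution behaves like a positive superharmonic function on a punctured disc; the logarithm
  shows that the puncture is removable for the lower bound.\<close>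

lemma not_generator_rotation:
  assumes g: "g \<in> closure G" "g \<notin> G" "\<And>u. u \<in> X \<Longrightarrow> u g = 0" and d0: "d0 > 0"
    and refl: "\<And>y. y \<in> frontier G \<Longrightarrow> 0 < norm (y - g) \<Longrightarrow> norm (y - g) < d0 \<Longrightarrow>
      \<exists>x\<in>G. norm (x - g) = norm (y - g) \<and> (\<forall>u\<in>X. u y = u x)"
  shows "\<not> feller_generator G X (graph_closure G X (lap_graph G X))"
proof
  assume gen: "feller_generator G X (graph_closure G X (lap_graph G X))"
  obtain f u where f: "f \<in> CG G" "\<And>x. f x \<ge> 0" and u: "u \<in> X" "weak_laplacian G u (\<lambda>x. 1 * u x - f x)"
    "\<And>x. 0 \<le> u x" "\<And>x. x \<in> G \<Longrightarrow> 0 < u x"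
    using positive_resolvent[OF gen] by metis
  have uCG: "u \<in> CG G" using u(1) nonlocal_space_subset by blast
  \<comment> \<open>For r <= \<rho> <= 1 the polynomial part m (1 + r^2)/4 has Laplacian m and is at
    most m/2, so it is a subsolution for lam = 1. The logarithmic part is harmonic and nonpositive
    there.\<close>
  define \<rho> where "\<rho> = min (d0 / 2) 1"
  have \<rho>: "\<rho> > 0" "\<rho> < d0" "\<rho> \<le> 1" using d0 by (auto simp: \<rho>_def)
  have fr: "closure G = G \<union> frontier G" using closure_Un_frontier[of G] by simp
  \<comment> \<open>Positivity reaches boundary points near \<open>g\<close>, other than
    \<open>g\<close> itself, because their values are attained inside \<open>G\<close>. Hence the
    minimum over the arc \<open>C\<close> is positive.\<close>
  have pos: "u x > 0" if "x \<in> closure G" "0 < norm (x - g)" "norm (x - g) < d0" for x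
    using refl[of x] u(1,4) that fr by force
  define C where "C = closure G \<inter> sphere g \<rho>"
  obtain m where m: "m > 0" "\<And>x. x \<in> C \<Longrightarrow> m \<le> u x"
  proof (cases "C = {}")
    case True
    then show ?thesis using that[of 1] by simp
  next
    case False
    have "compact C" unfolding C_def using G(2) by (intro closed_Int_compact) auto
    moreover have "continuous_on C u" using CG_continuous[OF uCG] by (auto simp: C_def intro: continuous_on_subset)
    ultimately obtain x where x: "x \<in> C" "\<forall>y\<in>C. u x \<le> u y" using continuous_attains_inf False by blast
    have "u x > 0" using x(1) \<rho> by (intro pos) (auto simp: C_def dist_norm norm_minus_commute)
    then show ?thesis using that[of "u x"] x by blast
  qed
  have key: "m * (1 + (norm (x - g))\<^sup>2) / 4 + \<eta> / 2 * ln ((norm (x - g))\<^sup>2 / \<rho>\<^sup>2) \<le> u x"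
    if x: "x \<in> closure G" "0 < norm (x - g)" "norm (x - g) \<le> \<rho>" and \<eta>: "\<eta> > 0" for x \<eta>
  proof -
    let ?\<phi> = "\<lambda>t. m * (1 + t) / 4 + \<eta> / 2 * ln (t / \<rho>\<^sup>2)"
    \<comment> \<open>At radius \<delta> the logarithmic term \<eta> ln(r/\<rho>) equals -m and
      outweighs the polynomial part, so the barrier is nonpositive on the inner circle, where only u
      >= 0 is known.\<close>
    define \<delta> where "\<delta> = \<rho> * exp (- m / \<eta>)"
    have \<delta>: "\<delta> > 0" "\<delta> < \<rho>" using \<rho>(1) m(1) \<eta> by (auto simp: \<delta>_def)
    have inner: "?\<phi> ((norm (y - g))\<^sup>2) \<le> 0" if "0 < norm (y - g)" "norm (y - g) \<le> \<delta>" for y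
    proof -
      have "norm (y - g) / \<rho> \<le> exp (- m / \<eta>)" using that \<rho>(1) by (simp add: \<delta>_def field_simps)
      then have "ln (norm (y - g) / \<rho>) \<le> - m / \<eta>" using that \<rho>(1) by (metis divide_pos_pos ln_exp ln_le_cancel_iff exp_gt_zero)
      moreover have "ln ((norm (y - g))\<^sup>2 / \<rho>\<^sup>2) = 2 * ln (norm (y - g) / \<rho>)"
        using that \<rho>(1) by (simp add: power_divide[symmetric] ln_realpow)
      ultimately have "\<eta> / 2 * ln ((norm (y - g))\<^sup>2 / \<rho>\<^sup>2) \<le> - m" using \<eta> by (simp add: field_simps)
      moreover have "(norm (y - g))\<^sup>2 \<le> 1\<^sup>2" using that \<delta> \<rho>(3) by (intro power_mono) auto
      then have "m * (1 + (norm (y - g))\<^sup>2) / 4 \<le> m / 2" using m(1) by (simp add: field_simps)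
      ultimately show ?thesis using m(1) by linarith
    qed
    show ?thesis
    proof (cases "norm (x - g) < \<delta>")
      case True
      then show ?thesis using inner[of x] x(2) u(3)[of x] by simp
    next
      case False
      define K where "K = closure G \<inter> (cball g \<rho> - ball g \<delta>)"
      define D where "D = G \<inter> (ball g \<rho> - cball g \<delta>)"
      show ?thesis
      proof (rule weak_laplacian_radial_comparison[OF G(1,2) uCG f(1) zero_less_one u(2), where K = K and D = D and I = "{0<..}"
           and \<phi> = ?\<phi> and \<phi>' = "\<lambda>t. m / 4 + \<eta> / (2 * t)" and \<phi>'' = "\<lambda>t. - \<eta> / (2 * t\<^sup>2)"])
        show "open {0::real<..}" by simp
        show "compact K" unfolding K_def by (intro closed_Int_compact compact_diff) auto
        show "K \<subseteq> closure G" by (simp add: K_def)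
        show "open D" unfolding D_def using G(1) by (intro open_Int open_Diff) auto
        show "D \<subseteq> K" "D \<subseteq> G" using closure_subset[of G] by (auto simp: D_def K_def)
        show "(norm (q - g))\<^sup>2 \<in> {0<..}" if "q \<in> D" for q
          using that \<delta> by (auto simp: D_def dist_norm norm_minus_commute)
        have nz: "norm (q - g) \<noteq> 0" if "q \<in> K" for q
          using that \<delta> by (auto simp: K_def dist_norm norm_minus_commute)
        show "continuous_on K (\<lambda>x. ?\<phi> ((norm (x - g))\<^sup>2))"
          using nz \<rho>(1) by (intro continuous_intros) auto
        show "(?\<phi> has_real_derivative m / 4 + \<eta> / (2 * t)) (at t)" if "t \<in> {0<..}" for t
          using that \<rho>(1) by (auto intro!: derivative_eq_intros simp: field_simps)
        show "((\<lambda>t. m / 4 + \<eta> / (2 * t)) has_real_derivative - \<eta> / (2 * t\<^sup>2)) (at t)" if "t \<in> {0<..}" for t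
          using that by (auto intro!: derivative_eq_intros simp: field_simps power2_eq_square)
        show "continuous_on {0<..} (\<lambda>t. - \<eta> / (2 * t\<^sup>2))" by (intro continuous_intros) auto
        show "1 * ?\<phi> t - f q \<le> 4 * (m / 4 + \<eta> / (2 * t)) + 4 * t * (- \<eta> / (2 * t\<^sup>2))"
          if q: "q \<in> D" "t = (norm (q - g))\<^sup>2" for q t
        proof -
          have "norm (q - g) < \<rho>" "norm (q - g) > 0" using q \<delta> by (auto simp: D_def dist_norm norm_minus_commute)
          then have t: "t > 0" "t \<le> \<rho>\<^sup>2" unfolding q(2) by (auto intro!: power_mono)
          moreover have "\<rho>\<^sup>2 \<le> 1\<^sup>2" using \<rho> by (intro power_mono) auto
          ultimately have t: "t > 0" "t \<le> \<rho>\<^sup>2" "t \<le> 1" by auto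
          have eq: "4 * (m / 4 + \<eta> / (2 * t)) + 4 * t * (- \<eta> / (2 * t\<^sup>2)) = m"
            using t(1) by (simp add: field_simps power2_eq_square)
          have le: "\<eta> / 2 * ln (t / \<rho>\<^sup>2) \<le> 0"
            using t \<eta> \<rho>(1) by (intro mult_nonneg_nonpos) (auto simp: ln_le_zero_iff divide_le_eq)
          have "m * (1 + t) / 4 \<le> m" using m(1) t(3) by (simp add: field_simps)
          then have "1 * ?\<phi> t - f q \<le> m" using le f(2)[of q] by simp
          then show ?thesis unfolding eq .
        qed
        show "x \<in> K" using x False by (simp add: K_def dist_norm norm_minus_commute)
        fix y assume y: "y \<in> K - D"
        then have yn: "\<delta> \<le> norm (y - g)" "norm (y - g) \<le> \<rho>" "y \<in> closure G"
          by (auto simp: K_def dist_norm norm_minus_commute)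
        consider "norm (y - g) = \<rho>" | "norm (y - g) = \<delta>" | "y \<in> frontier G" "\<delta> < norm (y - g)" "norm (y - g) < \<rho>"
          using y yn fr by (force simp: D_def dist_norm norm_minus_commute)
        then show "?\<phi> ((norm (y - g))\<^sup>2) \<le> u y \<or> (\<exists>x'\<in>D. u x' \<le> u y \<and> norm (x' - g) = norm (y - g))"
        proof cases
          case 1
          then have "m \<le> u y" using m(2)[of y] yn(3) by (simp add: C_def dist_norm norm_minus_commute)
          moreover have "\<rho>\<^sup>2 \<le> 1\<^sup>2" using \<rho> by (intro power_mono) auto
          then have "m * (1 + \<rho>\<^sup>2) / 4 \<le> m" using m(1) by (simp add: field_simps)
          moreover have "\<rho>\<^sup>2 / \<rho>\<^sup>2 = 1" using \<rho>(1) by simp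
          ultimately show ?thesis using 1 by simp
        next
          case 2
          then show ?thesis using inner[of y] \<delta>(1) u(3)[of y] by simp
        next
          case 3
          then have "0 < norm (y - g)" "norm (y - g) < d0" using \<delta> \<rho> by auto
          from refl[OF 3(1) this] obtain x' where x': "x' \<in> G" "norm (x' - g) = norm (y - g)" "u y = u x'" using u(1) by blast
          then have "x' \<in> D" using 3 by (simp add: D_def dist_norm norm_minus_commute)
          then show ?thesis using x' by auto
        qed
      qed
    qed
  qed
  have lower: "m / 4 \<le> u x" if x: "x \<in> closure G" "0 < norm (x - g)" "norm (x - g) \<le> \<rho>" for x
  proof -
    let ?c = "m * (1 + (norm (x - g))\<^sup>2) / 4" and ?l = "ln ((norm (x - g))\<^sup>2 / \<rho>\<^sup>2)"
    have "((\<lambda>\<eta>. ?c + \<eta> / 2 * ?l) \<longlongrightarrow> ?c + 0 / 2 * ?l) (at_right 0)" by (intro tendsto_intros) auto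
    moreover have "\<forall>\<^sub>F \<eta> in at_right 0. ?c + \<eta> / 2 * ?l \<le> u x"
      using key[OF x] by (auto intro: eventually_mono[OF eventually_at_right_less])
    ultimately have "?c + 0 / 2 * ?l \<le> u x" by (rule tendsto_upperbound) simp
    moreover have "m / 4 \<le> ?c" using m(1) by (simp add: field_simps)
    ultimately show ?thesis by simp
  qed
  obtain s where s: "\<And>n. s n \<in> G" "s \<longlonglongrightarrow> g" using g(1) unfolding closure_sequential by blast
  have "(\<lambda>n. u (s n)) \<longlonglongrightarrow> u g"
    using continuous_on_tendsto_compose[OF CG_continuous[OF uCG] s(2) g(1)] s(1) closure_subset by (auto intro: always_eventually)
  moreover have "\<forall>\<^sub>F n in sequentially. m / 4 \<le> u (s n)"
  proof -
    have "\<forall>\<^sub>F n in sequentially. dist (s n) g < \<rho>" using s(2) \<rho>(1) by (rule tendstoD)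
    then show ?thesis
    proof eventually_elim
      case (elim n)
      have "s n \<noteq> g" using s(1)[of n] g(2) by auto
      then show ?case using elim s(1)[of n] closure_subset by (intro lower) (auto simp: dist_norm)
    qed
  qed
  ultimately have "m / 4 \<le> u g" by (rule tendsto_lowerbound) simp
  then show False using g(3)[OF u(1)] m(1) by simp
qed

end

section \<open>Geometry of the nonlocal data\<close>

text \<open>A frontier point is not in the open set \<open>G\<close>, and the opposite open half
  disc does not meet \<open>G\<close>, which leaves only the line.\<close>

lemma half_plane_near_frontier:
  assumes "open G" "G \<inter> ball g \<epsilon> = {y \<in> ball g \<epsilon>. Im (cnj d * (y - g)) > 0}" "y \<in> frontier G" "y \<in> ball g \<epsilon>"
  shows "Im (cnj d * (y - g)) = 0"
proof (rule ccontr)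
  assume "Im (cnj d * (y - g)) \<noteq> 0"
  moreover have "y \<notin> G" using assms(1,3) frontier_disjoint_eq by blast
  then have "\<not> Im (cnj d * (y - g)) > 0" using assms(2,4) by blast
  ultimately have neg: "Im (cnj d * (y - g)) < 0" by linarith
  define V where "V = ball g \<epsilon> \<inter> {y. Im (cnj d * (y - g)) < 0}"
  have "open V" unfolding V_def by (intro open_Int open_ball open_Collect_less continuous_intros)
  moreover have "y \<in> V" using neg assms(4) by (simp add: V_def)
  moreover have "y \<in> closure G" using assms(3) by (simp add: frontier_def)
  ultimately have "V \<inter> G \<noteq> {}" using open_Int_closure_eq_empty by blast
  then obtain x where "x \<in> V" "x \<in> G" by blast
  then have "x \<in> G \<inter> ball g \<epsilon>" "Im (cnj d * (x - g)) < 0" by (auto simp: V_def)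
  then show False unfolding assms(2) by simp
qed

text \<open>Wherever \<open>b\<close> does not vanish, \<open>\<Omega>\<close> is a rigid motion of a segment of \<open>\<partial>G\<close>; so right-hand sides
  supported off one line per curve satisfy the nonlocal conditions trivially.\<close>

lemma nonlocal_image_in_line:
  assumes G: "open G" and half: "half_plane_near G g \<epsilon>" and data: "nonlocal_data G \<Gamma> g \<epsilon> b \<Omega> U"
    and sub: "closure \<Gamma> \<subseteq> frontier G" and rot: "\<exists>\<theta> w. \<forall>y\<in>U \<inter> ball g \<epsilon>. \<Omega> y = rot g \<theta> y + w"
  shows "\<exists>e a. e \<noteq> 0 \<and> (\<forall>y\<in>closure \<Gamma>. b y = 0 \<or> Im (cnj e * (\<Omega> y - a)) = 0)"
proof -
  obtain d where d: "d \<noteq> 0" "G \<inter> ball g \<epsilon> = {y\<in>ball g \<epsilon>. Im (cnj d * (y - g)) > 0}"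
    using half unfolding half_plane_near_def by blast
  obtain \<theta> w where w: "\<And>y. y \<in> U \<inter> ball g \<epsilon> \<Longrightarrow> \<Omega> y = rot g \<theta> y + w" using rot by blast
  \<comment> \<open>The image line passes through g + w in the rotated direction; multiplying by the
    conjugate of \<open>cis \<theta>\<close> undoes the rotation.\<close>
  have "b y = 0 \<or> Im (cnj (d * cis \<theta>) * (\<Omega> y - (g + w))) = 0" if y: "y \<in> closure \<Gamma>" for y
  proof (cases "y \<in> ball g \<epsilon>")
    case True
    have "y \<in> U" using data y unfolding nonlocal_data_def by blast
    then have "\<Omega> y - (g + w) = cis \<theta> * (y - g)" using w True by (simp add: rot_def)
    moreover have "cnj (cis \<theta>) * cis \<theta> = 1" by (simp add: cis_cnj cis_mult)
    ultimately have "cnj (d * cis \<theta>) * (\<Omega> y - (g + w)) = cnj d * (y - g)"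
      by (simp add: mult.assoc)
    moreover have "Im (cnj d * (y - g)) = 0" using half_plane_near_frontier[OF G d(2) _ True] y sub by blast
    ultimately have "Im (cnj (d * cis \<theta>) * (\<Omega> y - (g + w))) = 0" by (simp only:)
    then show ?thesis ..
  next
    case False
    then show ?thesis using data y unfolding nonlocal_data_def by blast
  qed
  moreover have "d * cis \<theta> \<noteq> 0" using d by simp
  ultimately show ?thesis by blast
qed

text \<open>The condition is assumed on the curve without its endpoints. It passes to
  \<open>g\<close> because \<open>b\<close> is constant near \<open>g\<close> and \<Omega> g lies in
  \<open>G\<close>, where \<open>u\<close> is continuous.\<close>

lemma nonlocal_condition_limit:
  assumes G: "open G" and u: "u \<in> CG G" and data: "nonlocal_data G \<Gamma> g \<epsilon> b \<Omega> U" and g: "g \<in> closure \<Gamma>" and eps: "\<epsilon> > 0"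
    and sub: "closure \<Gamma> \<subseteq> closure G" and \<Omega>: "\<Omega> g \<in> G"
    and b: "\<forall>y\<in>closure \<Gamma>. y \<in> ball g (\<epsilon> / 2) \<longrightarrow> b y = c"
    and cond: "\<And>y. y \<in> \<Gamma> \<Longrightarrow> u y = b y * u (\<Omega> y)"
  shows "u g = c * u (\<Omega> g)"
proof -
  obtain s where s: "\<And>n. s n \<in> \<Gamma>" "s \<longlonglongrightarrow> g" using g unfolding closure_sequential by blast
  have "smooth_on \<Omega> U" "open U" "closure \<Gamma> \<subseteq> U"
    using data by (simp_all add: nonlocal_data_def smooth_nondeg_on_def)
  then have "continuous_on U \<Omega>" unfolding smooth_on_def by (metis higher_diff_on.simps(1))
  then have "isCont \<Omega> g" using \<open>open U\<close> \<open>closure \<Gamma> \<subseteq> U\<close> g continuous_on_eq_continuous_at by blast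
  moreover have "isCont u (\<Omega> g)"
    using CG_continuous_interior[OF u] G \<Omega> continuous_on_eq_continuous_at by blast
  ultimately have "isCont (\<lambda>y. u (\<Omega> y)) g" by (rule isCont_o2)
  then have "(\<lambda>n. u (\<Omega> (s n))) \<longlonglongrightarrow> u (\<Omega> g)" using s(2) by (rule isCont_tendsto_compose)
  then have 1: "(\<lambda>n. c * u (\<Omega> (s n))) \<longlonglongrightarrow> c * u (\<Omega> g)" by (intro tendsto_intros)
  have "\<forall>\<^sub>F n in sequentially. dist (s n) g < \<epsilon> / 2" using s(2) eps by (intro tendstoD) auto
  then have "\<forall>\<^sub>F n in sequentially. c * u (\<Omega> (s n)) = u (s n)"
  proof eventually_elim
    case (elim n)
    have "s n \<in> closure \<Gamma>" using s(1) closure_subset by blast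
    then show ?case using b elim cond[OF s(1)[of n]] by (simp add: dist_commute)
  qed
  then have "(\<lambda>n. u (s n)) \<longlonglongrightarrow> c * u (\<Omega> g)" by (rule Lim_transform_eventually[OF 1])
  moreover have "(\<lambda>n. u (s n)) \<longlonglongrightarrow> u g"
    using s(1) closure_subset[of \<Gamma>] g sub
    by (intro continuous_on_tendsto_compose[OF CG_continuous[OF u] s(2)]) (auto intro: always_eventually)
  ultimately show ?thesis using LIMSEQ_unique by blast
qed

text \<open>One line for each curve: a union of two lines is closed, and leaving the first and then
  the second by small normal displacements shows that it contains no nonempty open set.\<close>

lemma nonlocal_problem_lines:
  assumes "open G" "bounded G" "connected G" "G \<noteq> {}" "e1 \<noteq> 0" "e2 \<noteq> 0"
    and "\<And>y z c. (y, z, c) \<in> S \<Longrightarrow> y \<notin> G \<and> (c = 0 \<or> Im (cnj e1 * (z - a1)) = 0 \<or> Im (cnj e2 * (z - a2)) = 0)"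
  shows "nonlocal_problem G S ({z. Im (cnj e1 * (z - a1)) = 0} \<union> {z. Im (cnj e2 * (z - a2)) = 0})"
proof
  let ?L = "{z. Im (cnj e1 * (z - a1)) = 0} \<union> {z. Im (cnj e2 * (z - a2)) = 0}"
  show "closed ?L" by (intro closed_Un closed_Collect_eq continuous_intros)
  show "B - ?L \<noteq> {}" if "open B" "B \<noteq> {}" for B
    using avoid_line[OF open_Int[OF that(1) open_complement_line[of e1 a1]] avoid_line[OF that assms(5)] assms(6)] by blast
qed (use assms in auto)

theorem theorem1:
  fixes G \<Gamma>1 \<Gamma>2 :: "complex set" and g1 g2 :: complex and \<epsilon> :: real
  assumes G_open: "open G" and G_conn: "connected G" and G_bdd: "bounded G"
    and G_smooth: "smooth_boundary G"
    and \<Gamma>_sub: "\<Gamma>1 \<subseteq> frontier G" "\<Gamma>2 \<subseteq> frontier G"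
    and \<Gamma>_open: "openin (top_of_set (frontier G)) \<Gamma>1" "openin (top_of_set (frontier G)) \<Gamma>2"
    and \<Gamma>_conn: "connected \<Gamma>1" "connected \<Gamma>2"
    and \<Gamma>_ne: "\<Gamma>1 \<noteq> {}" "\<Gamma>2 \<noteq> {}"
    and \<Gamma>_disj: "\<Gamma>1 \<inter> \<Gamma>2 = {}"
    and g_neq: "g1 \<noteq> g2"
    and K_def: "closure \<Gamma>1 \<inter> closure \<Gamma>2 = {g1, g2}"
    and bdry: "frontier G = \<Gamma>1 \<union> \<Gamma>2 \<union> {g1, g2}"
    and eps: "\<epsilon> > 0"
    and angle: "half_plane_near G g1 \<epsilon>" "half_plane_near G g2 \<epsilon>"
  shows
    "(\<forall>b1 \<Omega>1 U1.
        nonlocal_data G \<Gamma>1 g1 \<epsilon> b1 \<Omega>1 U1 \<and>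
        (\<exists>c>0. \<forall>y\<in>closure \<Gamma>1. y \<in> ball g1 (\<epsilon>/2) \<longrightarrow> b1 y = c) \<and>
        \<Omega>1 g1 \<in> G \<and>
        (\<exists>\<theta> w. \<forall>y\<in>U1 \<inter> ball g1 \<epsilon>. \<Omega>1 y = rot g1 \<theta> y + w)
      \<longrightarrow> (let X = {u\<in>CG G. (\<forall>y\<in>\<Gamma>1. u y - b1 y * u (\<Omega>1 y) = 0) \<and>
                              (\<forall>y\<in>closure \<Gamma>2. u y = 0)}
           in closable G X (lap_graph G X) \<and>
              \<not> feller_generator G X (graph_closure G X (lap_graph G X))))
   \<and>
    (\<forall>b1 b2 \<Omega>1 \<Omega>2 U1 U2 bstar.
        nonlocal_data G \<Gamma>1 g1 \<epsilon> b1 \<Omega>1 U1 \<and> nonlocal_data G \<Gamma>2 g1 \<epsilon> b2 \<Omega>2 U2 \<and>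
        bstar > 0 \<and>
        (\<forall>y\<in>closure \<Gamma>1. y \<in> ball g1 (\<epsilon>/2) \<longrightarrow> b1 y = bstar) \<and>
        (\<forall>y\<in>closure \<Gamma>2. y \<in> ball g1 (\<epsilon>/2) \<longrightarrow> b2 y = bstar) \<and>
        \<Omega>1 g1 \<in> G \<and> \<Omega>2 g1 \<in> G \<and> \<Omega>1 g1 \<noteq> \<Omega>2 g1 \<and>
        (\<exists>\<theta> w. \<forall>y\<in>U1 \<inter> ball g1 \<epsilon>. \<Omega>1 y = rot g1 \<theta> y + w) \<and>
        (\<exists>\<theta> w. \<forall>y\<in>U2 \<inter> ball g1 \<epsilon>. \<Omega>2 y = rot g1 \<theta> y + w)
      \<longrightarrow> (let X = {u\<in>CG G. (\<forall>y\<in>closure \<Gamma>1. u y - b1 y * u (\<Omega>1 y) = 0) \<and>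
                              (\<forall>y\<in>\<Gamma>2. u y - b2 y * u (\<Omega>2 y) = 0)}
           in closable G X (lap_graph G X) \<and>
              \<not> feller_generator G X (graph_closure G X (lap_graph G X))))
   \<and>
    (\<forall>b1 b2 \<Omega>1 \<Omega>2 U1 U2.
        nonlocal_data G \<Gamma>1 g1 \<epsilon> b1 \<Omega>1 U1 \<and> nonlocal_data G \<Gamma>2 g1 \<epsilon> b2 \<Omega>2 U2 \<and>
        (\<forall>y\<in>closure \<Gamma>1. y \<in> ball g1 (\<epsilon>/2) \<longrightarrow> b1 y = 1) \<and>
        (\<forall>y\<in>closure \<Gamma>2. y \<in> ball g1 (\<epsilon>/2) \<longrightarrow> b2 y = 1) \<and>
        \<Omega>1 g1 = g1 \<and> \<Omega>2 g1 = g1 \<and>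
        (\<exists>\<sigma>\<in>{1, -1}. \<forall>y\<in>U1 \<inter> ball g1 \<epsilon>. \<Omega>1 y = rot g1 (\<sigma> * pi / 2) y) \<and>
        (\<exists>\<sigma>\<in>{1, -1}. \<forall>y\<in>U2 \<inter> ball g1 \<epsilon>. \<Omega>2 y = rot g1 (\<sigma> * pi / 2) y)
      \<longrightarrow> (let X = {u\<in>CG G. (\<forall>y\<in>\<Gamma>1. u y - b1 y * u (\<Omega>1 y) = 0) \<and>
                              (\<forall>y\<in>\<Gamma>2. u y - b2 y * u (\<Omega>2 y) = 0) \<and>
                              u g1 = 0 \<and> u g2 = 0}
           in closable G X (lap_graph G X) \<and>
              \<not> feller_generator G X (graph_closure G X (lap_graph G X))))"
proof -
  have G_ne: "G \<noteq> {}" using \<Gamma>_ne(1) \<Gamma>_sub(1) frontier_empty by blast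
  note G = G_open G_bdd G_conn G_ne
  have sub: "closure \<Gamma>1 \<subseteq> frontier G" "closure \<Gamma>2 \<subseteq> frontier G"
    using \<Gamma>_sub by (simp_all add: closure_minimal)
  have sub': "closure \<Gamma>1 \<subseteq> closure G" "closure \<Gamma>2 \<subseteq> closure G"
    using sub by (auto simp: frontier_def)
  have notin: "y \<notin> G" if "y \<in> frontier G" for y using that G_open frontier_disjoint_eq by blast
  have gK: "g1 \<in> closure \<Gamma>1" "g1 \<in> closure \<Gamma>2" using K_def by auto
  have incl: "y \<in> closure \<Gamma>1" if "y \<in> \<Gamma>1" for y using that closure_subset by blast
  have incl2: "y \<in> closure \<Gamma>2" if "y \<in> \<Gamma>2" for y using that closure_subset by blast
  have notin_\<Gamma>: "y \<in> closure \<Gamma>1 \<Longrightarrow> y \<notin> G" "y \<in> closure \<Gamma>2 \<Longrightarrow> y \<notin> G"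
    "y \<in> \<Gamma>1 \<Longrightarrow> y \<notin> G" "y \<in> \<Gamma>2 \<Longrightarrow> y \<notin> G" "g1 \<notin> G" "g2 \<notin> G" for y
    using sub notin \<Gamma>_sub bdry by blast+
  have gfr: "g1 \<in> frontier G" "g2 \<in> frontier G" using bdry by auto
  have closable: "closable G (nonlocal_space G S) (lap_graph G (nonlocal_space G S))" for S
    by (rule closable_lap_graph[OF G(1,2,4) nonlocal_space_subset])
  show ?thesis
  proof (intro conjI allI impI; (elim conjE)?)
    fix b1 \<Omega>1 U1
    assume data: "nonlocal_data G \<Gamma>1 g1 \<epsilon> b1 \<Omega>1 U1"
      and "\<exists>c>0. \<forall>y\<in>closure \<Gamma>1. y \<in> ball g1 (\<epsilon>/2) \<longrightarrow> b1 y = c" and \<Omega>: "\<Omega>1 g1 \<in> G"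
      and rot: "\<exists>\<theta> w. \<forall>y\<in>U1 \<inter> ball g1 \<epsilon>. \<Omega>1 y = rot g1 \<theta> y + w"
    then obtain c where c: "c > 0" "\<forall>y\<in>closure \<Gamma>1. y \<in> ball g1 (\<epsilon>/2) \<longrightarrow> b1 y = c" by blast
    \<comment> \<open>The Dirichlet condition on the closure of \<Gamma>2 becomes triples with
      coefficient 0, where the second point is immaterial and taken equal to the first.\<close>
    define S where "S = (\<lambda>y. (y, \<Omega>1 y, b1 y)) ` \<Gamma>1 \<union> (\<lambda>y. (y, y, 0)) ` closure \<Gamma>2"
    have X: "{u\<in>CG G. (\<forall>y\<in>\<Gamma>1. u y - b1 y * u (\<Omega>1 y) = 0) \<and> (\<forall>y\<in>closure \<Gamma>2. u y = 0)} = nonlocal_space G S"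
      by (auto simp: nonlocal_space_def S_def ball_Un)
    obtain e a where e: "e \<noteq> 0" "\<And>y. y \<in> closure \<Gamma>1 \<Longrightarrow> b1 y = 0 \<or> Im (cnj e * (\<Omega>1 y - a)) = 0"
      using nonlocal_image_in_line[OF G(1) angle(1) data sub(1) rot] by blast
    interpret nonlocal_problem G S "{z. Im (cnj e * (z - a)) = 0} \<union> {z. Im (cnj e * (z - a)) = 0}"
      by (rule nonlocal_problem_lines[OF G e(1) e(1)]) (use e(2) incl notin_\<Gamma> in \<open>auto simp: S_def\<close>)
    have "u (\<Omega>1 g1) = 0" if u: "u \<in> nonlocal_space G S" for u
    proof -
      \<comment> \<open>\<open>g1\<close> belongs to both closures: the Dirichlet side fixes the
        value at \<open>g1\<close>, the nonlocal side transports it to \<Omega>1 g1.\<close>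
      have "u g1 = 0" using u gK(2) by (simp add: X[symmetric])
      moreover have "u g1 = c * u (\<Omega>1 g1)"
        using u by (intro nonlocal_condition_limit[OF G(1) _ data gK(1) eps sub'(1) \<Omega> c(2)]) (auto simp: X[symmetric])
      ultimately show ?thesis using c(1) by simp
    qed
    then show "let X = {u\<in>CG G. (\<forall>y\<in>\<Gamma>1. u y - b1 y * u (\<Omega>1 y) = 0) \<and> (\<forall>y\<in>closure \<Gamma>2. u y = 0)}
           in closable G X (lap_graph G X) \<and> \<not> feller_generator G X (graph_closure G X (lap_graph G X))"
      unfolding Let_def X using closable not_generator_zero[OF \<Omega>] by blast
  next
    fix b1 b2 \<Omega>1 \<Omega>2 U1 U2 bstar
    assume data: "nonlocal_data G \<Gamma>1 g1 \<epsilon> b1 \<Omega>1 U1" "nonlocal_data G \<Gamma>2 g1 \<epsilon> b2 \<Omega>2 U2"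
      and bstar: "bstar > 0" 
      and b: "\<forall>y\<in>closure \<Gamma>1. y \<in> ball g1 (\<epsilon>/2) \<longrightarrow> b1 y = bstar" "\<forall>y\<in>closure \<Gamma>2. y \<in> ball g1 (\<epsilon>/2) \<longrightarrow> b2 y = bstar"
      and \<Omega>: "\<Omega>1 g1 \<in> G" "\<Omega>2 g1 \<in> G" "\<Omega>1 g1 \<noteq> \<Omega>2 g1"
      and rot: "\<exists>\<theta> w. \<forall>y\<in>U1 \<inter> ball g1 \<epsilon>. \<Omega>1 y = rot g1 \<theta> y + w" "\<exists>\<theta> w. \<forall>y\<in>U2 \<inter> ball g1 \<epsilon>. \<Omega>2 y = rot g1 \<theta> y + w"
    define S where "S = (\<lambda>y. (y, \<Omega>1 y, b1 y)) ` closure \<Gamma>1 \<union> (\<lambda>y. (y, \<Omega>2 y, b2 y)) ` \<Gamma>2"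
    have X: "{u\<in>CG G. (\<forall>y\<in>closure \<Gamma>1. u y - b1 y * u (\<Omega>1 y) = 0) \<and> (\<forall>y\<in>\<Gamma>2. u y - b2 y * u (\<Omega>2 y) = 0)} = nonlocal_space G S"
      by (auto simp: nonlocal_space_def S_def ball_Un)
    obtain e1 a1 where e1: "e1 \<noteq> 0" "\<And>y. y \<in> closure \<Gamma>1 \<Longrightarrow> b1 y = 0 \<or> Im (cnj e1 * (\<Omega>1 y - a1)) = 0"
      using nonlocal_image_in_line[OF G(1) angle(1) data(1) sub(1) rot(1)] by blast
    obtain e2 a2 where e2: "e2 \<noteq> 0" "\<And>y. y \<in> closure \<Gamma>2 \<Longrightarrow> b2 y = 0 \<or> Im (cnj e2 * (\<Omega>2 y - a2)) = 0"
      using nonlocal_image_in_line[OF G(1) angle(1) data(2) sub(2) rot(2)] by blast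
    interpret nonlocal_problem G S "{z. Im (cnj e1 * (z - a1)) = 0} \<union> {z. Im (cnj e2 * (z - a2)) = 0}"
      by (rule nonlocal_problem_lines[OF G e1(1) e2(1)]) (use e1(2) e2(2) incl2 notin_\<Gamma> in \<open>auto simp: S_def\<close>)
    \<comment> \<open>Approaching \<open>g1\<close> along either curve gives the same value u(g1),
      and the common factor \<open>bstar\<close> cancels.\<close>
    have "u (\<Omega>1 g1) = u (\<Omega>2 g1)" if u: "u \<in> nonlocal_space G S" for u
    proof -
      have "u g1 = bstar * u (\<Omega>1 g1)"
        using u incl by (intro nonlocal_condition_limit[OF G(1) _ data(1) gK(1) eps sub'(1) \<Omega>(1) b(1)]) (auto simp: X[symmetric])
      moreover have "u g1 = bstar * u (\<Omega>2 g1)"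
        using u by (intro nonlocal_condition_limit[OF G(1) _ data(2) gK(2) eps sub'(2) \<Omega>(2) b(2)]) (auto simp: X[symmetric])
      ultimately show ?thesis using bstar by simp
    qed
    then show "let X = {u\<in>CG G. (\<forall>y\<in>closure \<Gamma>1. u y - b1 y * u (\<Omega>1 y) = 0) \<and> (\<forall>y\<in>\<Gamma>2. u y - b2 y * u (\<Omega>2 y) = 0)}
           in closable G X (lap_graph G X) \<and> \<not> feller_generator G X (graph_closure G X (lap_graph G X))"
      unfolding Let_def X using closable not_generator_identified[OF \<Omega>] by blast
  next
    fix b1 b2 \<Omega>1 \<Omega>2 U1 U2
    assume data: "nonlocal_data G \<Gamma>1 g1 \<epsilon> b1 \<Omega>1 U1" "nonlocal_data G \<Gamma>2 g1 \<epsilon> b2 \<Omega>2 U2"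
      and b: "\<forall>y\<in>closure \<Gamma>1. y \<in> ball g1 (\<epsilon>/2) \<longrightarrow> b1 y = 1" "\<forall>y\<in>closure \<Gamma>2. y \<in> ball g1 (\<epsilon>/2) \<longrightarrow> b2 y = 1"
      and \<Omega>: "\<Omega>1 g1 = g1" "\<Omega>2 g1 = g1"
      and rot: "\<exists>\<sigma>\<in>{1, -1}. \<forall>y\<in>U1 \<inter> ball g1 \<epsilon>. \<Omega>1 y = rot g1 (\<sigma> * pi / 2) y"
        "\<exists>\<sigma>\<in>{1, -1}. \<forall>y\<in>U2 \<inter> ball g1 \<epsilon>. \<Omega>2 y = rot g1 (\<sigma> * pi / 2) y"
    define S where "S = (\<lambda>y. (y, \<Omega>1 y, b1 y)) ` \<Gamma>1 \<union> (\<lambda>y. (y, \<Omega>2 y, b2 y)) ` \<Gamma>2 \<union> {(g1, g1, 0), (g2, g2, 0)}"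
    have X: "{u\<in>CG G. (\<forall>y\<in>\<Gamma>1. u y - b1 y * u (\<Omega>1 y) = 0) \<and> (\<forall>y\<in>\<Gamma>2. u y - b2 y * u (\<Omega>2 y) = 0) \<and>
        u g1 = 0 \<and> u g2 = 0} = nonlocal_space G S"
      by (auto simp: nonlocal_space_def S_def ball_Un)
    obtain \<theta>1 where \<theta>1: "\<And>y. y \<in> U1 \<inter> ball g1 \<epsilon> \<Longrightarrow> \<Omega>1 y = rot g1 \<theta>1 y" using rot(1) by blast
    obtain \<theta>2 where \<theta>2: "\<And>y. y \<in> U2 \<inter> ball g1 \<epsilon> \<Longrightarrow> \<Omega>2 y = rot g1 \<theta>2 y" using rot(2) by blast
    have rot': "\<exists>\<theta> w. \<forall>y\<in>U1 \<inter> ball g1 \<epsilon>. \<Omega>1 y = rot g1 \<theta> y + w"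
      by (rule exI[of _ \<theta>1], rule exI[of _ 0]) (simp add: \<theta>1)
    have rot'': "\<exists>\<theta> w. \<forall>y\<in>U2 \<inter> ball g1 \<epsilon>. \<Omega>2 y = rot g1 \<theta> y + w"
      by (rule exI[of _ \<theta>2], rule exI[of _ 0]) (simp add: \<theta>2)
    obtain e1 a1 where e1: "e1 \<noteq> 0" "\<And>y. y \<in> closure \<Gamma>1 \<Longrightarrow> b1 y = 0 \<or> Im (cnj e1 * (\<Omega>1 y - a1)) = 0"
      using nonlocal_image_in_line[OF G(1) angle(1) data(1) sub(1) rot'] by blast
    obtain e2 a2 where e2: "e2 \<noteq> 0" "\<And>y. y \<in> closure \<Gamma>2 \<Longrightarrow> b2 y = 0 \<or> Im (cnj e2 * (\<Omega>2 y - a2)) = 0"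
      using nonlocal_image_in_line[OF G(1) angle(1) data(2) sub(2) rot''] by blast
    interpret nonlocal_problem G S "{z. Im (cnj e1 * (z - a1)) = 0} \<union> {z. Im (cnj e2 * (z - a2)) = 0}"
      by (rule nonlocal_problem_lines[OF G e1(1) e2(1)]) (use e1(2) e2(2) incl incl2 notin_\<Gamma> in \<open>auto simp: S_def\<close>)
    \<comment> \<open>Within \<epsilon>/2 of \<open>g1\<close> both coefficients equal 1, and
      staying closer than \<open>g2\<close> leaves only points of \<Gamma>1 or \<Gamma>2 on the
      punctured frontier. There the rotation supplies an interior point at the same distance with
      the same value.\<close>
    define d0 where "d0 = min (\<epsilon> / 2) (dist g1 g2)"
    have d0: "d0 > 0" using eps g_neq by (simp add: d0_def)
    have norm_rot: "norm (rot g1 \<theta> y - g1) = norm (y - g1)" for \<theta> y by (simp add: rot_def norm_mult)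
    have refl: "\<exists>x\<in>G. norm (x - g1) = norm (y - g1) \<and> (\<forall>u\<in>nonlocal_space G S. u y = u x)"
      if y: "y \<in> frontier G" "0 < norm (y - g1)" "norm (y - g1) < d0" for y
    proof -
      have ball: "y \<in> ball g1 (\<epsilon> / 2)" "y \<in> ball g1 \<epsilon>" "y \<noteq> g2" "y \<noteq> g1"
        using y eps by (auto simp: d0_def dist_norm norm_minus_commute)
      then consider "y \<in> \<Gamma>1" | "y \<in> \<Gamma>2" using bdry y(1) by blast
      then show ?thesis
      proof cases
        case 1
        have "y \<in> U1" "\<Omega>1 y \<in> G" using data(1) incl[OF 1] 1 unfolding nonlocal_data_def by blast+
        moreover have "\<forall>u\<in>nonlocal_space G S. u y = u (\<Omega>1 y)"
          using b(1) incl[OF 1] ball(1) 1 by (simp add: X[symmetric])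
        ultimately show ?thesis using \<theta>1[of y] ball(2) norm_rot by (intro bexI[of _ "\<Omega>1 y"]) auto
      next
        case 2
        have "y \<in> U2" "\<Omega>2 y \<in> G" using data(2) incl2[OF 2] 2 unfolding nonlocal_data_def by blast+
        moreover have "\<forall>u\<in>nonlocal_space G S. u y = u (\<Omega>2 y)"
          using b(2) incl2[OF 2] ball(1) 2 by (simp add: X[symmetric])
        ultimately show ?thesis using \<theta>2[of y] ball(2) norm_rot by (intro bexI[of _ "\<Omega>2 y"]) auto
      qed
    qed
    have "\<not> feller_generator G (nonlocal_space G S) (graph_closure G (nonlocal_space G S) (lap_graph G (nonlocal_space G S)))"
    proof (rule not_generator_rotation[OF _ _ _ d0 refl])
      show "g1 \<in> closure G" using gfr by (simp add: frontier_def)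
      show "g1 \<notin> G" using notin gfr by blast
      show "u g1 = 0" if "u \<in> nonlocal_space G S" for u using that by (simp add: X[symmetric])
    qed
    then show "let X = {u\<in>CG G. (\<forall>y\<in>\<Gamma>1. u y - b1 y * u (\<Omega>1 y) = 0) \<and> (\<forall>y\<in>\<Gamma>2. u y - b2 y * u (\<Omega>2 y) = 0) \<and>
        u g1 = 0 \<and> u g2 = 0}
           in closable G X (lap_graph G X) \<and> \<not> feller_generator G X (graph_closure G X (lap_graph G X))"
      unfolding Let_def X using closable by blast
  qed
qed

end
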